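(* For every $\alpha\in\mathbb R$ the exact sequence $$0\to\ell_2\to Z_2(\alpha)\to\ell_2\to0$$ is singular (its quotient map is strictly singular), and for $\alpha\ne\beta$ the spaces $Z_2(\alpha)$ and $Z_2(\beta)$ are not isomorphic.
   Context: Scalars are complex, and isomorphic means (complex-)linearly isomorphic. For $\alpha\in\mathbb R$ define on $\ell_2$ the map $\mathscr K_{i\alpha}(x)=x\left(-\log\frac{|x|}{\|x\|}\right)^{1+i\alpha}$ (coordinatewise; $t^{1+i\alpha}=t\,e^{i\alpha\log t}$ for $t>0$, $0^{1+i\alpha}=0$; the $n$-th coordinate is $0$ when $x_n=0$; $\mathscr K_{i\alpha}(0)=0$). $Z_2(\alpha)$ is the twisted Hilbert space induced by $\mathscr K_{i\alpha}$: the space $\{(w,x)\in\mathbb C^{\mathbb N}\times\ell_2: w-\mathscr K_{i\alpha}(x)\in\ell_2\}$ with the quasi-norm $\|w-\mathscr K_{i\alpha}(x)\|_2+\|x\|_2$ (which is equivalent to a norm). The maps in the exact sequence are $y\mapsto(y,0)$ and $(w,x)\mapsto x$. An operator is strictly singular if no restriction of it to an infinite dimensional closed subspace is an isomorphism onto its image. *)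

theory Defs
  imports "HOL-Analysis.Analysis" "HOL-Library.Function_Algebras"
begin

text \<open>
  Complex quasi-normed spaces on a carrier set inside an ambient type. Addition is that of the
  ambient type; for sequences and pairs of sequences it is pointwise.
\<close>

record 'v quasi_normed =
  qspace :: "'v set"
  qscale :: "complex \<Rightarrow> 'v \<Rightarrow> 'v"
  qnorm :: "'v \<Rightarrow> real"

definition quasi_normed_space :: "'v::ab_group_add quasi_normed \<Rightarrow> bool" where
  "quasi_normed_space X \<longleftrightarrow>
     vector_space (qscale X) \<and> module.subspace (qscale X) (qspace X) \<and>
     (\<forall>x\<in>qspace X. 0 \<le> qnorm X x \<and> (qnorm X x = 0 \<longleftrightarrow> x = 0)) \<and>
     (\<forall>c. \<forall>x\<in>qspace X. qnorm X (qscale X c x) = cmod c * qnorm X x) \<and>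
     (\<exists>C. \<forall>x\<in>qspace X. \<forall>y\<in>qspace X. qnorm X (x + y) \<le> C * (qnorm X x + qnorm X y))"

text \<open>
  The balls of a quasi-norm need not be open, so the topology is given by the sets that contain
  a ball around each of their points.
\<close>

definition qopen :: "'v::ab_group_add quasi_normed \<Rightarrow> 'v set \<Rightarrow> bool" where
  "qopen X U \<longleftrightarrow> U \<subseteq> qspace X \<and>
     (\<forall>x\<in>U. \<exists>e>0. \<forall>y\<in>qspace X. qnorm X (y - x) < e \<longrightarrow> y \<in> U)"

definition qtop :: "'v::ab_group_add quasi_normed \<Rightarrow> 'v topology" where
  "qtop X = topology (qopen X)"

lemma istopology_qopen: "istopology (qopen X)"
  unfolding istopology_def
proof (intro conjI allI impI)
  fix S T assume S: "qopen X S" and T: "qopen X T"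
  show "qopen X (S \<inter> T)"
    unfolding qopen_def
  proof (intro conjI ballI)
    show "S \<inter> T \<subseteq> qspace X" using S by (auto simp: qopen_def)
    fix x assume x: "x \<in> S \<inter> T"
    obtain d where "d > 0" "\<forall>y\<in>qspace X. qnorm X (y - x) < d \<longrightarrow> y \<in> S"
      using S x unfolding qopen_def by blast
    moreover obtain e where "e > 0" "\<forall>y\<in>qspace X. qnorm X (y - x) < e \<longrightarrow> y \<in> T"
      using T x unfolding qopen_def by blast
    ultimately show "\<exists>e>0. \<forall>y\<in>qspace X. qnorm X (y - x) < e \<longrightarrow> y \<in> S \<inter> T"
      by (intro exI[of _ "min d e"]) auto
  qed
next
  fix \<K> assume "\<forall>K\<in>\<K>. qopen X K"
  then show "qopen X (\<Union>\<K>)"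
    unfolding qopen_def by (meson Union_iff Union_least)
qed

lemma openin_qtop: "openin (qtop X) = qopen X"
  unfolding qtop_def by (rule topology_inverse'[OF istopology_qopen])

lemma topspace_qtop: "topspace (qtop X) = qspace X"
proof -
  have "qopen X (qspace X)"
    unfolding qopen_def by (auto intro: exI[of _ 1])
  then show ?thesis
    unfolding topspace_def openin_qtop
    by (metis (no_types, lifting) Union_upper Union_least mem_Collect_eq qopen_def subset_antisym)
qed

definition linear_map ::
  "'v::ab_group_add quasi_normed \<Rightarrow> 'w::ab_group_add quasi_normed \<Rightarrow> ('v \<Rightarrow> 'w) \<Rightarrow> bool" where
  "linear_map X Y T \<longleftrightarrow>
     T ` qspace X \<subseteq> qspace Y \<and>
     (\<forall>x\<in>qspace X. \<forall>y\<in>qspace X. T (x + y) = T x + T y) \<and>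
     (\<forall>c. \<forall>x\<in>qspace X. T (qscale X c x) = qscale Y c (T x))"

definition bounded_operator ::
  "'v::ab_group_add quasi_normed \<Rightarrow> 'w::ab_group_add quasi_normed \<Rightarrow> ('v \<Rightarrow> 'w) \<Rightarrow> bool" where
  "bounded_operator X Y T \<longleftrightarrow> linear_map X Y T \<and> continuous_map (qtop X) (qtop Y) T"

definition isomorphism ::
  "'v::ab_group_add quasi_normed \<Rightarrow> 'w::ab_group_add quasi_normed \<Rightarrow> ('v \<Rightarrow> 'w) \<Rightarrow> bool" where
  "isomorphism X Y T \<longleftrightarrow> linear_map X Y T \<and> homeomorphic_map (qtop X) (qtop Y) T"

definition isomorphic ::
  "'v::ab_group_add quasi_normed \<Rightarrow> 'w::ab_group_add quasi_normed \<Rightarrow> bool" where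
  "isomorphic X Y \<longleftrightarrow> (\<exists>T. isomorphism X Y T)"

definition restrict_space_to :: "'v quasi_normed \<Rightarrow> 'v set \<Rightarrow> 'v quasi_normed" where
  "restrict_space_to X V = X\<lparr>qspace := V\<rparr>"

definition closed_subspace :: "'v::ab_group_add quasi_normed \<Rightarrow> 'v set \<Rightarrow> bool" where
  "closed_subspace X V \<longleftrightarrow> module.subspace (qscale X) V \<and> closedin (qtop X) V"

definition infinite_dimensional :: "'v::ab_group_add quasi_normed \<Rightarrow> 'v set \<Rightarrow> bool" where
  "infinite_dimensional X V \<longleftrightarrow> \<not> (\<exists>B. finite B \<and> B \<subseteq> V \<and> V \<subseteq> module.span (qscale X) B)"

definition strictly_singular ::
  "'v::ab_group_add quasi_normed \<Rightarrow> 'w::ab_group_add quasi_normed \<Rightarrow> ('v \<Rightarrow> 'w) \<Rightarrow> bool" where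
  "strictly_singular X Y T \<longleftrightarrow> bounded_operator X Y T \<and>
     \<not> (\<exists>V. closed_subspace X V \<and> infinite_dimensional X V \<and>
           isomorphism (restrict_space_to X V) (restrict_space_to Y (T ` V)) T)"

text \<open>Exactness of \<open>0 \<rightarrow> Y \<rightarrow> X \<rightarrow> Z \<rightarrow> 0\<close> with maps \<open>j\<close> and \<open>q\<close>.\<close>

definition short_exact ::
  "'u::ab_group_add quasi_normed \<Rightarrow> 'v::ab_group_add quasi_normed \<Rightarrow> 'w::ab_group_add quasi_normed
    \<Rightarrow> ('u \<Rightarrow> 'v) \<Rightarrow> ('v \<Rightarrow> 'w) \<Rightarrow> bool" where
  "short_exact Y X Z j q \<longleftrightarrow>
     quasi_normed_space Y \<and> quasi_normed_space X \<and> quasi_normed_space Z \<and>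
     bounded_operator Y X j \<and> bounded_operator X Z q \<and>
     inj_on j (qspace Y) \<and> j ` qspace Y = {x \<in> qspace X. q x = 0} \<and> q ` qspace X = qspace Z"

definition singular_exact_sequence ::
  "'u::ab_group_add quasi_normed \<Rightarrow> 'v::ab_group_add quasi_normed \<Rightarrow> 'w::ab_group_add quasi_normed
    \<Rightarrow> ('u \<Rightarrow> 'v) \<Rightarrow> ('v \<Rightarrow> 'w) \<Rightarrow> bool" where
  "singular_exact_sequence Y X Z j q \<longleftrightarrow> short_exact Y X Z j q \<and> strictly_singular X Z q"

type_synonym cseq = "nat \<Rightarrow> complex"

definition seq_scale :: "complex \<Rightarrow> cseq \<Rightarrow> cseq" where
  "seq_scale c x = (\<lambda>n. c * x n)"

definition l2_set :: "cseq set" where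
  "l2_set = {x. summable (\<lambda>n. (cmod (x n))\<^sup>2)}"

definition l2_norm :: "cseq \<Rightarrow> real" where
  "l2_norm x = sqrt (\<Sum>n. (cmod (x n))\<^sup>2)"

definition l2 :: "cseq quasi_normed" where
  "l2 = \<lparr>qspace = l2_set, qscale = seq_scale, qnorm = l2_norm\<rparr>"

text \<open>
  On \<open>l2_set\<close> the base of the power is a nonnegative real, so the complex power is the one of
  lemma \<open>powr_one_plus_i\<close>. Coordinates with \<open>x n = 0\<close> give \<open>0\<close> because of the factor \<open>x n\<close>;
  in particular \<open>KP_map \<alpha> 0 = 0\<close>.
\<close>

definition KP_map :: "real \<Rightarrow> cseq \<Rightarrow> cseq" where
  "KP_map \<alpha> x = (\<lambda>n. x n *
     complex_of_real (- ln (cmod (x n) / l2_norm x)) powr (1 + \<i> * complex_of_real \<alpha>))"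

lemma powr_one_plus_i:
  fixes t \<alpha> :: real
  assumes "t \<ge> 0"
  shows "complex_of_real t powr (1 + \<i> * complex_of_real \<alpha>) =
    (if t = 0 then 0
     else complex_of_real t * exp (\<i> * complex_of_real \<alpha> * complex_of_real (ln t)))"
  using assms
  by (auto simp: powr_def algebra_simps exp_add Ln_of_real exp_of_real)

definition Z2 :: "real \<Rightarrow> (cseq \<times> cseq) quasi_normed" where
  "Z2 \<alpha> =
    \<lparr>qspace = {(w, x). x \<in> l2_set \<and> w - KP_map \<alpha> x \<in> l2_set},
     qscale = (\<lambda>c (w, x). (seq_scale c w, seq_scale c x)),
     qnorm = (\<lambda>(w, x). l2_norm (w - KP_map \<alpha> x) + l2_norm x)\<rparr>"

end

theory Submission imports Defs begin

text \<open>
  Write \<open>\<phi>\<^sub>a(t) = t\<^sup>1\<^sup>+\<^sup>i\<^sup>a\<close>; it is Lipschitz on \<open>t \<ge> 0\<close>, which makes the Kalton--Peck maps quasi-linear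
  and lets vectors of \<open>Z2\<close> be truncated to sets of coordinates. Let \<open>(w\<^sub>n, x\<^sub>n)\<close> be a bounded
  coordinatewise null sequence in \<open>Z2 b\<close> with \<open>\<parallel>x\<^sub>n\<parallel>\<close> bounded below. After a gliding hump argument the
  \<open>x\<^sub>n\<close> are disjoint, and on the block of \<open>x\<^sub>n\<close> a sum of \<open>N\<close> terms has, up to bounded errors, the fibre
  component \<open>x\<^sub>n (\<phi>\<^sub>b(s) - \<phi>\<^sub>b(s + t))\<close> with \<open>t = ln N / 2\<close> and \<open>s = ln (\<parallel>x\<^sub>n\<parallel> / \<bar>x\<^sub>n\<bar>)\<close>. Since
  \<open>\<bar>\<phi>\<^sub>b(s + t) - \<phi>\<^sub>b(s)\<bar> \<ge> t\<close>, such sums are never \<open>O(\<surd>N)\<close>; this gives singularity, because an infinite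
  dimensional subspace on which the quotient map is an isomorphism would contain a sequence with
  \<open>O(\<surd>N)\<close> sums.

  Let \<open>S\<close> embed \<open>Z2 a\<close> into \<open>Z2 b\<close>. By the previous remark \<open>S(e\<^sub>n, 0)\<close> is asymptotically of the form
  \<open>(y\<^sub>n, 0)\<close>, and \<open>S(0, e\<^sub>n)\<close> has quotient component \<open>x\<^sub>n\<close> bounded below. As the sum of \<open>N\<close> vectors
  \<open>(\<phi>\<^sub>a(t) e\<^sub>n, e\<^sub>n)\<close> has quasi-norm \<open>\<surd>N\<close>, for every finite set of values \<open>t\<close> some \<open>n\<close> satisfies
  \<open>\<parallel>\<phi>\<^sub>a(t) y\<^sub>n - x\<^sub>n (\<phi>\<^sub>b(s + t) - \<phi>\<^sub>b(s))\<parallel> \<le> C\<close>. Hence \<open>(\<phi>\<^sub>b(s + t) - \<phi>\<^sub>b(s)) / \<phi>\<^sub>a(t)\<close> is almost independent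
  of large \<open>t\<close> on most of the mass of \<open>x\<^sub>n\<close>. But for \<open>s \<gg> t\<close> this quotient behaves like a multiple of
  \<open>t\<^sup>-\<^sup>i\<^sup>a\<close>, and for \<open>s \<ll> t\<close> like \<open>t\<^sup>i\<^sup>(\<^sup>b\<^sup>-\<^sup>a\<^sup>)\<close>, which oscillate when \<open>a \<noteq> 0\<close> and \<open>a \<noteq> b\<close>.
\<close>

section \<open>Sequences in \<open>l2\<close> and truncations\<close>

lemma sum_fun_apply: "(\<Sum>n\<in>A. f n) k = (\<Sum>n\<in>A. f n k)"
  for f :: "'a \<Rightarrow> 'b \<Rightarrow> 'c::comm_monoid_add"
  by (induction A rule: infinite_finite_induct) auto

lemma L2_set_le_l2_norm:
  assumes "x \<in> l2_set" "finite S"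
  shows "L2_set (\<lambda>k. cmod (x k)) S \<le> l2_norm x"
  using assms unfolding L2_set_def l2_norm_def l2_set_def
  by (auto intro!: sum_le_suminf)

text \<open>Finite sections control both membership and the norm, so Minkowski's inequality for
  \<open>L2_set\<close> on finite sets carries over to sequences without separate summability
  arguments.\<close>

lemma l2_normI:
  assumes "\<And>S. finite S \<Longrightarrow> L2_set (\<lambda>k. cmod (x k)) S \<le> B"
  shows "x \<in> l2_set" "l2_norm x \<le> B"
proof -
  have B: "0 \<le> B" using assms[of "{}"] by simp
  have *: "(\<Sum>k<n. (cmod (x k))\<^sup>2) \<le> B\<^sup>2" for n
  proof -
    have "sqrt (\<Sum>k<n. (cmod (x k))\<^sup>2) \<le> B"
      using assms[of "{..<n}"] by (simp add: L2_set_def)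
    then show ?thesis using real_sqrt_le_iff[of _ "B\<^sup>2"] B by (simp add: real_sqrt_abs)
  qed
  have s: "summable (\<lambda>k. (cmod (x k))\<^sup>2)"
    by (rule summableI_nonneg_bounded[OF _ *]) auto
  then show "x \<in> l2_set" by (simp add: l2_set_def)
  have "(\<Sum>k. (cmod (x k))\<^sup>2) \<le> B\<^sup>2" by (rule suminf_le_const[OF s *])
  then show "l2_norm x \<le> B"
    unfolding l2_norm_def using B real_le_lsqrt by blast
qed

lemma l2_norm_nonneg: "x \<in> l2_set \<Longrightarrow> 0 \<le> l2_norm x"
  using L2_set_le_l2_norm[of x "{}"] by simp

lemma cmod_le_l2_norm: "x \<in> l2_set \<Longrightarrow> cmod (x k) \<le> l2_norm x"
  using L2_set_le_l2_norm[of x "{k}"] by simp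

lemma l2_norm_power2: "x \<in> l2_set \<Longrightarrow> (l2_norm x)\<^sup>2 = (\<Sum>k. (cmod (x k))\<^sup>2)"
  unfolding l2_norm_def l2_set_def by (simp add: suminf_nonneg)

text \<open>Minkowski on finite sections. Closure under sums, scalar multiples and pointwise
  domination are all special cases, as is the final comparison in
  \<open>no_embedding\<close>.\<close>

lemma l2_dominated2:
  assumes "y \<in> l2_set" "z \<in> l2_set" "0 \<le> c"
    and "\<And>k. cmod (x k) \<le> c * (cmod (y k) + cmod (z k))"
  shows "x \<in> l2_set" "l2_norm x \<le> c * (l2_norm y + l2_norm z)"
proof -
  have "L2_set (\<lambda>k. cmod (x k)) S \<le> c * (l2_norm y + l2_norm z)" if "finite S" for S
  proof -
    have "L2_set (\<lambda>k. cmod (x k)) S \<le> L2_set (\<lambda>k. c * (cmod (y k) + cmod (z k))) S"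
      using assms by (intro L2_set_mono) auto
    also have "\<dots> = c * L2_set (\<lambda>k. cmod (y k) + cmod (z k)) S"
      using assms(3) by (simp add: L2_set_right_distrib)
    also have "\<dots> \<le> c * (L2_set (\<lambda>k. cmod (y k)) S + L2_set (\<lambda>k. cmod (z k)) S)"
      using assms(3) by (intro mult_left_mono L2_set_triangle_ineq)
    also have "\<dots> \<le> c * (l2_norm y + l2_norm z)"
      using assms that by (intro mult_left_mono add_mono L2_set_le_l2_norm)
    finally show ?thesis .
  qed
  then show "x \<in> l2_set" "l2_norm x \<le> c * (l2_norm y + l2_norm z)"
    by (auto intro: l2_normI)
qed

lemma l2_zero [simp]: "0 \<in> l2_set" "l2_norm 0 = 0"
  by (simp_all add: l2_set_def l2_norm_def)

lemma l2_dominated: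
  assumes "y \<in> l2_set" "0 \<le> c" "\<And>k. cmod (x k) \<le> c * cmod (y k)"
  shows "x \<in> l2_set" "l2_norm x \<le> c * l2_norm y"
  using l2_dominated2[of y 0 c x] assms by auto

lemma l2_norm_mono:
  assumes "y \<in> l2_set" "\<And>k. cmod (x k) \<le> cmod (y k)"
  shows "x \<in> l2_set" "l2_norm x \<le> l2_norm y"
  using l2_dominated[of y 1 x] assms by auto

lemma l2_add:
  assumes "x \<in> l2_set" "y \<in> l2_set"
  shows "x + y \<in> l2_set" "l2_norm (x + y) \<le> l2_norm x + l2_norm y"
  using l2_dominated2[of x y 1 "x + y"] assms by (auto simp: norm_triangle_ineq)

lemma l2_diff:
  assumes "x \<in> l2_set" "y \<in> l2_set"
  shows "x - y \<in> l2_set" "l2_norm (x - y) \<le> l2_norm x + l2_norm y"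
  using l2_dominated2[of x y 1 "x - y"] assms by (auto simp: norm_triangle_ineq4)

lemma l2_scale:
  assumes "x \<in> l2_set"
  shows "seq_scale c x \<in> l2_set" "l2_norm (seq_scale c x) = cmod c * l2_norm x"
proof -
  have *: "seq_scale c x \<in> l2_set" "l2_norm (seq_scale c x) \<le> cmod c * l2_norm x"
    if "x \<in> l2_set" for c x
    using l2_dominated[of x "cmod c" "seq_scale c x"] that by (auto simp: seq_scale_def norm_mult)
  show "seq_scale c x \<in> l2_set" using * assms by blast
  show "l2_norm (seq_scale c x) = cmod c * l2_norm x"
  proof (cases "c = 0")
    case True
    then have "seq_scale c x = 0" by (auto simp: seq_scale_def)
    then show ?thesis using True by simp
  next
    case False
    have "x = seq_scale (1 / c) (seq_scale c x)" using False by (auto simp: seq_scale_def)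
    then have "l2_norm x \<le> cmod (1 / c) * l2_norm (seq_scale c x)"
      using *(2)[OF *(1)[OF assms], of "1 / c" c] by simp
    then have "cmod c * l2_norm x \<le> l2_norm (seq_scale c x)"
      using False by (simp add: norm_divide field_simps)
    then show ?thesis using *(2)[OF assms, of c] by simp
  qed
qed

lemma l2_norm_eq_0: "x \<in> l2_set \<Longrightarrow> l2_norm x = 0 \<longleftrightarrow> x = 0"
  using cmod_le_l2_norm[of x] l2_zero(2) by (metis ext norm_le_zero_iff zero_fun_apply)

lemma l2_sum:
  assumes "\<And>n. n \<in> A \<Longrightarrow> x n \<in> l2_set"
  shows "(\<Sum>n\<in>A. x n) \<in> l2_set"
  using assms by (induction A rule: infinite_finite_induct) (auto intro: l2_add)

section \<open>Truncation to sets of coordinates and disjoint blocks\<close>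

definition trunc :: "nat set \<Rightarrow> cseq \<Rightarrow> cseq" where
  "trunc J x = (\<lambda>k. if k \<in> J then x k else 0)"

lemma trunc_apply [simp]: "trunc J x k = (if k \<in> J then x k else 0)"
  by (simp add: trunc_def)

lemma trunc_simps:
  "trunc J (x + y) = trunc J x + trunc J y" "trunc J (x - y) = trunc J x - trunc J y"
  "x - trunc J x = trunc (- J) x"
  by (auto simp: fun_eq_iff)

lemma l2_trunc:
  assumes "x \<in> l2_set" shows "trunc J x \<in> l2_set" "l2_norm (trunc J x) \<le> l2_norm x"
  using l2_norm_mono[OF assms, of "trunc J x"] by auto

lemma l2_norm_trunc_union:
  assumes "x \<in> l2_set" "I \<inter> J = {}"
  shows "(l2_norm (trunc (I \<union> J) x))\<^sup>2 = (l2_norm (trunc I x))\<^sup>2 + (l2_norm (trunc J x))\<^sup>2"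
proof -
  have s: "summable (\<lambda>k. (cmod (trunc I x k))\<^sup>2)" for I
    using l2_trunc(1)[OF assms(1), of I] unfolding l2_set_def by blast
  have "(\<Sum>k. (cmod (trunc (I \<union> J) x k))\<^sup>2) = (\<Sum>k. (cmod (trunc I x k))\<^sup>2 + (cmod (trunc J x k))\<^sup>2)"
    using assms(2) by (intro suminf_cong) auto
  then show ?thesis
    using suminf_add[OF s[of I] s[of J]] assms(1) by (simp only: l2_norm_power2 l2_trunc)
qed

lemma l2_norm_trunc_UN:
  assumes "x \<in> l2_set" "finite A" "disjoint_family J"
  shows "(l2_norm (trunc (\<Union>m\<in>A. J m) x))\<^sup>2 = (\<Sum>m\<in>A. (l2_norm (trunc (J m) x))\<^sup>2)"
  using assms(2)
proof (induction A rule: finite_induct)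
  case empty
  have "trunc {} x = 0" by (simp add: fun_eq_iff)
  then show ?case by (metis UN_empty l2_zero(2) power2_eq_square mult_zero_left sum.empty)
next
  case (insert a A)
  have "J a \<inter> J m = {}" if "m \<in> A" for m
  proof -
    have "a \<noteq> m" using that insert.hyps by auto
    then show ?thesis using assms(3) by (simp add: disjoint_family_on_def)
  qed
  then have "J a \<inter> (\<Union>m\<in>A. J m) = {}" by auto
  then show ?case
    using l2_norm_trunc_union[OF assms(1), of "J a" "\<Union>m\<in>A. J m"] insert.IH
    by (simp only: UN_insert sum.insert[OF insert.hyps])
qed

lemma sum_l2_norm_trunc_le:
  assumes "x \<in> l2_set" "finite A" "disjoint_family J"
  shows "(\<Sum>m\<in>A. (l2_norm (trunc (J m) x))\<^sup>2) \<le> (l2_norm x)\<^sup>2"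
  using l2_norm_trunc_UN[OF assms] l2_trunc(2)[OF assms(1)]
  by (metis l2_norm_nonneg l2_trunc(1)[OF assms(1)] power_mono)

lemma trunc_block_sum:
  fixes x :: "nat \<Rightarrow> cseq"
  assumes "finite A" "disjoint_family J" "m \<in> A"
  shows "trunc (J m) (\<Sum>n\<in>A. trunc (J n) (x n)) = trunc (J m) (x m)"
proof
  fix k
  have "(\<Sum>n\<in>A. if k \<in> J n then x n k else 0) = x m k" if "k \<in> J m"
  proof -
    have "(\<Sum>n\<in>A. if k \<in> J n then x n k else 0) = (\<Sum>n\<in>A. if n = m then x n k else 0)"
      using assms(2) that by (intro sum.cong) (auto simp: disjoint_family_on_def)
    then show ?thesis using assms by simp
  qed
  then show "trunc (J m) (\<Sum>n\<in>A. trunc (J n) (x n)) k = trunc (J m) (x m) k"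
    by (simp add: sum_fun_apply)
qed

text \<open>Pythagoras for disjoint supports: the sum lives on the union of the blocks, and its
  restriction to each block is a single summand.\<close>

lemma l2_norm_block_sum:
  fixes x :: "nat \<Rightarrow> cseq"
  assumes "finite A" "disjoint_family J" "\<And>n. n \<in> A \<Longrightarrow> x n \<in> l2_set"
  shows "(l2_norm (\<Sum>n\<in>A. trunc (J n) (x n)))\<^sup>2 = (\<Sum>n\<in>A. (l2_norm (trunc (J n) (x n)))\<^sup>2)"
proof -
  let ?f = "\<Sum>n\<in>A. trunc (J n) (x n)"
  have f: "?f \<in> l2_set" using assms(3) by (intro l2_sum l2_trunc)
  have "trunc (\<Union>m\<in>A. J m) ?f = ?f"
    by (auto simp: fun_eq_iff sum_fun_apply)
  then have "(l2_norm ?f)\<^sup>2 = (\<Sum>m\<in>A. (l2_norm (trunc (J m) ?f))\<^sup>2)"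
    using l2_norm_trunc_UN[of ?f A J, OF f assms(1,2)] by simp
  also have "\<dots> = (\<Sum>n\<in>A. (l2_norm (trunc (J n) (x n)))\<^sup>2)"
    by (intro sum.cong refl) (simp only: trunc_block_sum[OF assms(1,2)])
  finally show ?thesis .
qed

section \<open>The Kalton--Peck map\<close>

lemma cmod_cis_diff_le: "cmod (cis x - cis y) \<le> \<bar>x - y\<bar>"
proof -
  have "cis x - cis y = cis y * (cis (x - y) - 1)"
    by (simp add: algebra_simps cis_mult)
  moreover have "cmod (cis (x - y) - 1) = 2 * \<bar>sin ((x - y) / 2)\<bar>"
    using dist_exp_i_1[of "x - y"] by (simp add: cis_conv_exp)
  ultimately show ?thesis
    using abs_sin_x_le_abs_x[of "(x - y) / 2"] by (simp add: norm_mult)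
qed

section \<open>Complex powers and logarithmic bounds\<close>

definition phi :: "real \<Rightarrow> real \<Rightarrow> complex" where
  "phi a t = complex_of_real t * cis (a * ln t)"

lemma phi_0 [simp]: "phi a 0 = 0"
  by (simp add: phi_def)

lemma norm_phi: "0 \<le> t \<Longrightarrow> cmod (phi a t) = t"
  by (simp add: phi_def norm_mult)

text \<open>The difference splits into a change of modulus and a rotation. For \<open>t <= s\<close>
  the rotation costs at most \<open>t * \<bar>a\<bar> * ln (s / t)\<close>, hence at most
  \<open>\<bar>a\<bar> * (s - t)\<close>: the factor \<open>t\<close> absorbs the singularity of the
  logarithm at \<open>0\<close>.\<close>

lemma phi_lipschitz:
  assumes "0 \<le> s" "0 \<le> t"
  shows "cmod (phi a s - phi a t) \<le> (1 + \<bar>a\<bar>) * \<bar>s - t\<bar>"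
  using assms
proof (induction s t rule: linorder_wlog)
  case (sym s t)
  then show ?case by (simp add: norm_minus_commute abs_minus_commute)
next
  case (le t s)
  show ?case
  proof (cases "t = 0")
    case True
    then show ?thesis using le by (simp add: norm_phi mult_le_cancel_right1)
  next
    case False
    have "phi a s - phi a t = of_real (s - t) * cis (a * ln s) + of_real t * (cis (a * ln s) - cis (a * ln t))"
      by (simp add: phi_def algebra_simps)
    also have "cmod \<dots> \<le> (s - t) + t * cmod (cis (a * ln s) - cis (a * ln t))"
      using le by (intro order_trans[OF norm_triangle_ineq]) (simp add: norm_mult del: of_real_diff)
    also have "cmod (cis (a * ln s) - cis (a * ln t)) \<le> \<bar>a * (ln s - ln t)\<bar>"
      using cmod_cis_diff_le[of "a * ln s" "a * ln t"] by (simp add: algebra_simps)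
    also have "\<dots> = \<bar>a\<bar> * ln (s / t)"
      using le False by (simp add: abs_mult ln_div)
    also have "ln (s / t) \<le> s / t - 1"
      using le False by (intro ln_le_minus_one) auto
    also have "s - t + t * (\<bar>a\<bar> * (s / t - 1)) = (1 + \<bar>a\<bar>) * \<bar>s - t\<bar>"
      using le False by (simp add: field_simps)
    finally show ?thesis using le by (simp add: norm_minus_commute mult_left_mono abs_minus_commute)
  qed
qed

text \<open>The upper bounds apply \<open>ln v \<le> v - 1\<close> to \<open>m / u\<close> and to
  \<open>sqrt (m / u)\<close>. The first is uniform in \<open>u\<close>; the second tends to
  \<open>0\<close> with \<open>u\<close>, which controls tails and coordinatewise limits.\<close>

lemma mult_ln_div_le:
  fixes u m :: real
  assumes "0 \<le> u" "u \<le> m"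
  shows "0 \<le> u * ln (m / u)" "u * ln (m / u) \<le> m" "u * ln (m / u) \<le> 2 * sqrt (m * u)"
proof -
  show "0 \<le> u * ln (m / u)"
    using assms by (cases "u = 0") (auto intro!: mult_nonneg_nonneg)
  show "u * ln (m / u) \<le> m"
  proof (cases "u = 0")
    case False
    then have "ln (m / u) \<le> m / u - 1" using assms by (intro ln_le_minus_one) auto
    then have "u * ln (m / u) \<le> u * (m / u - 1)" using assms by (intro mult_left_mono) auto
    then show ?thesis using False assms by (simp add: algebra_simps)
  qed (use assms in auto)
  show "u * ln (m / u) \<le> 2 * sqrt (m * u)"
  proof (cases "u = 0")
    case False
    then have p: "0 < u" "0 < m / u" using assms by auto
    have "ln (m / u) = 2 * ln (sqrt (m / u))" using p by (simp add: ln_sqrt)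
    also have "\<dots> \<le> 2 * sqrt (m / u)"
      using ln_le_minus_one[of "sqrt (m / u)"] p by simp
    finally have "u * ln (m / u) \<le> 2 * (u * sqrt (m / u))" using p by simp
    also have "u * sqrt (m / u) = sqrt (m * u)"
      using p by (simp add: real_sqrt_divide real_sqrt_mult field_simps)
    finally show ?thesis .
  qed (use assms in auto)
qed

text \<open>One coordinate of the Kalton--Peck map, with the norm of the vector replaced by \<open>r\<close>.\<close>

definition Om :: "real \<Rightarrow> real \<Rightarrow> complex \<Rightarrow> complex" where
  "Om a r z = z * phi a (ln (r / cmod z))"

lemma Om_0 [simp]: "Om a r 0 = 0"
  by (simp add: Om_def)

lemma norm_Om: "cmod z \<le> r \<Longrightarrow> cmod (Om a r z) = cmod z * ln (r / cmod z)"
  by (cases "z = 0") (auto simp: Om_def norm_mult norm_phi)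

lemma Om_scale: "c \<noteq> 0 \<Longrightarrow> Om a (cmod c * r) (c * z) = c * Om a r z"
  by (simp add: Om_def norm_mult)

text \<open>\<open>phi\<close> is Lipschitz and \<open>ln (r / cmod v)\<close> differs from
  \<open>ln (r / m)\<close> by \<open>ln (m / cmod v)\<close>, so the deviation from a linear
  function of \<open>v\<close> is bounded independently of \<open>r\<close>.\<close>

lemma Om_base:
  assumes "cmod v \<le> m" "m \<le> r"
  shows "cmod (Om a r v - v * phi a (ln (r / m))) \<le> (1 + \<bar>a\<bar>) * (cmod v * ln (m / cmod v))"
proof (cases "v = 0")
  case False
  then have p: "0 < cmod v" by simp
  then have p: "0 < cmod v" "0 < m" "0 < r" using assms by linarith+
  have "cmod (Om a r v - v * phi a (ln (r / m)))
      = cmod v * cmod (phi a (ln (r / cmod v)) - phi a (ln (r / m)))"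
    by (simp add: Om_def norm_mult flip: right_diff_distrib)
  also have "\<dots> \<le> cmod v * ((1 + \<bar>a\<bar>) * \<bar>ln (r / cmod v) - ln (r / m)\<bar>)"
    using p assms by (intro mult_left_mono phi_lipschitz) auto
  also have "\<bar>ln (r / cmod v) - ln (r / m)\<bar> = ln (m / cmod v)"
    using p assms by (simp add: ln_div)
  finally show ?thesis by (simp add: mult.left_commute)
qed simp

lemma Om_add:
  assumes "cmod z + cmod z' \<le> r"
  shows "cmod (Om a r (z + z') - Om a r z - Om a r z') \<le> 3 * (1 + \<bar>a\<bar>) * (cmod z + cmod z')"
proof -
  \<comment> \<open>Comparing all three terms with the linear function \<open>v \<mapsto> v * phi a (ln (r / m))\<close> avoids a logarithm of the
    possibly tiny \<open>cmod (z + z')\<close>.\<close>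
  define m where "m = cmod z + cmod z'"
  have b: "cmod (Om a r v - v * phi a (ln (r / m))) \<le> (1 + \<bar>a\<bar>) * m" if "cmod v \<le> m" for v
  proof -
    have "cmod (Om a r v - v * phi a (ln (r / m))) \<le> (1 + \<bar>a\<bar>) * (cmod v * ln (m / cmod v))"
      using Om_base[OF that] assms by (simp add: m_def)
    also have "\<dots> \<le> (1 + \<bar>a\<bar>) * m"
      using mult_ln_div_le(2)[of "cmod v" m] that by (intro mult_left_mono) auto
    finally show ?thesis .
  qed
  let ?p = "phi a (ln (r / m))"
  have "Om a r (z + z') - Om a r z - Om a r z'
      = (Om a r (z + z') - (z + z') * ?p) - (Om a r z - z * ?p) - (Om a r z' - z' * ?p)"
    by (simp add: algebra_simps)
  also have "cmod \<dots> \<le> (1 + \<bar>a\<bar>) * m + (1 + \<bar>a\<bar>) * m + (1 + \<bar>a\<bar>) * m"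
    by (intro order_trans[OF norm_triangle_ineq4] add_mono b)
       (auto simp: m_def norm_triangle_ineq)
  finally show ?thesis by (simp add: m_def algebra_simps)
qed

lemma KP_map_eq:
  assumes "x \<in> l2_set"
  shows "KP_map a x k = Om a (l2_norm x) (x k)"
proof (cases "x k = 0")
  case True
  then show ?thesis by (simp add: KP_map_def)
next
  case False
  then have p: "0 < cmod (x k)" "cmod (x k) \<le> l2_norm x" using cmod_le_l2_norm[OF assms] by auto
  then have e: "- ln (cmod (x k) / l2_norm x) = ln (l2_norm x / cmod (x k))"
    by (simp add: ln_div)
  \<comment> \<open>A coordinate never exceeds the norm; hence the base of the power is nonnegative,
    as \<open>powr_one_plus_i\<close> requires.\<close>
  have "0 \<le> ln (l2_norm x / cmod (x k))" using p by simp
  then show ?thesis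
    unfolding KP_map_def Om_def e powr_one_plus_i[OF \<open>0 \<le> ln (l2_norm x / cmod (x k))\<close>] phi_def
    by (simp add: cis_conv_exp mult.assoc)
qed

lemma KP_map_0 [simp]: "KP_map a 0 = 0"
  by (simp add: KP_map_def fun_eq_iff)

lemma KP_map_scale:
  assumes "x \<in> l2_set"
  shows "KP_map a (seq_scale c x) = seq_scale c (KP_map a x)"
proof (cases "c = 0")
  case True
  then show ?thesis by (simp add: KP_map_def seq_scale_def)
next
  case False
  then show ?thesis
    using assms l2_scale[OF assms, of c]
    by (auto simp: fun_eq_iff KP_map_eq) (simp add: seq_scale_def Om_scale KP_map_eq)
qed

lemma norm_KP_map_le:
  assumes "x \<in> l2_set"
  shows "cmod (KP_map a x k) \<le> l2_norm x" "cmod (KP_map a x k) \<le> 2 * sqrt (l2_norm x * cmod (x k))"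
  using mult_ln_div_le[of "cmod (x k)" "l2_norm x"] cmod_le_l2_norm[OF assms, of k]
  by (simp_all add: KP_map_eq assms norm_Om)

text \<open>Passing from the norm of \<open>x\<close> to a larger \<open>R\<close> shifts all
  logarithms by the same amount \<open>ln (R / l2_norm x)\<close>, so the error is at most a
  constant multiple of \<open>x\<close> in every coordinate.\<close>

lemma Om_change:
  fixes a :: real
  assumes "x \<in> l2_set" "l2_norm x \<le> R"
  defines "v \<equiv> (\<lambda>k. Om a R (x k)) - KP_map a x"
  shows "v \<in> l2_set" "l2_norm v \<le> (1 + \<bar>a\<bar>) * (l2_norm x * ln (R / l2_norm x))"
proof -
  let ?r = "l2_norm x"
  have c: "cmod (v k) \<le> ((1 + \<bar>a\<bar>) * \<bar>ln (R / ?r)\<bar>) * cmod (x k)" for k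
  proof (cases "x k = 0")
    case True
    then show ?thesis by (simp add: v_def KP_map_eq assms)
  next
    case False
    then have "0 < cmod (x k)" by simp
    then have p: "0 < cmod (x k)" "cmod (x k) \<le> ?r" "0 < ?r" "0 < R"
      using cmod_le_l2_norm[OF assms(1), of k] assms(2) by linarith+
    have "cmod (v k) = cmod (x k) * cmod (phi a (ln (R / cmod (x k))) - phi a (ln (?r / cmod (x k))))"
      by (simp add: v_def KP_map_eq assms Om_def norm_mult flip: right_diff_distrib)
    also have "\<dots> \<le> cmod (x k) * ((1 + \<bar>a\<bar>) * \<bar>ln (R / cmod (x k)) - ln (?r / cmod (x k))\<bar>)"
      using p assms(2) by (intro mult_left_mono phi_lipschitz) auto
    also have "\<bar>ln (R / cmod (x k)) - ln (?r / cmod (x k))\<bar> = \<bar>ln (R / ?r)\<bar>"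
      using p by (simp add: ln_div)
    finally show ?thesis by (simp only: mult_ac)
  qed
  note l2_dominated[OF assms(1) _ c]
  moreover have "\<bar>ln (R / ?r)\<bar> * ?r = ?r * ln (R / ?r)"
    using assms(2) l2_norm_nonneg[OF assms(1)]
    by (cases "?r = 0") (auto simp: abs_of_nonneg)
  ultimately show "v \<in> l2_set" "l2_norm v \<le> (1 + \<bar>a\<bar>) * (l2_norm x * ln (R / l2_norm x))"
    by (simp_all add: mult.assoc)
qed

lemma Om_change_le:
  assumes "x \<in> l2_set" "l2_norm x \<le> R"
  shows "l2_norm ((\<lambda>k. Om a R (x k)) - KP_map a x) \<le> (1 + \<bar>a\<bar>) * R"
    "l2_norm ((\<lambda>k. Om a R (x k)) - KP_map a x) \<le> (1 + \<bar>a\<bar>) * (2 * sqrt (R * l2_norm x))"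
  using Om_change(2)[OF assms, of a] mult_ln_div_le(2,3)[OF l2_norm_nonneg assms(2)] assms(1)
  by (meson abs_ge_zero add_nonneg_nonneg mult_left_mono order_trans zero_le_one)+

text \<open>Quasi-linearity. All three terms are first rewritten with the common base
  \<open>l2_norm x + l2_norm y\<close>, where \<open>Om_add\<close> works coordinate by coordinate;
  the constant \<open>6\<close> is \<open>3\<close> from \<open>Om_add\<close> plus \<open>1\<close>
  for each change of base.\<close>

lemma KP_map_add:
  fixes a :: real
  assumes x: "x \<in> l2_set" and y: "y \<in> l2_set"
  defines "v \<equiv> KP_map a (x + y) - KP_map a x - KP_map a y"
  shows "v \<in> l2_set" "l2_norm v \<le> 6 * (1 + \<bar>a\<bar>) * (l2_norm x + l2_norm y)"
proof -
  let ?R = "l2_norm x + l2_norm y"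
  let ?O = "\<lambda>x. (\<lambda>k. Om a ?R (x k)) :: cseq"
  define p where "p = ?O (x + y) - ?O x - ?O y"
  have nn: "0 \<le> l2_norm x" "0 \<le> l2_norm y" using x y by (auto intro: l2_norm_nonneg)
  have "cmod (x k) + cmod (y k) \<le> ?R" for k
    using cmod_le_l2_norm[OF x] cmod_le_l2_norm[OF y] by (simp add: add_mono)
  then have "cmod (p k) \<le> 3 * (1 + \<bar>a\<bar>) * (cmod (x k) + cmod (y k))" for k
    using Om_add[of "x k" "y k" ?R a] by (simp add: p_def)
  then have p: "p \<in> l2_set" "l2_norm p \<le> 3 * (1 + \<bar>a\<bar>) * ?R"
    using l2_dominated2[OF x y, of "3 * (1 + \<bar>a\<bar>)" p] by auto
  define d where "d u = ?O u - KP_map a u" for u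
  have d: "d u \<in> l2_set" "l2_norm (d u) \<le> (1 + \<bar>a\<bar>) * ?R" if "u \<in> l2_set" "l2_norm u \<le> ?R" for u
    using Om_change(1)[OF that] Om_change_le(1)[OF that] by (auto simp: d_def)
  have dx: "d x \<in> l2_set" "l2_norm (d x) \<le> (1 + \<bar>a\<bar>) * ?R" using d[OF x] nn by auto
  have dy: "d y \<in> l2_set" "l2_norm (d y) \<le> (1 + \<bar>a\<bar>) * ?R" using d[OF y] nn by auto
  have ds: "d (x + y) \<in> l2_set" "l2_norm (d (x + y)) \<le> (1 + \<bar>a\<bar>) * ?R"
    using d[of "x + y"] l2_add[OF x y] by auto
  have v: "v = ((p - d (x + y)) + d x) + d y"
    by (simp add: v_def p_def d_def algebra_simps)
  note 1 = l2_diff[OF p(1) ds(1)]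
  note 2 = l2_add[OF 1(1) dx(1)]
  note 3 = l2_add[OF 2(1) dy(1)]
  show "v \<in> l2_set" using 3(1) v by simp
  show "l2_norm v \<le> 6 * (1 + \<bar>a\<bar>) * ?R"
    using 1(2) 2(2) 3(2) p(2) ds(2) dx(2) dy(2) unfolding v by (simp add: algebra_simps)
qed

text \<open>Truncating before or after the map changes only the norm in the logarithm, so
  \<open>Om_change\<close> applies with \<open>R = l2_norm x\<close>. The bound with the square root
  is small when little of \<open>x\<close> lies in \<open>J\<close>.\<close>

lemma KP_map_trunc:
  fixes a :: real and J :: "nat set"
  assumes "x \<in> l2_set"
  defines "v \<equiv> trunc J (KP_map a x) - KP_map a (trunc J x)"
  shows "v \<in> l2_set" "l2_norm v \<le> (1 + \<bar>a\<bar>) * l2_norm x"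
    "l2_norm v \<le> (1 + \<bar>a\<bar>) * (2 * sqrt (l2_norm x * l2_norm (trunc J x)))"
proof -
  have "trunc J (KP_map a x) = (\<lambda>k. Om a (l2_norm x) (trunc J x k))"
    by (auto simp: fun_eq_iff KP_map_eq assms)
  then show "v \<in> l2_set" "l2_norm v \<le> (1 + \<bar>a\<bar>) * l2_norm x"
    "l2_norm v \<le> (1 + \<bar>a\<bar>) * (2 * sqrt (l2_norm x * l2_norm (trunc J x)))"
    using Om_change(1)[OF l2_trunc[OF assms(1), of J], of a] Om_change_le[OF l2_trunc[OF assms(1), of J], of a]
    by (auto simp: v_def)
qed

section \<open>Quasi-normed spaces and the exact sequence\<close>

lemma qspace_l2 [simp]: "qspace l2 = l2_set" and qscale_l2 [simp]: "qscale l2 = seq_scale"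
  and qnorm_l2 [simp]: "qnorm l2 = l2_norm"
  by (simp_all add: l2_def)

lemma qspace_Z2: "u \<in> qspace (Z2 a) \<longleftrightarrow> snd u \<in> l2_set \<and> fst u - KP_map a (snd u) \<in> l2_set"
  by (cases u) (simp add: Z2_def)

lemma qscale_Z2 [simp]: "qscale (Z2 a) c u = (seq_scale c (fst u), seq_scale c (snd u))"
  by (cases u) (simp add: Z2_def)

lemma qnorm_Z2: "qnorm (Z2 a) u = l2_norm (fst u - KP_map a (snd u)) + l2_norm (snd u)"
  by (cases u) (simp add: Z2_def)

lemma vector_space_seq_scale: "vector_space seq_scale"
  by unfold_locales (auto simp: seq_scale_def fun_eq_iff algebra_simps)

lemma vector_space_qscale_Z2: "vector_space (qscale (Z2 a))"
  by unfold_locales (auto simp: seq_scale_def fun_eq_iff algebra_simps prod_eq_iff)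

lemma subspace_iff:
  fixes s :: "'k::field \<Rightarrow> 'v::ab_group_add \<Rightarrow> 'v"
  assumes "vector_space s"
  shows "module.subspace s S \<longleftrightarrow> 0 \<in> S \<and> (\<forall>x\<in>S. \<forall>y\<in>S. x + y \<in> S) \<and> (\<forall>c. \<forall>x\<in>S. s c x \<in> S)"
  using module.subspace_def assms by (metis module_iff_vector_space)

lemma quasi_normed_spaceD:
  fixes X :: "'v::ab_group_add quasi_normed"
  assumes "quasi_normed_space X"
  shows "0 \<in> qspace X"
    "x \<in> qspace X \<Longrightarrow> y \<in> qspace X \<Longrightarrow> x + y \<in> qspace X"
    "x \<in> qspace X \<Longrightarrow> y \<in> qspace X \<Longrightarrow> y - x \<in> qspace X"
    "x \<in> qspace X \<Longrightarrow> qscale X c x \<in> qspace X"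
    "x \<in> qspace X \<Longrightarrow> 0 \<le> qnorm X x"
    "qnorm X 0 = 0"
    "x \<in> qspace X \<Longrightarrow> qnorm X (qscale X c x) = cmod c * qnorm X x"
proof -
  have X: "vector_space (qscale X)" "module.subspace (qscale X) (qspace X)"
    "\<forall>x\<in>qspace X. 0 \<le> qnorm X x \<and> (qnorm X x = 0 \<longleftrightarrow> x = 0)"
    "\<forall>c. \<forall>x\<in>qspace X. qnorm X (qscale X c x) = cmod c * qnorm X x"
    using assms unfolding quasi_normed_space_def by - (elim conjE, assumption)+
  note S = X(2)[unfolded subspace_iff[OF X(1)]]
  show "0 \<in> qspace X" using S by (rule conjunct1)
  then show "qnorm X 0 = 0" using X(3) by blast
  show "x \<in> qspace X \<Longrightarrow> y \<in> qspace X \<Longrightarrow> y - x \<in> qspace X"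
    using X module.subspace_diff module_iff_vector_space by blast
qed (use assms in \<open>auto simp: quasi_normed_space_def subspace_iff\<close>)

lemma quasi_normed_space_triangle:
  assumes "quasi_normed_space X"
  obtains C where "1 \<le> C" "\<And>x y. x \<in> qspace X \<Longrightarrow> y \<in> qspace X \<Longrightarrow>
    qnorm X (x + y) \<le> C * (qnorm X x + qnorm X y)"
proof -
  obtain C where C: "\<forall>x\<in>qspace X. \<forall>y\<in>qspace X. qnorm X (x + y) \<le> C * (qnorm X x + qnorm X y)"
    using assms unfolding quasi_normed_space_def by (elim conjE exE)
  show ?thesis
  proof (rule that[of "max 1 C"])
    fix x y assume xy: "x \<in> qspace X" "y \<in> qspace X"
    have "C * (qnorm X x + qnorm X y) \<le> max 1 C * (qnorm X x + qnorm X y)"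
      using quasi_normed_spaceD(5)[OF assms] xy by (intro mult_right_mono) auto
    then show "qnorm X (x + y) \<le> max 1 C * (qnorm X x + qnorm X y)"
      using C xy by fastforce
  qed simp
qed

lemma quasi_normed_space_l2: "quasi_normed_space l2"
  unfolding quasi_normed_space_def
  by (auto simp: vector_space_seq_scale subspace_iff l2_add l2_scale l2_norm_nonneg l2_norm_eq_0
      intro!: exI[of _ 1])

lemma Z2_add:
  assumes u: "u \<in> qspace (Z2 a)" and v: "v \<in> qspace (Z2 a)"
  shows "u + v \<in> qspace (Z2 a)"
    "qnorm (Z2 a) (u + v) \<le> (1 + 6 * (1 + \<bar>a\<bar>)) * (qnorm (Z2 a) u + qnorm (Z2 a) v)"
proof -
  let ?d = "\<lambda>u. fst u - KP_map a (snd u)"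
  let ?k = "KP_map a (snd u + snd v) - KP_map a (snd u) - KP_map a (snd v)"
  have m: "snd u \<in> l2_set" "snd v \<in> l2_set" "?d u \<in> l2_set" "?d v \<in> l2_set"
    using u v by (auto simp: qspace_Z2)
  have e: "?d (u + v) = (?d u + ?d v) - ?k" by simp
  note k = KP_map_add[OF m(1,2), of a]
  note 1 = l2_add[OF m(3,4)]
  note 2 = l2_diff[OF 1(1) k(1)]
  note 3 = l2_add[OF m(1,2)]
  show "u + v \<in> qspace (Z2 a)" unfolding qspace_Z2 e using 2 3 by simp
  have "qnorm (Z2 a) (u + v) \<le> (qnorm (Z2 a) u + qnorm (Z2 a) v) + 6 * (1 + \<bar>a\<bar>) * (l2_norm (snd u) + l2_norm (snd v))"
    unfolding qnorm_Z2 e using 1 2 3 k by simp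
  also have "\<dots> \<le> (qnorm (Z2 a) u + qnorm (Z2 a) v) + 6 * (1 + \<bar>a\<bar>) * (qnorm (Z2 a) u + qnorm (Z2 a) v)"
    using m by (intro add_left_mono mult_left_mono) (auto simp: qnorm_Z2 l2_norm_nonneg)
  finally show "qnorm (Z2 a) (u + v) \<le> (1 + 6 * (1 + \<bar>a\<bar>)) * (qnorm (Z2 a) u + qnorm (Z2 a) v)"
    by (simp add: algebra_simps)
qed

lemma Z2_scale:
  assumes u: "u \<in> qspace (Z2 a)"
  shows "qscale (Z2 a) c u \<in> qspace (Z2 a)" "qnorm (Z2 a) (qscale (Z2 a) c u) = cmod c * qnorm (Z2 a) u"
proof -
  have m: "snd u \<in> l2_set" "fst u - KP_map a (snd u) \<in> l2_set" using u by (auto simp: qspace_Z2)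
  have "seq_scale c (fst u) - KP_map a (seq_scale c (snd u)) = seq_scale c (fst u - KP_map a (snd u))"
    unfolding KP_map_scale[OF m(1)] by (simp add: seq_scale_def fun_eq_iff algebra_simps)
  then show "qscale (Z2 a) c u \<in> qspace (Z2 a)"
    "qnorm (Z2 a) (qscale (Z2 a) c u) = cmod c * qnorm (Z2 a) u"
    using l2_scale[OF m(1), of c] l2_scale[OF m(2), of c]
    by (simp_all add: qspace_Z2 qnorm_Z2 distrib_left)
qed

lemma Z2_nonneg: "u \<in> qspace (Z2 a) \<Longrightarrow> 0 \<le> qnorm (Z2 a) u"
  by (simp add: qspace_Z2 qnorm_Z2 l2_norm_nonneg)

lemma quasi_normed_space_Z2: "quasi_normed_space (Z2 a)"
proof -
  have "qnorm (Z2 a) u = 0 \<longleftrightarrow> u = 0" if "u \<in> qspace (Z2 a)" for u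
    using that by (auto simp: qspace_Z2 qnorm_Z2 l2_norm_nonneg add_nonneg_eq_0_iff l2_norm_eq_0 prod_eq_iff)
  moreover have "0 \<in> qspace (Z2 a)" by (simp add: qspace_Z2)
  ultimately show ?thesis
    unfolding quasi_normed_space_def subspace_iff[OF vector_space_qscale_Z2]
    by (intro conjI ballI allI exI[of _ "1 + 6 * (1 + \<bar>a\<bar>)"])
       (auto simp only: Z2_add Z2_scale Z2_nonneg vector_space_qscale_Z2)
qed

section \<open>Finite sums, linear maps and isomorphisms of quasi-normed spaces\<close>

lemma qspace_sum:
  assumes "quasi_normed_space X" "\<And>n. n \<in> A \<Longrightarrow> v n \<in> qspace X"
  shows "(\<Sum>n\<in>A. v n) \<in> qspace X"
  using assms(2)
proof (induction A rule: infinite_finite_induct)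
qed (use quasi_normed_spaceD[OF assms(1)] in auto)

text \<open>Each addition costs a factor \<open>C\<close>. Splitting off the smallest index first
  gives the \<open>n\<close>-th term a weight that does not depend on \<open>A\<close>, so errors
  that decay fast enough against these weights have uniformly bounded sums.\<close>

lemma qnorm_sum_le:
  fixes v :: "nat \<Rightarrow> 'v::ab_group_add"
  assumes X: "quasi_normed_space X" and C: "1 \<le> C"
    and tri: "\<And>x y. x \<in> qspace X \<Longrightarrow> y \<in> qspace X \<Longrightarrow> qnorm X (x + y) \<le> C * (qnorm X x + qnorm X y)"
    and "finite A" "\<And>n. n \<in> A \<Longrightarrow> v n \<in> qspace X"
  shows "qnorm X (\<Sum>n\<in>A. v n) \<le> (\<Sum>n\<in>A. C ^ Suc n * qnorm X (v n))"
proof -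
  note nn = quasi_normed_spaceD(5)[OF X]
  \<comment> \<open>The exponent counts from a lower bound \<open>m\<close> of \<open>A\<close>;
    after removal of the minimum the remaining set has the lower bound \<open>Suc m\<close>, which
    frees one factor \<open>C\<close>.\<close>
  have "qnorm X (\<Sum>n\<in>A. v n) \<le> (\<Sum>n\<in>A. C ^ (Suc n - m) * qnorm X (v n))"
    if "\<forall>n\<in>A. m \<le> n \<and> v n \<in> qspace X" for m
    using \<open>finite A\<close> that
  proof (induction A arbitrary: m rule: finite_linorder_min_induct)
    case empty
    show ?case using quasi_normed_spaceD(6)[OF X] by simp
  next
    case (insert b A)
    have b: "v b \<in> qspace X" "m \<le> b" using insert.prems by auto
    have A: "n \<in> A \<Longrightarrow> Suc m \<le> n \<and> v n \<in> qspace X" for n using insert by fastforce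
    have nb: "b \<notin> A" using insert.hyps by auto
    have S: "(\<Sum>n\<in>A. v n) \<in> qspace X" using X A by (intro qspace_sum) auto
    have "qnorm X (v b + (\<Sum>n\<in>A. v n)) \<le> C * qnorm X (v b) + C * qnorm X (\<Sum>n\<in>A. v n)"
      using tri[OF b(1) S] by (simp add: distrib_left)
    also have "C * qnorm X (v b) \<le> C ^ (Suc b - m) * qnorm X (v b)"
      using power_increasing[of 1 "Suc b - m" C] C b nn by (intro mult_right_mono) auto
    also have "C * qnorm X (\<Sum>n\<in>A. v n) \<le> C * (\<Sum>n\<in>A. C ^ (Suc n - Suc m) * qnorm X (v n))"
      using insert.IH[of "Suc m"] A C by (intro mult_left_mono) auto
    also have "\<dots> = (\<Sum>n\<in>A. C ^ (Suc n - m) * qnorm X (v n))"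
      unfolding sum_distrib_left
    proof (intro sum.cong refl)
      fix n assume "n \<in> A"
      then have "Suc n - m = Suc (Suc n - Suc m)" using A by force
      then show "C * (C ^ (Suc n - Suc m) * qnorm X (v n)) = C ^ (Suc n - m) * qnorm X (v n)"
        by simp
    qed
    finally show ?case using insert.hyps nb by simp
  qed
  from this[of 0] show ?thesis using assms by simp
qed

lemma linear_map_diff:
  assumes "quasi_normed_space X" "linear_map X Y T" "x \<in> qspace X" "y \<in> qspace X"
  shows "y - x \<in> qspace X" "T (y - x) = T y - T x"
proof -
  show m: "y - x \<in> qspace X" using quasi_normed_spaceD[OF assms(1)] assms(3,4) by blast
  have "T ((y - x) + x) = T (y - x) + T x"
    using m assms(2,3) unfolding linear_map_def by blast
  then show "T (y - x) = T y - T x" by simp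
qed

lemma linear_map_0:
  assumes "quasi_normed_space X" "linear_map X Y T" shows "T 0 = 0"
  using linear_map_diff(2)[OF assms, of 0 0] quasi_normed_spaceD(1)[OF assms(1)] by simp

lemma bounded_operatorI:
  assumes X: "quasi_normed_space X" and T: "linear_map X Y T"
    and M: "\<And>x. x \<in> qspace X \<Longrightarrow> qnorm Y (T x) \<le> M * qnorm X x"
  shows "bounded_operator X Y T"
  unfolding bounded_operator_def continuous_map_def topspace_qtop openin_qtop
proof (intro conjI T funcsetI allI impI)
  show "T x \<in> qspace Y" if "x \<in> qspace X" for x using that T by (auto simp: linear_map_def)
  fix U assume U: "qopen Y U"
  show "qopen X {x \<in> qspace X. T x \<in> U}"
    unfolding qopen_def
  proof (intro conjI ballI)
    fix x assume x: "x \<in> {x \<in> qspace X. T x \<in> U}"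
    then obtain e where e: "e > 0" "\<And>y. y \<in> qspace Y \<Longrightarrow> qnorm Y (y - T x) < e \<Longrightarrow> y \<in> U"
      using U unfolding qopen_def by blast
    show "\<exists>d>0. \<forall>y\<in>qspace X. qnorm X (y - x) < d \<longrightarrow> y \<in> {x \<in> qspace X. T x \<in> U}"
    proof (intro exI[of _ "e / (\<bar>M\<bar> + 1)"] conjI ballI impI)
      show "0 < e / (\<bar>M\<bar> + 1)" using e by simp
      fix y assume y: "y \<in> qspace X" "qnorm X (y - x) < e / (\<bar>M\<bar> + 1)"
      have d: "y - x \<in> qspace X" "T (y - x) = T y - T x"
        using linear_map_diff[OF X T] x y by auto
      have nn: "0 \<le> qnorm X (y - x)" using quasi_normed_spaceD(5)[OF X] d by simp
      have "qnorm Y (T y - T x) \<le> M * qnorm X (y - x)" using M[OF d(1)] d by simp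
      also have "\<dots> \<le> (\<bar>M\<bar> + 1) * qnorm X (y - x)" using nn by (intro mult_right_mono) auto
      also have "\<dots> < e" using y(2) by (simp add: field_simps)
      finally show "y \<in> {x \<in> qspace X. T x \<in> U}"
        using e y T by (auto simp: linear_map_def)
    qed
  qed auto
qed

text \<open>Balls need not be open, so \<open>U\<close> is the interior of the ball: the points
  around which some ball stays inside it. Dividing the radius by \<open>2 * C\<close> gives openness
  in spite of the quasi-triangle constant.\<close>

lemma qopen_inside_ball:
  fixes X :: "'v::ab_group_add quasi_normed"
  assumes X: "quasi_normed_space X" and e: "0 < e"
  shows "\<exists>U. qopen X U \<and> 0 \<in> U \<and> (\<forall>u\<in>U. qnorm X u < e)"
proof -
  obtain C where C: "1 \<le> C" and tri: "\<And>x y. x \<in> qspace X \<Longrightarrow> y \<in> qspace X \<Longrightarrow>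
      qnorm X (x + y) \<le> C * (qnorm X x + qnorm X y)"
    using quasi_normed_space_triangle[OF X] by blast
  note D = quasi_normed_spaceD[OF X]
  define U where "U = {x \<in> qspace X. \<exists>d>0. \<forall>y\<in>qspace X. qnorm X (y - x) < d \<longrightarrow> qnorm X y < e}"
  have "qopen X U" unfolding qopen_def
  proof (intro conjI ballI)
    fix x assume "x \<in> U"
    then obtain d where x: "x \<in> qspace X" and d: "d > 0"
      "\<And>y. y \<in> qspace X \<Longrightarrow> qnorm X (y - x) < d \<Longrightarrow> qnorm X y < e"
      unfolding U_def by blast
    define h where "h = d / (2 * C)"
    have h: "h > 0" using d C by (simp add: h_def)
    show "\<exists>h>0. \<forall>y\<in>qspace X. qnorm X (y - x) < h \<longrightarrow> y \<in> U"
    proof (intro exI[of _ h] conjI h ballI impI)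
      fix y assume y: "y \<in> qspace X" "qnorm X (y - x) < h"
      have "qnorm X z < e" if z: "z \<in> qspace X" "qnorm X (z - y) < h" for z
      proof (rule d(2)[OF z(1)])
        have "qnorm X (z - x) \<le> C * (qnorm X (z - y) + qnorm X (y - x))"
          using tri[of "z - y" "y - x"] D(3) z y x by simp
        also have "\<dots> < C * (h + h)"
          using z y C by (intro mult_strict_left_mono add_strict_mono) auto
        also have "\<dots> = d" using C by (simp add: h_def field_simps)
        finally show "qnorm X (z - x) < d" .
      qed
      then show "y \<in> U" unfolding U_def using y h by blast
    qed
  qed (auto simp: U_def)
  moreover have "0 \<in> U"
    unfolding U_def using D(1) e by auto
  moreover have "qnorm X u < e" if "u \<in> U" for u
  proof -
    have u: "u \<in> qspace X" "\<exists>d>0. \<forall>y\<in>qspace X. qnorm X (y - u) < d \<longrightarrow> qnorm X y < e"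
      using that by (simp_all only: U_def mem_Collect_eq)
    from u(2) obtain d where "d > 0" "\<forall>y\<in>qspace X. qnorm X (y - u) < d \<longrightarrow> qnorm X y < e"
      by (elim exE conjE)
    with u(1) show ?thesis using D(6) by simp
  qed
  ultimately show ?thesis by (intro exI[of _ U]) simp
qed

text \<open>Translates the topological notion into two-sided norm estimates: continuity and openness
  at \<open>0\<close> give neighbourhoods, and homogeneity turns these into linear bounds.\<close>

lemma isomorphism_bounds:
  fixes X :: "'v::ab_group_add quasi_normed" and Y :: "'w::ab_group_add quasi_normed"
  assumes X: "quasi_normed_space X" and Y: "quasi_normed_space Y" and "isomorphism X Y T"
  obtains M where "0 \<le> M" "\<And>x. x \<in> qspace X \<Longrightarrow> qnorm Y (T x) \<le> M * qnorm X x"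
    "\<And>x. x \<in> qspace X \<Longrightarrow> qnorm X x \<le> M * qnorm Y (T x)"
    "linear_map X Y T" "bij_betw T (qspace X) (qspace Y)"
proof -
  have T: "linear_map X Y T" and hT: "homeomorphic_map (qtop X) (qtop Y) T"
    using assms(3) by (auto simp: isomorphism_def)
  have bij: "bij_betw T (qspace X) (qspace Y)"
    using hT homeomorphic_imp_surjective_map[OF hT] homeomorphic_imp_injective_map[OF hT]
    by (simp add: bij_betw_def topspace_qtop)
  note T0 = quasi_normed_spaceD(1)[OF X] linear_map_0[OF X T]
  \<comment> \<open>Stated for arbitrary homogeneous \<open>f\<close> and \<open>g\<close>, so that
    it serves both for \<open>T\<close> and for its inverse. If it failed, scaling \<open>x\<close>
    by \<open>1 / g x\<close> would give a vector with \<open>f < d\<close> but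
    \<open>g = 1\<close>.\<close>
  have bound: "g x \<le> (2 / d) * f x"
    if hom: "\<And>c. f (qscale X (complex_of_real c) x) = \<bar>c\<bar> * f x" "\<And>c. g (qscale X (complex_of_real c) x) = \<bar>c\<bar> * g x"
      and d: "0 < d" "\<And>y. y \<in> qspace X \<Longrightarrow> f y < d \<Longrightarrow> g y < 1"
      and x: "x \<in> qspace X" and f: "0 \<le> f x" for f g :: "'v \<Rightarrow> real" and d x
  proof (rule ccontr)
    assume n: "\<not> ?thesis"
    then have g: "0 < g x" using f d(1) by (smt (verit) divide_nonneg_pos mult_nonneg_nonneg)
    have "f (qscale X (complex_of_real (1 / g x)) x) < d"
      using n g d(1) f unfolding hom(1) by (simp add: field_simps)
    moreover have "qscale X (complex_of_real (1 / g x)) x \<in> qspace X"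
      using quasi_normed_spaceD(4)[OF X x] .
    ultimately have "g (qscale X (complex_of_real (1 / g x)) x) < 1" by (rule d(2)[rotated])
    then show False using g unfolding hom(2) by simp
  qed
  have hX: "qnorm X (qscale X (complex_of_real c) x) = \<bar>c\<bar> * qnorm X x"
    and hY: "qnorm Y (T (qscale X (complex_of_real c) x)) = \<bar>c\<bar> * qnorm Y (T x)"
    and nX: "0 \<le> qnorm X x" and nY: "0 \<le> qnorm Y (T x)" if "x \<in> qspace X" for c x
    using quasi_normed_spaceD[OF X] quasi_normed_spaceD[OF Y] T that
    by (auto simp: linear_map_def)
  obtain U where U: "qopen Y U" "0 \<in> U" "\<forall>u\<in>U. qnorm Y u < 1"
    using qopen_inside_ball[OF Y zero_less_one] by (elim exE conjE)
  have "qopen X {x \<in> qspace X. T x \<in> U}"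
    using homeomorphic_imp_continuous_map[OF hT] U(1)
    by (simp add: continuous_map_def topspace_qtop openin_qtop)
  moreover have "0 \<in> {x \<in> qspace X. T x \<in> U}" using U(2) T0 by simp
  ultimately have "\<exists>d>0. \<forall>y\<in>qspace X. qnorm X (y - 0) < d \<longrightarrow> y \<in> {x \<in> qspace X. T x \<in> U}"
    unfolding qopen_def by (elim conjE bspec)
  then obtain d where d: "d > 0" "\<And>x. x \<in> qspace X \<Longrightarrow> qnorm X x < d \<Longrightarrow> T x \<in> U"
    by auto
  obtain V where V: "qopen X V" "0 \<in> V" "\<forall>u\<in>V. qnorm X u < 1"
    using qopen_inside_ball[OF X zero_less_one] by (elim exE conjE)
  have "qopen Y (T ` V)"
    using homeomorphic_imp_open_map[OF hT] V(1) by (simp add: open_map_def openin_qtop)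
  moreover have "0 \<in> T ` V" using V(2) T0(2) by (rule image_eqI[OF sym, rotated])
  ultimately have "\<exists>h>0. \<forall>y\<in>qspace Y. qnorm Y (y - 0) < h \<longrightarrow> y \<in> T ` V"
    unfolding qopen_def by (elim conjE bspec)
  then obtain h where h: "h > 0" "\<And>y. y \<in> qspace Y \<Longrightarrow> qnorm Y y < h \<Longrightarrow> y \<in> T ` V"
    unfolding diff_zero by blast
  have hV: "qnorm X x < 1" if x: "x \<in> qspace X" "qnorm Y (T x) < h" for x
  proof -
    have "T x \<in> T ` V" using h(2) x T by (auto simp: linear_map_def)
    then obtain u where u: "u \<in> V" "T x = T u" by blast
    then have "x = u" using bij V(1) x(1) by (auto simp: bij_betw_def qopen_def inj_on_def)
    then show ?thesis using u V(3) by simp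
  qed
  define M where "M = max (2 / d) (2 / h)"
  show ?thesis
  proof (rule that[of M, OF _ _ _ T bij])
    show "0 \<le> M" using d(1) by (simp add: M_def le_max_iff_disj)
    fix x assume x: "x \<in> qspace X"
    have "qnorm Y (T x) \<le> 2 / d * qnorm X x"
      using bound[of "qnorm X" x "\<lambda>x. qnorm Y (T x)" d] hX[OF x] hY[OF x] nX[OF x] x d U(3) by blast
    also have "\<dots> \<le> M * qnorm X x" using nX[OF x] by (intro mult_right_mono) (auto simp: M_def)
    finally show "qnorm Y (T x) \<le> M * qnorm X x" .
    have "qnorm X x \<le> 2 / h * qnorm Y (T x)"
      using bound[of "\<lambda>x. qnorm Y (T x)" x "qnorm X" h] hX[OF x] hY[OF x] nY[OF x] x h(1) hV by blast
    also have "\<dots> \<le> M * qnorm Y (T x)" using nY[OF x] by (intro mult_right_mono) (auto simp: M_def)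
    finally show "qnorm X x \<le> M * qnorm Y (T x)" .
  qed
qed

lemma short_exact_Z2: "short_exact l2 (Z2 a) l2 (\<lambda>y. (y, 0)) (\<lambda>(w, x). x)"
proof -
  have j: "linear_map l2 (Z2 a) (\<lambda>y. (y, 0))"
    by (auto simp: linear_map_def qspace_Z2) (simp add: seq_scale_def fun_eq_iff)
  have q: "linear_map (Z2 a) l2 (\<lambda>(w, x). x)"
    by (auto simp: linear_map_def qspace_Z2)
  have "bounded_operator l2 (Z2 a) (\<lambda>y. (y, 0))"
    by (rule bounded_operatorI[OF quasi_normed_space_l2 j, of 1]) (simp add: qnorm_Z2)
  moreover have "bounded_operator (Z2 a) l2 (\<lambda>(w, x). x)"
    by (rule bounded_operatorI[OF quasi_normed_space_Z2 q, of 1])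
       (auto simp: qnorm_Z2 qspace_Z2 l2_norm_nonneg)
  moreover have "x \<in> (\<lambda>(w, x). x) ` qspace (Z2 a)" if "x \<in> l2_set" for x
    using that by (intro image_eqI[of _ _ "(KP_map a x, x)"]) (auto simp: qspace_Z2)
  ultimately show ?thesis
    unfolding short_exact_def
    using quasi_normed_space_l2 quasi_normed_space_Z2 by (auto simp: inj_on_def qspace_Z2)
qed

section \<open>Gliding humps in \<open>Z2\<close>\<close>

text \<open>An initial segment of a late row is small because the columns tend to \<open>0\<close>,
  and the tail of that row is small by summability; what remains sits on an interval after the
  previous one. The rows are abstract nonnegative functions so that several sequences of vectors can
  share the same blocks.\<close>

lemma gliding_hump:
  fixes g :: "nat \<Rightarrow> nat \<Rightarrow> real" and P :: "nat \<Rightarrow> nat \<Rightarrow> bool" and \<epsilon> :: "nat \<Rightarrow> real"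
  assumes nn: "\<And>n k. 0 \<le> g n k" and s: "\<And>n. summable (g n)"
    and null: "\<And>k. (\<lambda>n. g n k) \<longlonglongrightarrow> 0"
    and freq: "\<And>j. \<exists>\<^sub>F n in sequentially. P j n" and e: "\<And>j. 0 < \<epsilon> j"
  shows "\<exists>r J. strict_mono r \<and> disjoint_family J \<and>
    (\<forall>j. P j (r j) \<and> (\<Sum>k. if k \<in> J j then 0 else g (r j) k) \<le> \<epsilon> j)"
proof -
  define ok where "ok j n b c \<longleftrightarrow> b \<le> c \<and> P j n \<and> (\<Sum>k. if k \<in> {b..<c} then 0 else g n k) \<le> \<epsilon> j"
    for j n and b c :: nat
  have step: "\<exists>n c. m < n \<and> ok j n b c" for j m b
  proof -
    have "(\<lambda>n. \<Sum>k<b. g n k) \<longlonglongrightarrow> (\<Sum>k<b. 0)" by (intro tendsto_sum null)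
    then have "\<forall>\<^sub>F n in sequentially. (\<Sum>k<b. g n k) < \<epsilon> j / 2"
      using e[of j] by (intro order_tendstoD(2)) auto
    then have "\<forall>\<^sub>F n in sequentially. (\<Sum>k<b. g n k) < \<epsilon> j / 2 \<and> m < n"
      using eventually_gt_at_top by (rule eventually_conj)
    then obtain n where n: "P j n" "(\<Sum>k<b. g n k) < \<epsilon> j / 2" "m < n"
      using frequently_eventually_conj[OF freq[of j]] frequently_ex by blast
    obtain c where c: "\<And>i. i \<ge> c \<Longrightarrow> norm (\<Sum>k. g n (k + i)) < \<epsilon> j / 2"
      using suminf_exist_split[OF _ s[of n], of "\<epsilon> j / 2"] e[of j] by auto
    define d where "d = max b c"
    let ?f = "\<lambda>k. if k \<in> {b..<d} then 0 else g n k"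
    have "summable ?f" by (rule summable_comparison_test'[OF s[of n]]) (auto simp: nn)
    then have "(\<Sum>k. ?f k) = (\<Sum>k. ?f (k + d)) + (\<Sum>k<d. ?f k)"
      by (rule suminf_split_initial_segment)
    also have "(\<Sum>k. ?f (k + d)) = (\<Sum>k. g n (k + d))" by simp
    also have "(\<Sum>k<d. ?f k) = (\<Sum>k<b. ?f k)"
      by (intro sum.mono_neutral_right) (auto simp: d_def)
    also have "\<dots> = (\<Sum>k<b. g n k)" by (intro sum.cong) auto
    finally have "(\<Sum>k. ?f k) \<le> \<epsilon> j" using c[of d] n by (simp add: d_def abs_le_iff)
    then show ?thesis unfolding ok_def using n d_def by (intro exI[of _ n] exI[of _ d]) auto
  qed
  \<comment> \<open>Dependent choice runs over triples: index, left end and right end of the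
    interval. \<open>R\<close> makes the next interval start where the last one ended, whence
    disjointness.\<close>
  define Q where "Q j s \<longleftrightarrow> ok j (fst s) (fst (snd s)) (snd (snd s))"
    for j and s :: "nat \<times> nat \<times> nat"
  define R where "R s s' \<longleftrightarrow> fst s < fst s' \<and> snd (snd s) = fst (snd s')" for s s' :: "nat \<times> nat \<times> nat"
  have "\<exists>f. \<forall>j. Q j (f j) \<and> R (f j) (f (Suc j))"
  proof (rule dependent_nat_choice)
    show "\<exists>x. Q 0 x" using step[of 0 0 0] unfolding Q_def by (metis fst_conv snd_conv)
    fix x :: "nat \<times> nat \<times> nat" and j
    obtain n c where "fst x < n" "ok (Suc j) n (snd (snd x)) c" using step by blast
    then show "\<exists>y. Q (Suc j) y \<and> R x y"
      by (intro exI[of _ "(n, snd (snd x), c)"]) (simp add: Q_def R_def)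
  qed
  then obtain f where f: "\<And>j. Q j (f j)" "\<And>j. R (f j) (f (Suc j))" by blast
  define r where "r j = fst (f j)" for j
  define b where "b j = fst (snd (f j))" for j
  have ok: "ok j (r j) (b j) (b (Suc j))" for j
    using f(1)[of j] f(2)[of j] by (simp add: Q_def R_def r_def b_def)
  have "strict_mono r" using f(2) by (simp add: strict_mono_Suc_iff r_def R_def)
  moreover have "incseq b" using ok by (intro incseq_SucI) (simp add: ok_def)
  then have "b (Suc i) \<le> b j" if "i < j" for i j using that by (simp add: incseqD)
  then have "disjoint_family (\<lambda>j. {b j..<b (Suc j)})"
    by (auto simp: disjoint_family_on_def disjoint_iff) (metis leD linorder_neqE_nat order_le_less_trans order_less_le_trans)
  ultimately show ?thesis
    using ok unfolding ok_def by (intro exI[of _ r] exI[of _ "\<lambda>j. {b j..<b (Suc j)}"]) simp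
qed

text \<open>Both components are cut to the same set, so \<open>KP_map_trunc\<close> controls the
  change in the fibre. The first bound makes truncations uniformly bounded, the second makes tails
  small.\<close>

lemma Z2_trunc:
  fixes J :: "nat set"
  assumes "u \<in> qspace (Z2 a)"
  defines "d \<equiv> fst u - KP_map a (snd u)" and "v \<equiv> (trunc J (fst u), trunc J (snd u))"
  shows "v \<in> qspace (Z2 a)" "qnorm (Z2 a) v \<le> (3 + \<bar>a\<bar>) * qnorm (Z2 a) u"
    "qnorm (Z2 a) v \<le> l2_norm (trunc J d) + (1 + \<bar>a\<bar>) * (2 * sqrt (l2_norm (snd u) * l2_norm (trunc J (snd u))))
      + l2_norm (trunc J (snd u))"
proof -
  have m: "snd u \<in> l2_set" "d \<in> l2_set" using assms by (auto simp: qspace_Z2)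
  have e: "fst v - KP_map a (snd v) = trunc J d + (trunc J (KP_map a (snd u)) - KP_map a (trunc J (snd u)))"
    by (simp add: v_def d_def trunc_simps)
  note t = KP_map_trunc[OF m(1), of J a]
  note 1 = l2_add[OF l2_trunc(1)[OF m(2)] t(1), of J]
  show "v \<in> qspace (Z2 a)"
    unfolding qspace_Z2 e using 1 l2_trunc[OF m(1), of J] by (simp add: v_def)
  show "qnorm (Z2 a) v \<le> l2_norm (trunc J d) + (1 + \<bar>a\<bar>) * (2 * sqrt (l2_norm (snd u) * l2_norm (trunc J (snd u))))
      + l2_norm (trunc J (snd u))"
    unfolding qnorm_Z2 e using 1(2) t(3) by (simp add: v_def)
  have "qnorm (Z2 a) v \<le> l2_norm (trunc J d) + (1 + \<bar>a\<bar>) * l2_norm (snd u) + l2_norm (trunc J (snd u))"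
    unfolding qnorm_Z2 e using 1(2) t(2) by (simp add: v_def)
  also have "\<dots> \<le> l2_norm d + (1 + \<bar>a\<bar>) * l2_norm (snd u) + l2_norm (snd u)"
    using l2_trunc(2)[OF m(1)] l2_trunc(2)[OF m(2)] by (intro add_mono) auto
  also have "\<dots> \<le> (3 + \<bar>a\<bar>) * (l2_norm d + l2_norm (snd u))"
    using l2_norm_nonneg[OF m(1)] l2_norm_nonneg[OF m(2)] by (simp add: algebra_simps)
  finally show "qnorm (Z2 a) v \<le> (3 + \<bar>a\<bar>) * qnorm (Z2 a) u"
    by (simp add: qnorm_Z2 d_def)
qed

definition bounded_null :: "real \<Rightarrow> real \<Rightarrow> (nat \<Rightarrow> cseq \<times> cseq) \<Rightarrow> bool" where
  "bounded_null a M U \<longleftrightarrow> (\<forall>n. U n \<in> qspace (Z2 a) \<and> qnorm (Z2 a) (U n) \<le> M) \<and>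
     (\<forall>k. (\<lambda>n. fst (U n) k) \<longlonglongrightarrow> 0 \<and> (\<lambda>n. snd (U n) k) \<longlonglongrightarrow> 0)"

text \<open>The fibre defect \<open>d n\<close> is also coordinatewise null: by
  \<open>norm_KP_map_le\<close> a coordinate of the Kalton--Peck image is at most twice the square
  root of \<open>M\<close> times the modulus of that coordinate of \<open>snd (U n)\<close>.\<close>

lemma bounded_nullD:
  assumes "bounded_null a M U"
  defines "d \<equiv> \<lambda>n. fst (U n) - KP_map a (snd (U n))"
  shows "U n \<in> qspace (Z2 a)" "qnorm (Z2 a) (U n) \<le> M"
    "snd (U n) \<in> l2_set" "d n \<in> l2_set" "l2_norm (snd (U n)) \<le> M" "l2_norm (d n) \<le> M" "0 \<le> M"
    "(\<lambda>n. snd (U n) k) \<longlonglongrightarrow> 0" "(\<lambda>n. d n k) \<longlonglongrightarrow> 0"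
proof -
  show U: "U n \<in> qspace (Z2 a)" "qnorm (Z2 a) (U n) \<le> M" for n
    using assms(1) by (auto simp: bounded_null_def)
  then show m: "snd (U n) \<in> l2_set" "d n \<in> l2_set" for n by (auto simp: qspace_Z2 d_def)
  then have nn: "0 \<le> l2_norm (snd (U n))" "0 \<le> l2_norm (d n)" for n by (auto intro: l2_norm_nonneg)
  show b: "l2_norm (snd (U n)) \<le> M" for n using U(2)[of n] nn[of n] by (simp add: qnorm_Z2 d_def)
  show "l2_norm (d n) \<le> M" using U(2)[of n] nn[of n] by (simp add: qnorm_Z2 d_def)
  show "0 \<le> M" using b nn order_trans by blast
  show x: "(\<lambda>n. snd (U n) k) \<longlonglongrightarrow> 0" using assms(1) by (simp add: bounded_null_def)
  have "(\<lambda>n. KP_map a (snd (U n)) k) \<longlonglongrightarrow> 0"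
  proof (rule Lim_null_comparison)
    show "(\<lambda>n. 2 * sqrt (M * cmod (snd (U n) k))) \<longlonglongrightarrow> 0"
      using x by (auto intro!: tendsto_eq_intros)
    show "\<forall>\<^sub>F n in sequentially. norm (KP_map a (snd (U n)) k) \<le> 2 * sqrt (M * cmod (snd (U n) k))"
      using norm_KP_map_le(2)[OF m(1), of a _ k] b
      by (intro always_eventually allI) (meson mult_left_mono mult_right_mono norm_ge_zero order_trans real_sqrt_le_mono zero_le_numeral)
  qed
  moreover have "(\<lambda>n. fst (U n) k) \<longlonglongrightarrow> 0" using assms(1) by (simp add: bounded_null_def)
  ultimately show "(\<lambda>n. d n k) \<longlonglongrightarrow> 0" unfolding d_def by (auto intro!: tendsto_eq_intros)
qed

text \<open>One gliding hump serves both sequences. The vectors of \<open>U\<close> are cut in both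
  components; those of \<open>Y\<close> have small quotient component along the chosen indices, so
  they are replaced by blocks lying in the fibre. \<open>Q\<close> carries a further condition on
  these indices.\<close>

lemma block_approximation:
  fixes \<delta> :: "nat \<Rightarrow> real"
  assumes U: "bounded_null a M U" and Y: "bounded_null a M Y"
    and freq: "\<forall>\<epsilon>>0. \<exists>\<^sub>F n in sequentially. Q n \<and> l2_norm (snd (Y n)) < \<epsilon>"
    and \<delta>: "\<And>j. 0 < \<delta> j"
  shows "\<exists>r J. strict_mono r \<and> disjoint_family J \<and> (\<forall>j. Q (r j) \<and>
    qnorm (Z2 a) (U (r j) - (trunc (J j) (fst (U (r j))), trunc (J j) (snd (U (r j))))) \<le> \<delta> j \<and>
    Y (r j) - (trunc (J j) (fst (Y (r j)) - KP_map a (snd (Y (r j)))), 0) \<in> qspace (Z2 a) \<and>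
    qnorm (Z2 a) (Y (r j) - (trunc (J j) (fst (Y (r j)) - KP_map a (snd (Y (r j)))), 0)) \<le> \<delta> j)"
proof -
  note Ud = bounded_nullD[OF U] and Yd = bounded_nullD[OF Y]
  define dU where "dU n = fst (U n) - KP_map a (snd (U n))" for n
  define dY where "dY n = fst (Y n) - KP_map a (snd (Y n))" for n
  define g where "g n k = (cmod (snd (U n) k))\<^sup>2 + (cmod (dU n k))\<^sup>2 + (cmod (dY n k))\<^sup>2" for n k
  \<comment> \<open>\<open>h\<close> will bound the norms off the block and the quotient component
    of \<open>Y\<close>. The left side dominates both the truncation error of
    \<open>Z2_trunc\<close> for \<open>U\<close> and the error \<open>2 * h\<close> for
    \<open>Y\<close>.\<close>
  have "\<exists>h>0. 2 * h + (1 + \<bar>a\<bar>) * (2 * sqrt (M * h)) < \<delta> j" for j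
  proof -
    have "((\<lambda>h. 2 * h + (1 + \<bar>a\<bar>) * (2 * sqrt (M * h))) \<longlongrightarrow> 0) (at_right 0)"
      by (auto intro!: tendsto_eq_intros)
    then have "\<forall>\<^sub>F h in at_right 0. 2 * h + (1 + \<bar>a\<bar>) * (2 * sqrt (M * h)) < \<delta> j"
      using \<delta>[of j] by (rule order_tendstoD)
    then have "\<forall>\<^sub>F h in at_right 0. 2 * h + (1 + \<bar>a\<bar>) * (2 * sqrt (M * h)) < \<delta> j \<and> 0 < h"
      using eventually_at_right_less by (rule eventually_conj)
    then show ?thesis using eventually_happens trivial_limit_at_right_real by blast
  qed
  then obtain h where h: "\<And>j. 0 < h j" "\<And>j. 2 * h j + (1 + \<bar>a\<bar>) * (2 * sqrt (M * h j)) < \<delta> j"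
    by metis
  have sg: "summable (\<lambda>k. (cmod (x k))\<^sup>2)" if "x \<in> l2_set" for x using that by (simp add: l2_set_def)
  have g: "0 \<le> g n k" "summable (g n)" "(\<lambda>n. g n k) \<longlonglongrightarrow> 0" for n k
  proof -
    show "0 \<le> g n k" by (simp add: g_def)
    show "summable (g n)" unfolding g_def dU_def dY_def
      by (intro summable_add sg Ud Yd)
    have "(\<lambda>n. dU n k) \<longlonglongrightarrow> 0" "(\<lambda>n. dY n k) \<longlonglongrightarrow> 0"
      unfolding dU_def dY_def by (rule Ud Yd)+
    then show "(\<lambda>n. g n k) \<longlonglongrightarrow> 0" unfolding g_def using Ud(8)[of k]
      by (auto intro!: tendsto_eq_intros)
  qed
  have "\<exists>r J. strict_mono r \<and> disjoint_family J \<and> (\<forall>j. (Q (r j) \<and> l2_norm (snd (Y (r j))) < h j) \<and>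
      (\<Sum>k. if k \<in> J j then 0 else g (r j) k) \<le> (h j)\<^sup>2)"
  proof (intro gliding_hump g)
    show "\<exists>\<^sub>F n in sequentially. Q n \<and> l2_norm (snd (Y n)) < h j" for j using freq h(1) by simp
    show "0 < (h j)\<^sup>2" for j by (rule zero_less_power[OF h(1)])
  qed
  then obtain r J where r: "strict_mono r" "disjoint_family J" "\<And>j. Q (r j) \<and> l2_norm (snd (Y (r j))) < h j"
    and J: "\<And>j. (\<Sum>k. if k \<in> J j then 0 else g (r j) k) \<le> (h j)\<^sup>2"
    by blast
  have small: "l2_norm (trunc (- J j) x) \<le> h j"
    if x: "x \<in> l2_set" "\<And>k. (cmod (x k))\<^sup>2 \<le> g (r j) k" for j x
  proof -
    have "(l2_norm (trunc (- J j) x))\<^sup>2 = (\<Sum>k. (cmod (trunc (- J j) x k))\<^sup>2)"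
      using x l2_trunc by (intro l2_norm_power2) auto
    also have "\<dots> \<le> (\<Sum>k. if k \<in> J j then 0 else g (r j) k)"
    proof (rule suminf_le)
      show "summable (\<lambda>k. (cmod (trunc (- J j) x k))\<^sup>2)" using sg l2_trunc(1)[OF x(1)] by blast
      show "summable (\<lambda>k. if k \<in> J j then 0 else g (r j) k)"
        by (rule summable_comparison_test'[OF g(2)[of "r j"]]) (auto simp: g)
    qed (use x(2) in auto)
    also have "\<dots> \<le> (h j)\<^sup>2" by (rule J)
    finally show ?thesis using h(1)[of j] by (simp add: power2_le_iff_abs_le abs_of_pos)
  qed
  show ?thesis
  proof (intro exI[of _ r] exI[of _ J] conjI allI r)
    fix j
    let ?n = "r j"
    show "Q ?n" using r(3) by blast
    have 1: "l2_norm (trunc (- J j) (snd (U ?n))) \<le> h j" "l2_norm (trunc (- J j) (dU ?n)) \<le> h j"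
      "l2_norm (trunc (- J j) (dY ?n)) \<le> h j"
      using small Ud(3)[of ?n] Ud(4)[of ?n] Yd(4)[of ?n] by (auto simp: g_def dU_def dY_def)
    have e: "U ?n - (trunc (J j) (fst (U ?n)), trunc (J j) (snd (U ?n)))
        = (trunc (- J j) (fst (U ?n)), trunc (- J j) (snd (U ?n)))"
      by (simp add: prod_eq_iff trunc_simps)
    have "l2_norm (snd (U ?n)) * l2_norm (trunc (- J j) (snd (U ?n))) \<le> M * h j"
      using 1 Ud h(1)[of j] by (intro mult_mono l2_norm_nonneg l2_trunc) auto
    then have "(1 + \<bar>a\<bar>) * (2 * sqrt (l2_norm (snd (U ?n)) * l2_norm (trunc (- J j) (snd (U ?n)))))
        \<le> (1 + \<bar>a\<bar>) * (2 * sqrt (M * h j))"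
      by (intro mult_left_mono real_sqrt_le_mono) auto
    then show "qnorm (Z2 a) (U ?n - (trunc (J j) (fst (U ?n)), trunc (J j) (snd (U ?n)))) \<le> \<delta> j"
      unfolding e using Z2_trunc(3)[OF Ud(1)[of ?n], of "- J j"] 1 h(2)[of j] by (simp add: dU_def)
    let ?v = "Y ?n - (trunc (J j) (fst (Y ?n) - KP_map a (snd (Y ?n))), 0)"
    have v: "fst ?v - KP_map a (snd ?v) = trunc (- J j) (dY ?n)" "snd ?v = snd (Y ?n)"
      by (auto simp: dY_def fun_eq_iff)
    have "dY ?n \<in> l2_set" using Yd(4)[of ?n] by (simp add: dY_def)
    then show "?v \<in> qspace (Z2 a)" unfolding qspace_Z2 v(1) unfolding v(2) by (intro conjI l2_trunc(1) Yd(3))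
    have "0 \<le> (1 + \<bar>a\<bar>) * (2 * sqrt (M * h j))" using h(1)[of j] Ud(7) by auto
    then show "qnorm (Z2 a) ?v \<le> \<delta> j"
      unfolding qnorm_Z2 v(1) unfolding v(2) using 1(3) r(3)[of j] h(2)[of j] by linarith
  qed
qed

section \<open>Sums along almost disjoint sequences\<close>

lemma sum_half_power_le: "finite A \<Longrightarrow> (\<Sum>n\<in>A. (1 / 2) ^ Suc n) \<le> (1::real)"
  using sum_le_suminf[OF sums_summable[OF power_half_series]] sums_unique[OF power_half_series] by force

text \<open>Where the quotient components are negligible, a subsequence consists of disjoint fibre
  blocks up to small errors, and Pythagoras gives the square root. Used for singularity and for the
  lower bound on the quotient components of the images of \<open>(0, unit n)\<close>.\<close>

lemma bounded_null_subsequence_sums: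
  assumes Y: "bounded_null a M Y"
    and freq: "\<forall>\<epsilon>>0. \<exists>\<^sub>F n in sequentially. l2_norm (snd (Y n)) < \<epsilon>"
  shows "\<exists>(r :: nat \<Rightarrow> nat) C. strict_mono r \<and> (\<forall>A. finite A \<longrightarrow> qnorm (Z2 a) (\<Sum>n\<in>A. Y (r n)) \<le> C * sqrt (card A))"
proof -
  note Yd = bounded_nullD[OF Y]
  define C where "C = 1 + 6 * (1 + \<bar>a\<bar>)"
  have C: "1 \<le> C" by (simp add: C_def)
  note tri = Z2_add(2)[where a = a, folded C_def]
  \<comment> \<open>These errors beat the weights \<open>C ^ Suc j\<close> of
    \<open>qnorm_sum_le\<close>, leaving a geometric series of total at most
    \<open>1\<close>.\<close>
  define \<delta> where "\<delta> j = (1 / (2 * C)) ^ Suc j" for j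
  have \<delta>: "0 < \<delta> j" "C ^ Suc j * \<delta> j = (1 / 2) ^ Suc j" for j
    using C by (auto simp: \<delta>_def simp flip: power_mult_distrib)
  let ?y = "\<lambda>J j n. trunc (J j) (fst (Y n) - KP_map a (snd (Y n)))"
  obtain r :: "nat \<Rightarrow> nat" and J :: "nat \<Rightarrow> nat set" where r: "strict_mono r" "disjoint_family J"
    and v: "\<And>j. Y (r j) - (?y J j (r j), 0) \<in> qspace (Z2 a)"
      "\<And>j. qnorm (Z2 a) (Y (r j) - (?y J j (r j), 0)) \<le> \<delta> j"
    using block_approximation[OF Y Y, of "\<lambda>_. True" \<delta>] freq \<delta>(1) by auto
  have "qnorm (Z2 a) (\<Sum>n\<in>A. Y (r n)) \<le> C * (1 + M) * sqrt (card A)" if A: "finite A" for A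
  proof (cases "A = {}")
    case True
    then show ?thesis by (simp add: quasi_normed_spaceD(6)[OF quasi_normed_space_Z2])
  next
    case False
    let ?e = "\<lambda>n. Y (r n) - (?y J n (r n), 0)" and ?s = "\<Sum>n\<in>A. ?y J n (r n)"
    have s: "?s \<in> l2_set" by (intro l2_sum l2_trunc Yd)
    have "1 \<le> card A" using A False by (simp add: Suc_le_eq card_gt_0_iff)
    then have c1: "1 \<le> sqrt (card A)" by simp
    have "(l2_norm ?s)\<^sup>2 = (\<Sum>n\<in>A. (l2_norm (?y J n (r n)))\<^sup>2)"
      using A r(2) Yd by (intro l2_norm_block_sum) auto
    also have "\<dots> \<le> (\<Sum>n\<in>A. M\<^sup>2)"
      using order_trans[OF l2_trunc(2)[OF Yd(4)] Yd(6)] l2_norm_nonneg[OF l2_trunc(1)[OF Yd(4)]]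
      by (intro sum_mono power_mono)
    also have "\<dots> = (M * sqrt (card A))\<^sup>2" by (simp add: power_mult_distrib)
    finally have ns: "l2_norm ?s \<le> M * sqrt (card A)"
      by (rule power2_le_imp_le) (use Yd(7) in simp)
    have "qnorm (Z2 a) (\<Sum>n\<in>A. ?e n) \<le> (\<Sum>n\<in>A. C ^ Suc n * qnorm (Z2 a) (?e n))"
      by (intro qnorm_sum_le quasi_normed_space_Z2 C tri A v(1))
    also have "\<dots> \<le> (\<Sum>n\<in>A. C ^ Suc n * \<delta> n)"
      using v(2) C by (intro sum_mono mult_left_mono) auto
    also have "\<dots> \<le> 1" unfolding \<delta>(2) using A by (rule sum_half_power_le)
    finally have ne: "qnorm (Z2 a) (\<Sum>n\<in>A. ?e n) \<le> sqrt (card A)" using c1 by (rule order_trans)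
    have me: "(\<Sum>n\<in>A. ?e n) \<in> qspace (Z2 a)" using v by (intro qspace_sum quasi_normed_space_Z2)
    have ms: "(?s, 0) \<in> qspace (Z2 a)" using s by (simp add: qspace_Z2)
    have "(\<Sum>n\<in>A. Y (r n)) = (\<Sum>n\<in>A. ?e n) + (?s, 0)"
      by (simp add: prod_eq_iff fst_sum snd_sum sum_subtractf)
    then have "qnorm (Z2 a) (\<Sum>n\<in>A. Y (r n)) \<le> C * (qnorm (Z2 a) (\<Sum>n\<in>A. ?e n) + qnorm (Z2 a) (?s, 0))"
      using tri[OF me ms] by simp
    also have "\<dots> \<le> C * (sqrt (card A) + M * sqrt (card A))"
      using ne ns C by (intro mult_left_mono add_mono) (auto simp: qnorm_Z2)
    finally show ?thesis by (simp add: algebra_simps)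
  qed
  then show ?thesis using r(1) by (intro exI[of _ r] exI[of _ "C * (1 + M)"]) simp
qed

text \<open>On one block the Kalton--Peck map of the whole sum sees the norm of the sum, comparable
  to \<open>sqrt N\<close>, which moves the logarithm by \<open>ln N / 2\<close> up to a constant.
  The total fibre defect is of order \<open>sqrt N\<close>, so fewer than \<open>N\<close> blocks
  can exceed a fixed bound; hence each \<open>N\<close> has finitely many bad indices, and a single
  index serves all of \<open>F\<close>. The constant is chosen before \<open>F\<close>.\<close>

lemma block_sum_estimate:
  fixes \<psi> :: "nat \<Rightarrow> complex"
  assumes U: "bounded_null a M U" and Y: "bounded_null a M Y" and c: "0 < c"
    and freq: "\<forall>\<epsilon>>0. \<exists>\<^sub>F n in sequentially. c \<le> l2_norm (snd (U n)) \<and> l2_norm (snd (Y n)) < \<epsilon>"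
    and \<psi>: "\<And>N. cmod (\<psi> N) \<le> sqrt N"
    and sums: "\<forall>A. finite A \<longrightarrow>
      qnorm (Z2 a) (\<Sum>n\<in>A. qscale (Z2 a) (\<psi> (card A)) (Y n) + U n) \<le> M * sqrt (card A)"
  shows "\<exists>C. \<forall>F. finite F \<and> 0 \<notin> F \<longrightarrow> (\<exists>x\<in>l2_set. \<exists>y\<in>l2_set. c / 2 \<le> l2_norm x \<and>
    (\<forall>N\<in>F. let v = seq_scale (\<psi> N) y + (\<lambda>k. x k * (phi a (ln (l2_norm x / cmod (x k))) -
        phi a (ln (l2_norm x / cmod (x k)) + ln N / 2)))
      in v \<in> l2_set \<and> l2_norm v \<le> C))"
proof -
  note Ud = bounded_nullD[OF U] and Yd = bounded_nullD[OF Y]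
  note Z2D = quasi_normed_spaceD[OF quasi_normed_space_Z2]
  define K where "K = 1 + 6 * (1 + \<bar>a\<bar>)"
  have K: "1 \<le> K" by (simp add: K_def)
  note tri = Z2_add(2)[where a = a, folded K_def]
  \<comment> \<open>The bound \<open>c / 2\<close> keeps the cut vectors \<open>x j\<close> away
    from \<open>0\<close>; the geometric bound controls the summed errors.\<close>
  define \<delta> where "\<delta> j = min (c / 2) ((1 / (2 * K)) ^ Suc j)" for j
  have \<delta>: "0 < \<delta> j" "\<delta> j \<le> c / 2" "K ^ Suc j * \<delta> j \<le> (1 / 2) ^ Suc j" for j
  proof -
    show "0 < \<delta> j" "\<delta> j \<le> c / 2" using K c by (auto simp: \<delta>_def)
    have "K ^ Suc j * \<delta> j \<le> K ^ Suc j * (1 / (2 * K)) ^ Suc j"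
      using K by (intro mult_left_mono) (auto simp: \<delta>_def)
    also have "\<dots> = (1 / 2) ^ Suc j" using K by (simp flip: power_mult_distrib del: power_Suc)
    finally show "K ^ Suc j * \<delta> j \<le> (1 / 2) ^ Suc j" .
  qed
  obtain r :: "nat \<Rightarrow> nat" and J :: "nat \<Rightarrow> nat set" where r: "strict_mono r" "disjoint_family J"
    and rJ: "\<forall>j. c \<le> l2_norm (snd (U (r j))) \<and>
      qnorm (Z2 a) (U (r j) - (trunc (J j) (fst (U (r j))), trunc (J j) (snd (U (r j))))) \<le> \<delta> j \<and>
      Y (r j) - (trunc (J j) (fst (Y (r j)) - KP_map a (snd (Y (r j)))), 0) \<in> qspace (Z2 a) \<and>
      qnorm (Z2 a) (Y (r j) - (trunc (J j) (fst (Y (r j)) - KP_map a (snd (Y (r j)))), 0)) \<le> \<delta> j"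
    using block_approximation[of a M U Y "\<lambda>n. c \<le> l2_norm (snd (U n))" \<delta>, OF U Y freq \<delta>(1)]
    by (elim exE conjE)
  have cr: "c \<le> l2_norm (snd (U (r j)))"
    and aU: "qnorm (Z2 a) (U (r j) - (trunc (J j) (fst (U (r j))), trunc (J j) (snd (U (r j))))) \<le> \<delta> j"
    and aY: "Y (r j) - (trunc (J j) (fst (Y (r j)) - KP_map a (snd (Y (r j)))), 0) \<in> qspace (Z2 a)"
      "qnorm (Z2 a) (Y (r j) - (trunc (J j) (fst (Y (r j)) - KP_map a (snd (Y (r j)))), 0)) \<le> \<delta> j" for j
    using rJ[rule_format, of j] by (simp_all only: conj_assoc)
  define w where "w j = trunc (J j) (fst (U (r j)))" for j
  define x where "x j = trunc (J j) (snd (U (r j)))" for j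
  define y where "y j = trunc (J j) (fst (Y (r j)) - KP_map a (snd (Y (r j))))" for j
  have xl: "x j \<in> l2_set" "l2_norm (x j) \<le> M" for j
    using l2_trunc[OF Ud(3)] Ud(5) unfolding x_def by (blast intro: order_trans)+
  have yl: "y j \<in> l2_set" for j using l2_trunc(1)[OF Yd(4)] by (simp add: y_def)
  have wx: "(w j, x j) \<in> qspace (Z2 a)" "qnorm (Z2 a) (w j, x j) \<le> (3 + \<bar>a\<bar>) * M" for j
  proof -
    show "(w j, x j) \<in> qspace (Z2 a)" unfolding w_def x_def by (rule Z2_trunc(1)[OF Ud(1)])
    have "qnorm (Z2 a) (w j, x j) \<le> (3 + \<bar>a\<bar>) * qnorm (Z2 a) (U (r j))"
      unfolding w_def x_def by (rule Z2_trunc(2)[OF Ud(1)])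
    also have "\<dots> \<le> (3 + \<bar>a\<bar>) * M" using Ud(2) by (intro mult_left_mono) auto
    finally show "qnorm (Z2 a) (w j, x j) \<le> (3 + \<bar>a\<bar>) * M" .
  qed
  have dl: "w j - KP_map a (x j) \<in> l2_set" "l2_norm (w j - KP_map a (x j)) \<le> (3 + \<bar>a\<bar>) * M" for j
    using wx[of j] l2_norm_nonneg[OF xl(1), of j] by (auto simp: qspace_Z2 qnorm_Z2)
  have eU: "U (r j) - (w j, x j) \<in> qspace (Z2 a)" "qnorm (Z2 a) (U (r j) - (w j, x j)) \<le> \<delta> j" for j
    using Z2D(3)[OF wx(1) Ud(1)] aU unfolding w_def x_def by auto
  have eY: "Y (r j) - (y j, 0) \<in> qspace (Z2 a)" "qnorm (Z2 a) (Y (r j) - (y j, 0)) \<le> \<delta> j" for j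
    using aY unfolding y_def by auto
  have xc: "c / 2 \<le> l2_norm (x j)" for j
  proof -
    have "snd (U (r j)) = x j + snd (U (r j) - (w j, x j))" by simp
    then have "l2_norm (snd (U (r j))) \<le> l2_norm (x j) + l2_norm (snd (U (r j) - (w j, x j)))"
      using l2_add(2)[OF xl(1)] eU(1) unfolding qspace_Z2 by metis
    moreover have "l2_norm (snd (U (r j) - (w j, x j))) \<le> c / 2"
      using eU[of j] \<delta>(2)[of j] l2_norm_nonneg unfolding qspace_Z2 qnorm_Z2 by fastforce
    ultimately show ?thesis using cr[of j] by linarith
  qed
  define D where "D = K * (M + 2 * K)"
  have D: "0 \<le> D" using K Ud(7) by (simp add: D_def)
  \<comment> \<open>The fibre defect of the sum after each given vector has been replaced by its
    block version.\<close>
  define F where "F A = (\<Sum>j\<in>A. seq_scale (\<psi> (card A)) (y j) + w j) - KP_map a (\<Sum>j\<in>A. x j)" for A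
  have Fb: "F A \<in> l2_set" "l2_norm (F A) \<le> D * sqrt (card A)" if A: "finite A" "A \<noteq> {}" for A
  proof -
    let ?N = "card A" and ?p = "\<psi> (card A)"
    have "1 \<le> ?N" using A by (simp add: Suc_le_eq card_gt_0_iff)
    then have N1: "1 \<le> sqrt ?N" by simp
    define e where "e j = qscale (Z2 a) ?p (Y (r j) - (y j, 0)) + (U (r j) - (w j, x j))" for j
    have me: "e j \<in> qspace (Z2 a)" for j unfolding e_def by (intro Z2D eU eY)
    have ne: "qnorm (Z2 a) (e j) \<le> K * (cmod ?p + 1) * \<delta> j" for j
    proof -
      have "qnorm (Z2 a) (e j) \<le> K * (cmod ?p * qnorm (Z2 a) (Y (r j) - (y j, 0)) + qnorm (Z2 a) (U (r j) - (w j, x j)))"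
        unfolding e_def Z2_scale(2)[OF eY(1), symmetric] by (intro tri Z2D eU eY)
      also have "\<dots> \<le> K * (cmod ?p * \<delta> j + \<delta> j)"
        using K eU(2) eY(2) by (intro mult_left_mono add_mono) auto
      finally show ?thesis by (simp add: algebra_simps)
    qed
    have "qnorm (Z2 a) (\<Sum>j\<in>A. e j) \<le> (\<Sum>j\<in>A. K ^ Suc j * qnorm (Z2 a) (e j))"
      by (intro qnorm_sum_le quasi_normed_space_Z2 K tri A(1) me)
    also have "\<dots> \<le> (\<Sum>j\<in>A. K * (cmod ?p + 1) * (1 / 2) ^ Suc j)"
    proof (rule sum_mono)
      fix j
      have "K ^ Suc j * qnorm (Z2 a) (e j) \<le> K ^ Suc j * (K * (cmod ?p + 1) * \<delta> j)"
        using ne K by (intro mult_left_mono) auto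
      also have "\<dots> = K * (cmod ?p + 1) * (K ^ Suc j * \<delta> j)" by (simp only: mult_ac)
      also have "\<dots> \<le> K * (cmod ?p + 1) * (1 / 2) ^ Suc j" using \<delta>(3) K by (intro mult_left_mono) auto
      finally show "K ^ Suc j * qnorm (Z2 a) (e j) \<le> K * (cmod ?p + 1) * (1 / 2) ^ Suc j" .
    qed
    also have "\<dots> \<le> K * (cmod ?p + 1) * 1"
      unfolding sum_distrib_left[symmetric] using K sum_half_power_le[OF A(1)] by (intro mult_left_mono) auto
    also have "\<dots> \<le> K * (2 * sqrt ?N)"
    proof -
      have "cmod ?p + 1 \<le> 2 * sqrt ?N" using \<psi>[of ?N] N1 by linarith
      then show ?thesis using K by simp
    qed
    finally have se: "qnorm (Z2 a) (\<Sum>j\<in>A. e j) \<le> K * (2 * sqrt ?N)" .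
    let ?V = "\<Sum>j\<in>A. qscale (Z2 a) ?p (Y (r j)) + U (r j)"
    have mV: "?V \<in> qspace (Z2 a)" by (intro qspace_sum quasi_normed_space_Z2 Z2D Ud Yd)
    have inj: "inj_on r A" using r(1) by (meson inj_on_subset strict_mono_imp_inj_on subset_UNIV)
    have nV: "qnorm (Z2 a) ?V \<le> M * sqrt ?N"
      using sums[rule_format, of "r ` A"] A(1) by (simp add: sum.reindex[OF inj] card_image[OF inj])
    have msum: "(\<Sum>j\<in>A. e j) \<in> qspace (Z2 a)" by (intro qspace_sum quasi_normed_space_Z2 me)
    note m1 = Z2D(4)[OF msum, of "- 1"]
    \<comment> \<open>The given sum minus the errors is exactly the sum of the block versions. The
      difference is written with a \<open>- 1\<close> multiple so that the quasi-triangle inequality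
      applies.\<close>
    define W where "W = ?V + qscale (Z2 a) (- 1) (\<Sum>j\<in>A. e j)"
    have mW: "W \<in> qspace (Z2 a)" unfolding W_def by (intro Z2D(2) mV m1)
    have "qnorm (Z2 a) W \<le> K * (M * sqrt ?N + K * (2 * sqrt ?N))"
      unfolding W_def using tri[OF mV m1] nV se K Z2_scale(2)[OF msum, of "- 1"]
      by (intro order_trans[OF tri[OF mV m1]] mult_left_mono add_mono) auto
    also have "\<dots> = D * sqrt ?N" by (simp add: D_def algebra_simps)
    finally have nW: "qnorm (Z2 a) W \<le> D * sqrt ?N" .
    have "snd W k = (\<Sum>j\<in>A. x j) k" "fst W k = (\<Sum>j\<in>A. seq_scale ?p (y j) + w j) k" for k
      unfolding W_def
      by (simp_all add: sum_fun_apply fst_sum snd_sum e_def seq_scale_def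
          flip: sum_distrib_left sum_subtractf sum.distrib sum_negf)
         (simp_all add: algebra_simps)
    then have "snd W = (\<Sum>j\<in>A. x j)" "fst W = (\<Sum>j\<in>A. seq_scale ?p (y j) + w j)" by blast+
    then have e: "F A = fst W - KP_map a (snd W)" by (simp add: F_def)
    show "F A \<in> l2_set" "l2_norm (F A) \<le> D * sqrt ?N"
      unfolding e using mW nW l2_norm_nonneg[of "snd W"] by (auto simp: qspace_Z2 qnorm_Z2)
  qed
  define B where "B N j = seq_scale (\<psi> N) (y j) + (\<lambda>k. x j k * (phi a (ln (l2_norm (x j) / cmod (x j k))) -
        phi a (ln (l2_norm (x j) / cmod (x j k)) + ln N / 2)))" for N j
  define C1 where "C1 = (3 + \<bar>a\<bar>) * M + (1 + \<bar>a\<bar>) * ln (2 * M / c) * M"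
  have Bb: "B (card A) m \<in> l2_set" "l2_norm (B (card A) m) \<le> l2_norm (trunc (J m) (F A)) + C1"
    if A: "finite A" "m \<in> A" for A m
  proof -
    let ?N = "card A" and ?p = "\<psi> (card A)" and ?X = "\<Sum>j\<in>A. x j"
    let ?R = "l2_norm ?X"
    have N1: "1 \<le> ?N" using A by (metis One_nat_def Suc_leI card_gt_0_iff empty_iff)
    have Xl: "?X \<in> l2_set" by (intro l2_sum xl)
    have R2: "?R\<^sup>2 = (\<Sum>j\<in>A. (l2_norm (x j))\<^sup>2)"
      unfolding x_def by (rule l2_norm_block_sum[OF A(1) r(2) Ud(3)])
    have "(c / 2 * sqrt ?N)\<^sup>2 = (\<Sum>j\<in>A. (c / 2)\<^sup>2)" by (simp add: power_mult_distrib power_divide)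
    also have "\<dots> \<le> ?R\<^sup>2" unfolding R2 using xc c by (intro sum_mono power_mono) auto
    finally have R1: "c / 2 * sqrt ?N \<le> ?R" by (rule power2_le_imp_le) (rule l2_norm_nonneg[OF Xl])
    have "?R\<^sup>2 \<le> (\<Sum>j\<in>A. M\<^sup>2)" unfolding R2 using xl l2_norm_nonneg by (intro sum_mono power_mono) auto
    also have "\<dots> = (M * sqrt ?N)\<^sup>2" by (simp add: power_mult_distrib)
    finally have R3: "?R \<le> M * sqrt ?N" by (rule power2_le_imp_le) (use Ud(7) in auto)
    have xm: "x m k = (if k \<in> J m then ?X k else 0)" for k
      using fun_cong[OF trunc_block_sum[OF A(1) r(2) A(2), of "\<lambda>j. snd (U (r j))"], of k]
      by (simp add: x_def split: if_splits)
    have tF: "trunc (J m) (F A) = (seq_scale ?p (y m) + w m) - (\<lambda>k. Om a ?R (x m k))"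
    proof
      fix k
      have "trunc (J m) (\<Sum>j\<in>A. y j) = y m" "trunc (J m) (\<Sum>j\<in>A. w j) = w m"
        unfolding y_def w_def by (rule trunc_block_sum[OF A(1) r(2) A(2)])+
      then have "trunc (J m) (\<Sum>j\<in>A. y j) k = y m k" "trunc (J m) (\<Sum>j\<in>A. w j) k = w m k" by simp_all
      moreover have "y m k = 0" "w m k = 0" if "k \<notin> J m" using that by (simp_all add: y_def w_def)
      ultimately have "k \<in> J m \<Longrightarrow> (\<Sum>j\<in>A. seq_scale ?p (y j) + w j) k = ?p * y m k + w m k"
        by (simp add: sum_fun_apply seq_scale_def sum.distrib flip: sum_distrib_left)
      then show "trunc (J m) (F A) k = ((seq_scale ?p (y m) + w m) - (\<lambda>k. Om a ?R (x m k))) k"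
        using \<open>k \<notin> J m \<Longrightarrow> y m k = 0\<close> \<open>k \<notin> J m \<Longrightarrow> w m k = 0\<close>
        by (simp add: F_def KP_map_eq[OF Xl] xm seq_scale_def)
    qed
    let ?r = "l2_norm (x m)"
    \<comment> \<open>\<open>G\<close> is the error from replacing the norm \<open>?R\<close> of the
      sum by \<open>?r * sqrt ?N\<close>. Both \<open>?R / sqrt ?N\<close> and \<open>?r\<close> lie
      between \<open>c / 2\<close> and \<open>M\<close>, so the arguments of \<open>phi\<close>
      differ by at most \<open>ln (2 * M / c)\<close>.\<close>
    define G where "G = (\<lambda>k. Om a ?R (x m k) - x m k * phi a (ln (?r / cmod (x m k)) + ln ?N / 2))"
    have rp: "0 < ?r" "?r \<le> M" "c / 2 \<le> ?r" using xc[of m] c xl by auto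
    have Rp: "0 < ?R" using R1 N1 c by (smt (verit) divide_pos_pos mult_pos_pos of_nat_0_less_iff less_le_trans zero_less_one real_sqrt_gt_zero)
    have Mc: "0 \<le> ln (2 * M / c)" using rp c by simp
    have Gk: "cmod (G k) \<le> (1 + \<bar>a\<bar>) * ln (2 * M / c) * cmod (x m k)" for k
    proof (cases "x m k = 0")
      case True
      then show ?thesis by (simp add: G_def)
    next
      case False
      then have p: "0 < cmod (x m k)" by simp
      have le: "cmod (x m k) \<le> ?r" using cmod_le_l2_norm xl by blast
      have le': "cmod (x m k) \<le> ?R" using cmod_le_l2_norm[OF Xl, of k] Rp by (simp add: xm)
      let ?s = "ln (?R / cmod (x m k))" and ?t = "ln (?r / cmod (x m k)) + ln ?N / 2"
      have st: "\<bar>?s - ?t\<bar> \<le> ln (2 * M / c)"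
      proof -
        have "?s - ?t = ln (?R / sqrt ?N) - ln ?r"
          using p rp Rp N1 by (simp add: ln_div ln_sqrt)
        moreover have "ln (c / 2) \<le> ln (?R / sqrt ?N)" "ln (?R / sqrt ?N) \<le> ln M"
          using R1 R3 c N1 Rp rp by (auto intro!: ln_mono simp: field_simps)
        moreover have "ln (c / 2) \<le> ln ?r" "ln ?r \<le> ln M" using rp c by (auto intro!: ln_mono)
        moreover have "ln M - ln (c / 2) = ln (2 * M / c)" using rp c by (simp add: ln_div ln_mult)
        ultimately show ?thesis by linarith
      qed
      have "cmod (G k) = cmod (x m k) * cmod (phi a ?s - phi a ?t)"
        by (simp add: G_def Om_def norm_mult flip: right_diff_distrib)
      also have "\<dots> \<le> cmod (x m k) * ((1 + \<bar>a\<bar>) * \<bar>?s - ?t\<bar>)"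
        using p le le' N1 by (intro mult_left_mono phi_lipschitz add_nonneg_nonneg) auto
      also have "\<dots> \<le> cmod (x m k) * ((1 + \<bar>a\<bar>) * ln (2 * M / c))"
        using st by (intro mult_left_mono) auto
      finally show ?thesis by (simp only: mult_ac)
    qed
    have Gl: "G \<in> l2_set" "l2_norm G \<le> (1 + \<bar>a\<bar>) * ln (2 * M / c) * M"
    proof -
      have nn: "0 \<le> (1 + \<bar>a\<bar>) * ln (2 * M / c)" using Mc by simp
      show "G \<in> l2_set" using l2_dominated(1)[OF xl(1) nn Gk] .
      show "l2_norm G \<le> (1 + \<bar>a\<bar>) * ln (2 * M / c) * M"
        using l2_dominated(2)[OF xl(1) nn Gk] mult_left_mono[OF xl(2) nn] order_trans by blast
    qed
    \<comment> \<open>Subtracting the bounded fibre defect of \<open>(w m, x m)\<close> trades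
      \<open>w m\<close> for the Kalton--Peck image of \<open>x m\<close>, which is the first
      \<open>phi\<close> term in \<open>B\<close>.\<close>
    have e: "B ?N m = (trunc (J m) (F A) - (w m - KP_map a (x m))) + G"
      unfolding tF B_def G_def
      by (simp add: fun_eq_iff KP_map_eq[OF xl(1)]) (simp add: Om_def algebra_simps)
    have "A \<noteq> {}" using A by auto
    note 1 = l2_trunc(1)[OF Fb(1)[OF A(1) this], of "J m"]
    note 2 = l2_diff[OF 1 dl(1)[of m]]
    note 3 = l2_add[OF 2(1) Gl(1)]
    show "B ?N m \<in> l2_set" unfolding e by (rule 3)
    show "l2_norm (B ?N m) \<le> l2_norm (trunc (J m) (F A)) + C1"
      unfolding e C1_def using 2(2) 3(2) dl(2)[of m] Gl(2) by linarith
  qed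
  \<comment> \<open>\<open>N\<close> bad indices would form a set \<open>A\<close> contradicting the bound on \<open>F A\<close>.\<close>
  have bad: "finite {m. \<not> l2_norm (B N m) \<le> D + 1 + C1}" if N: "N \<noteq> 0" for N
  proof (rule ccontr)
    assume "infinite {m. \<not> l2_norm (B N m) \<le> D + 1 + C1}"
    then obtain A where A: "A \<subseteq> {m. \<not> l2_norm (B N m) \<le> D + 1 + C1}" "card A = N" "finite A"
      using infinite_arbitrarily_large by blast
    then have ne: "A \<noteq> {}" using N by auto
    have "(\<Sum>m\<in>A. (D + 1)\<^sup>2) \<le> (\<Sum>m\<in>A. (l2_norm (trunc (J m) (F A)))\<^sup>2)"
    proof (intro sum_mono power_mono)
      fix m assume m: "m \<in> A"
      then have "D + 1 + C1 < l2_norm (B N m)" using A by auto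
      then show "D + 1 \<le> l2_norm (trunc (J m) (F A))" using Bb(2)[OF A(3) m] A(2) by simp
    qed (use D in auto)
    also have "\<dots> \<le> (l2_norm (F A))\<^sup>2" by (rule sum_l2_norm_trunc_le[OF Fb(1)[OF A(3) ne] A(3) r(2)])
    also have "\<dots> \<le> (D * sqrt (card A))\<^sup>2"
      using Fb[OF A(3) ne] by (intro power_mono l2_norm_nonneg)
    also have "\<dots> = card A * D\<^sup>2" by (simp add: power_mult_distrib)
    finally have "real N * (D + 1)\<^sup>2 \<le> real N * D\<^sup>2" using A(2) by simp
    then have "(D + 1)\<^sup>2 \<le> D\<^sup>2" using N by simp
    then show False using D by (simp add: power2_eq_square algebra_simps)
  qed
  show ?thesis
  proof (intro exI[of _ "D + 1 + C1"] allI impI)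
    fix F :: "nat set" assume F: "finite F \<and> 0 \<notin> F"
    have "finite (\<Union>N\<in>F. {m. \<not> l2_norm (B N m) \<le> D + 1 + C1})"
    proof (intro finite_UN_I bad)
      show "N \<noteq> 0" if "N \<in> F" for N using F that by metis
    qed (use F in simp)
    from ex_new_if_finite[OF infinite_UNIV_nat this]
    obtain m where m: "m \<notin> (\<Union>N\<in>F. {m. \<not> l2_norm (B N m) \<le> D + 1 + C1})"
      by (elim exE)
    show "\<exists>x\<in>l2_set. \<exists>y\<in>l2_set. c / 2 \<le> l2_norm x \<and>
      (\<forall>N\<in>F. let v = seq_scale (\<psi> N) y + (\<lambda>k. x k * (phi a (ln (l2_norm x / cmod (x k))) -
          phi a (ln (l2_norm x / cmod (x k)) + ln N / 2)))
        in v \<in> l2_set \<and> l2_norm v \<le> D + 1 + C1)"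
    proof (rule bexI[of _ "x m"], rule bexI[of _ "y m"], rule conjI)
      show "\<forall>N\<in>F. let v = seq_scale (\<psi> N) (y m) + (\<lambda>k. x m k * (phi a (ln (l2_norm (x m) / cmod (x m k))) -
          phi a (ln (l2_norm (x m) / cmod (x m k)) + ln N / 2)))
        in v \<in> l2_set \<and> l2_norm v \<le> D + 1 + C1"
        unfolding Let_def B_def[symmetric]
      proof
        fix N assume N: "N \<in> F"
        \<comment> \<open>Any set of \<open>N\<close> indices containing \<open>m\<close> will do,
          since \<open>B\<close> depends only on its cardinality and on \<open>m\<close>.\<close>
        define A where "A = {m..<m + N}"
        have A: "finite A" "m \<in> A" "card A = N" using N F by (auto simp: A_def intro: gr0I)
        show "B N m \<in> l2_set \<and> l2_norm (B N m) \<le> D + 1 + C1"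
          using Bb(1)[OF A(1,2)] A(3) m N by auto
      qed
    qed (use xc xl yl in auto)
  qed
qed

text \<open>\<open>block_sum_estimate\<close> with zero \<open>Y\<close> and zero
  \<open>\<psi>\<close> leaves \<open>x\<close> times a difference of \<open>phi\<close> at
  arguments \<open>ln N / 2\<close> apart. As \<open>cmod (phi a t) = t\<close>, that difference has
  modulus at least \<open>ln N / 2\<close>, so the bound would force the norm of \<open>x\<close>
  below \<open>c / 2\<close> for large \<open>N\<close>.\<close>

lemma sum_sections_unbounded:
  assumes U: "bounded_null a M U" and c: "0 < c"
    and freq: "\<exists>\<^sub>F n in sequentially. c \<le> l2_norm (snd (U n))"
  shows "\<exists>A. finite A \<and> C * sqrt (card A) < qnorm (Z2 a) (\<Sum>n\<in>A. U n)"
proof (rule ccontr)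
  assume "\<not> ?thesis"
  then have n: "qnorm (Z2 a) (\<Sum>n\<in>A. U n) \<le> C * sqrt (card A)" if "finite A" for A
    using that by force
  \<comment> \<open>\<open>block_sum_estimate\<close> uses one constant for the vectors and for
    their sums.\<close>
  define M' where "M' = max M C"
  have U': "bounded_null a M' U" using U unfolding bounded_null_def M'_def by (auto intro: order_trans)
  have Y': "bounded_null a M' (\<lambda>_. 0)"
    using bounded_nullD(7)[OF U'] quasi_normed_spaceD[OF quasi_normed_space_Z2[of a]]
    by (simp add: bounded_null_def)
  have z: "l2_norm 0 = 0" by simp
  have sums: "qnorm (Z2 a) (\<Sum>n\<in>A. qscale (Z2 a) 0 0 + U n) \<le> M' * sqrt (card A)" if "finite A" for A
  proof -
    have "qscale (Z2 a) 0 0 = 0" by (simp add: seq_scale_def prod_eq_iff fun_eq_iff)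
    then have "qnorm (Z2 a) (\<Sum>n\<in>A. qscale (Z2 a) 0 0 + U n) \<le> C * sqrt (card A)" using n[OF that] by simp
    also have "\<dots> \<le> M' * sqrt (card A)" by (intro mult_right_mono) (auto simp: M'_def)
    finally show ?thesis .
  qed
  have "\<exists>C. \<forall>F. finite F \<and> 0 \<notin> F \<longrightarrow> (\<exists>x\<in>l2_set. \<exists>y\<in>l2_set. c / 2 \<le> l2_norm x \<and>
    (\<forall>N\<in>F. let v = seq_scale 0 y + (\<lambda>k. x k * (phi a (ln (l2_norm x / cmod (x k))) -
        phi a (ln (l2_norm x / cmod (x k)) + ln (real N) / 2)))
      in v \<in> l2_set \<and> l2_norm v \<le> C))"
    using block_sum_estimate[OF U' Y' c, of "\<lambda>_. 0"] freq sums z by simp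
  then obtain C' where C': "\<forall>F. finite F \<and> 0 \<notin> F \<longrightarrow> (\<exists>x\<in>l2_set. \<exists>y\<in>l2_set. c / 2 \<le> l2_norm x \<and>
    (\<forall>N\<in>F. let v = seq_scale 0 y + (\<lambda>k. x k * (phi a (ln (l2_norm x / cmod (x k))) -
        phi a (ln (l2_norm x / cmod (x k)) + ln (real N) / 2)))
      in v \<in> l2_set \<and> l2_norm v \<le> C'))"
    by (elim exE)
  obtain q :: nat where q: "C' < q * (c / 2)" using c by (meson half_gt_zero reals_Archimedean3)
  define N where "N = nat \<lceil>exp (2 * real q)\<rceil>"
  have "exp (2 * real q) \<le> N" by (simp add: N_def of_nat_ceiling)
  moreover from this have "0 < real N" by (rule less_le_trans[OF exp_gt_zero])
  ultimately have N: "N \<noteq> 0" "real q \<le> ln N / 2"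
    using ln_mono[of "exp (2 * real q)" N] by auto
  obtain x where x: "x \<in> l2_set" "c / 2 \<le> l2_norm x"
    and v: "let v = (\<lambda>k. x k * (phi a (ln (l2_norm x / cmod (x k))) -
        phi a (ln (l2_norm x / cmod (x k)) + ln N / 2))) in v \<in> l2_set \<and> l2_norm v \<le> C'"
  proof -
    have "seq_scale 0 y = 0" for y by (simp add: seq_scale_def fun_eq_iff)
    then show thesis using C'[rule_format, of "{N}"] N(1) that by (auto simp: Let_def)
  qed
  let ?v = "\<lambda>k. x k * (phi a (ln (l2_norm x / cmod (x k))) - phi a (ln (l2_norm x / cmod (x k)) + ln N / 2))"
  have "cmod (x k) \<le> 1 / real q * cmod (?v k)" if "q \<noteq> 0" for k
  proof (cases "x k = 0")
    case False
    let ?s = "ln (l2_norm x / cmod (x k))"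
    have s: "0 \<le> ?s" using False cmod_le_l2_norm[OF x(1), of k] by simp
    have "real q \<le> cmod (phi a (?s + ln N / 2)) - cmod (phi a ?s)" using s N by (simp add: norm_phi)
    also have "\<dots> \<le> cmod (phi a ?s - phi a (?s + ln N / 2))"
      by (metis norm_minus_commute norm_triangle_ineq2)
    finally have "cmod (x k) * real q \<le> cmod (?v k)" by (simp add: norm_mult mult_left_mono)
    then show ?thesis using that by (simp add: field_simps)
  qed simp
  then have "l2_norm x \<le> 1 / real q * l2_norm ?v" if "q \<noteq> 0"
    using l2_dominated(2)[of ?v "1 / real q" x] v that by (simp add: Let_def)
  then have "real q * l2_norm x \<le> C'" using v l2_norm_nonneg[of ?v] by (cases "q = 0") (auto simp: Let_def field_simps)
  moreover have "q * (c / 2) \<le> q * l2_norm x" using x by (intro mult_left_mono) auto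
  ultimately show False using q by linarith
qed

section \<open>Singularity of the quotient map\<close>

text \<open>A finite spanning set of the kernel together with one vector outside it would span
  \<open>V\<close>.\<close>

lemma infinite_dimensional_kernel:
  fixes X :: "'v::ab_group_add quasi_normed" and f :: "'v \<Rightarrow> complex"
  assumes X: "vector_space (qscale X)" and V: "module.subspace (qscale X) V" "infinite_dimensional X V"
    and f: "\<And>u v. f (u + v) = f u + f v" "\<And>c v. f (qscale X c v) = c * f v"
  shows "module.subspace (qscale X) {v \<in> V. f v = 0}" "infinite_dimensional X {v \<in> V. f v = 0}"
proof -
  interpret vector_space "qscale X" by (rule X)
  have f0: "f 0 = 0" using f(2)[of 0 0] by simp
  show "subspace {v \<in> V. f v = 0}"
    using V(1) f f0 by (auto simp: subspace_def)
  show "infinite_dimensional X {v \<in> V. f v = 0}"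
    unfolding infinite_dimensional_def
  proof
    assume "\<exists>B. finite B \<and> B \<subseteq> {v \<in> V. f v = 0} \<and> {v \<in> V. f v = 0} \<subseteq> span B"
    then obtain B where B: "finite B" "B \<subseteq> V" "{v \<in> V. f v = 0} \<subseteq> span B" by blast
    show False
    proof (cases "\<forall>v\<in>V. f v = 0")
      case True
      then have "V \<subseteq> span B" using B(3) by blast
      then show False using V(2) B by (auto simp: infinite_dimensional_def)
    next
      case False
      then obtain v0 where v0: "v0 \<in> V" "f v0 \<noteq> 0" by blast
      have "v \<in> span (insert v0 B)" if v: "v \<in> V" for v
      proof -
        let ?c = "f v / f v0"
        have "v - qscale X ?c v0 \<in> V" using V(1) v v0 subspace_diff subspace_scale by blast
        moreover have "f (v - qscale X ?c v0) + f (qscale X ?c v0) = f v" using f(1) by (metis diff_add_cancel)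
        then have "f (v - qscale X ?c v0) = 0" using v0 f(2) by simp
        ultimately have "v - qscale X ?c v0 \<in> span (insert v0 B)"
          using B(3) span_mono[of B "insert v0 B"] by blast
        moreover have "qscale X ?c v0 \<in> span (insert v0 B)" by (simp add: span_base span_scale)
        ultimately show ?thesis using span_add by fastforce
      qed
      then show False using V(2) B v0
        unfolding infinite_dimensional_def by (metis finite_insert insert_subset subsetI)
    qed
  qed
qed

lemma infinite_dimensional_common_kernel:
  fixes X :: "'v::ab_group_add quasi_normed" and f :: "nat \<Rightarrow> 'v \<Rightarrow> complex"
  assumes X: "vector_space (qscale X)" and V: "module.subspace (qscale X) V" "infinite_dimensional X V"
    and f: "\<And>i u v. f i (u + v) = f i u + f i v" "\<And>i c v. f i (qscale X c v) = c * f i v"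
  shows "\<exists>v\<in>V. v \<noteq> 0 \<and> (\<forall>i<n. f i v = 0)"
proof -
  have K: "module.subspace (qscale X) {v \<in> V. \<forall>i<n. f i v = 0} \<and>
    infinite_dimensional X {v \<in> V. \<forall>i<n. f i v = 0}" for n
  proof (induction n)
    case (Suc n)
    have "{v \<in> V. \<forall>i<Suc n. f i v = 0} = {v \<in> {v \<in> V. \<forall>i<n. f i v = 0}. f n v = 0}"
      by (auto simp: less_Suc_eq)
    then show ?case
      using infinite_dimensional_kernel[where f = "f n", OF X conjunct1[OF Suc] conjunct2[OF Suc] f]
      by simp
  qed (use V in simp)
  interpret vector_space "qscale X" by (rule X)
  show ?thesis
  proof (rule ccontr)
    assume "\<not> ?thesis"
    then have "{v \<in> V. \<forall>i<n. f i v = 0} \<subseteq> span {}" by auto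
    then show False using K[of n] unfolding infinite_dimensional_def by blast
  qed
qed

lemma quasi_normed_space_restrict:
  assumes X: "quasi_normed_space X" and V: "module.subspace (qscale X) V" "V \<subseteq> qspace X"
  shows "quasi_normed_space (restrict_space_to X V)"
proof -
  have D: "vector_space (qscale X)"
    "\<forall>x\<in>qspace X. 0 \<le> qnorm X x \<and> (qnorm X x = 0 \<longleftrightarrow> x = 0)"
    "\<forall>c. \<forall>x\<in>qspace X. qnorm X (qscale X c x) = cmod c * qnorm X x"
    "\<exists>C. \<forall>x\<in>qspace X. \<forall>y\<in>qspace X. qnorm X (x + y) \<le> C * (qnorm X x + qnorm X y)"
    using X unfolding quasi_normed_space_def by - (elim conjE, assumption)+
  from D(4) obtain C where C: "\<forall>x\<in>qspace X. \<forall>y\<in>qspace X. qnorm X (x + y) \<le> C * (qnorm X x + qnorm X y)"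
    by (elim exE)
  let ?X = "restrict_space_to X V"
  have e: "qspace ?X = V" "qscale ?X = qscale X" "qnorm ?X = qnorm X" by (simp_all add: restrict_space_to_def)
  show ?thesis
    unfolding quasi_normed_space_def e
  proof (intro conjI exI[of _ C])
    show "\<forall>x\<in>V. \<forall>y\<in>V. qnorm X (x + y) \<le> C * (qnorm X x + qnorm X y)"
      using C V(2) by (simp add: subset_eq)
  qed (use D(1-3) V in \<open>simp_all add: subset_eq\<close>)
qed

lemma bounded_null_subseq:
  assumes "bounded_null a M U" "strict_mono r"
  shows "bounded_null a M (\<lambda>n. U (r n))"
  using assms LIMSEQ_subseq_LIMSEQ[OF _ assms(2)] by (fastforce simp: bounded_null_def o_def)

lemma subspace_image:
  fixes X :: "'v::ab_group_add quasi_normed" and Y :: "'w::ab_group_add quasi_normed"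
  assumes X: "quasi_normed_space X" and Y: "quasi_normed_space Y" and T: "linear_map X Y T"
    and V: "module.subspace (qscale X) V" "V \<subseteq> qspace X"
  shows "module.subspace (qscale Y) (T ` V)" "T ` V \<subseteq> qspace Y"
proof -
  have X': "vector_space (qscale X)" and Y': "vector_space (qscale Y)"
    using X Y by (simp_all only: quasi_normed_space_def)
  have add: "T (x + y) = T x + T y" and sc: "T (qscale X c x) = qscale Y c (T x)" if "x \<in> V" "y \<in> V" for x y c
    using T that(1)[THEN subsetD[OF V(2)]] that(2)[THEN subsetD[OF V(2)]] by (simp_all add: linear_map_def)
  note S = V(1)[unfolded subspace_iff[OF X']]
  show "module.subspace (qscale Y) (T ` V)"
    unfolding subspace_iff[OF Y']
  proof (intro conjI ballI allI)
    show "0 \<in> T ` V" using linear_map_0[OF X T] S by (metis image_eqI)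
  next
    fix u v assume "u \<in> T ` V" "v \<in> T ` V"
    then show "u + v \<in> T ` V" using S add by (force simp flip: add)
  next
    fix c u assume "u \<in> T ` V"
    then show "qscale Y c u \<in> T ` V" using S sc by (force simp flip: sc)
  qed
  show "T ` V \<subseteq> qspace Y" using T V(2) by (auto simp: linear_map_def)
qed

text \<open>On a subspace \<open>V\<close> where the quotient map is an isomorphism, the quasi-norm
  is dominated by the norm of the quotient component. Normalised vectors of \<open>V\<close>
  vanishing on longer and longer initial segments then form a bounded null sequence, and along a
  subsequence the sums of \<open>N\<close> terms are of order \<open>sqrt N\<close>, contrary to
  \<open>sum_sections_unbounded\<close>.\<close>

lemma strictly_singular_Z2: "strictly_singular (Z2 a) l2 (\<lambda>(w, x). x)"
  unfolding strictly_singular_def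
proof (intro conjI notI)
  show bo: "bounded_operator (Z2 a) l2 (\<lambda>(w, x). x)"
    using short_exact_Z2[of a] by (simp add: short_exact_def)
  then have q: "linear_map (Z2 a) l2 (\<lambda>(w, x). x)" by (simp add: bounded_operator_def)
  assume "\<exists>V. closed_subspace (Z2 a) V \<and> infinite_dimensional (Z2 a) V \<and>
    isomorphism (restrict_space_to (Z2 a) V) (restrict_space_to l2 ((\<lambda>(w, x). x) ` V)) (\<lambda>(w, x). x)"
  then obtain V where V: "closed_subspace (Z2 a) V" "infinite_dimensional (Z2 a) V"
    and iso: "isomorphism (restrict_space_to (Z2 a) V) (restrict_space_to l2 ((\<lambda>(w, x). x) ` V)) (\<lambda>(w, x). x)"
    by (elim exE conjE)
  have sV: "module.subspace (qscale (Z2 a)) V" "V \<subseteq> qspace (Z2 a)"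
    using V(1) closedin_subset topspace_qtop unfolding closed_subspace_def by blast+
  note qV = quasi_normed_space_restrict[OF quasi_normed_space_Z2 sV]
  note qI = quasi_normed_space_restrict[OF quasi_normed_space_l2 subspace_image[OF quasi_normed_space_Z2 quasi_normed_space_l2 q sV]]
  obtain M where M0: "0 \<le> M" and
    "\<And>x. x \<in> qspace (restrict_space_to (Z2 a) V) \<Longrightarrow> qnorm (restrict_space_to (Z2 a) V) x
      \<le> M * qnorm (restrict_space_to l2 ((\<lambda>(w, x). x) ` V)) ((\<lambda>(w, x). x) x)"
    using isomorphism_bounds[OF qV qI iso] by metis
  then have M: "qnorm (Z2 a) v \<le> M * l2_norm (snd v)" if "v \<in> V" for v
    using that by (simp add: restrict_space_to_def case_prod_beta)
  have "\<exists>v\<in>V. l2_norm (snd v) = 1 \<and> (\<forall>k<n. fst v k = 0 \<and> snd v k = 0)" for n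
  proof -
    \<comment> \<open>Even and odd indices interleave the coordinates of the two components, so the
      vanishing of \<open>2 * n\<close> functionals clears the first \<open>n\<close> coordinates of
      both.\<close>
    define f where "f i v = (if even i then fst v (i div 2) else snd v (i div 2))" for i and v :: "cseq \<times> cseq"
    have "\<exists>v\<in>V. v \<noteq> 0 \<and> (\<forall>i<2 * n. f i v = 0)"
      by (rule infinite_dimensional_common_kernel[OF vector_space_qscale_Z2 sV(1) V(2)])
         (auto simp: f_def seq_scale_def)
    then obtain v where v: "v \<in> V" "v \<noteq> 0" "\<And>i. i < 2 * n \<Longrightarrow> f i v = 0" by blast
    have k: "fst v k = 0" "snd v k = 0" if "k < n" for k
      using v(3)[of "2 * k"] v(3)[of "2 * k + 1"] that by (auto simp: f_def)
    have vZ: "v \<in> qspace (Z2 a)" using v sV by blast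
    then have nn: "0 \<le> l2_norm (snd v)" by (simp add: qspace_Z2 l2_norm_nonneg)
    have "snd v \<noteq> 0"
    proof
      assume "snd v = 0"
      then have "qnorm (Z2 a) v \<le> 0" using M[OF v(1)] by simp
      then show False using vZ v(2) quasi_normed_space_Z2[of a] by (auto simp: quasi_normed_space_def)
    qed
    then have p: "0 < l2_norm (snd v)" using vZ nn by (simp add: qspace_Z2 l2_norm_eq_0 less_le)
    let ?c = "complex_of_real (1 / l2_norm (snd v))"
    let ?u = "qscale (Z2 a) ?c v"
    have "?u \<in> V" using sV(1) v(1) unfolding subspace_iff[OF vector_space_qscale_Z2] by blast
    moreover have "l2_norm (snd ?u) = 1" using p vZ by (simp add: l2_scale qspace_Z2 norm_divide)
    moreover have "fst ?u k = 0" "snd ?u k = 0" if "k < n" for k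
      using k[OF that] by (simp_all add: seq_scale_def)
    ultimately show ?thesis by blast
  qed
  then obtain v where v: "\<And>n. v n \<in> V" "\<And>n. l2_norm (snd (v n)) = 1"
    and v0: "\<And>n k. k < n \<Longrightarrow> fst (v n) k = 0 \<and> snd (v n) k = 0" by metis
  have vZ: "v n \<in> qspace (Z2 a)" for n using v(1) sV(2) by blast
  have null: "(\<lambda>n. fst (v n) k) \<longlonglongrightarrow> 0" "(\<lambda>n. snd (v n) k) \<longlonglongrightarrow> 0" for k
    by (rule tendsto_eventually, rule eventually_mono[OF eventually_gt_at_top[of k]], use v0 in blast)+
  have bv: "bounded_null a M v"
    using M[OF v(1)] v(2) vZ null by (simp add: bounded_null_def)
  \<comment> \<open>Moving the quotient components into the fibre, where the quasi-norm is the
    \<open>l2\<close> norm, lets \<open>bounded_null_subsequence_sums\<close> extract the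
    subsequence.\<close>
  have "bounded_null a 1 (\<lambda>n. (snd (v n), 0))"
    using v(2) vZ null by (simp add: bounded_null_def qspace_Z2 qnorm_Z2)
  from bounded_null_subsequence_sums[OF this] obtain r :: "nat \<Rightarrow> nat" and C where r: "strict_mono r"
    and C: "\<forall>A. finite A \<longrightarrow> qnorm (Z2 a) (\<Sum>n\<in>A. (snd (v (r n)), 0)) \<le> C * sqrt (card A)"
    by auto
  obtain A where A: "finite A" "M * C * sqrt (card A) < qnorm (Z2 a) (\<Sum>n\<in>A. v (r n))"
    using sum_sections_unbounded[OF bounded_null_subseq[OF bv r], of 1 "M * C"] v(2) by auto
  have "(\<Sum>n\<in>A. v (r n)) \<in> V"
    using qspace_sum[OF qV, of A "\<lambda>n. v (r n)"] v(1) by (simp add: restrict_space_to_def)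
  then have "qnorm (Z2 a) (\<Sum>n\<in>A. v (r n)) \<le> M * l2_norm (snd (\<Sum>n\<in>A. v (r n)))" by (rule M)
  also have "l2_norm (snd (\<Sum>n\<in>A. v (r n))) = qnorm (Z2 a) (\<Sum>n\<in>A. (snd (v (r n)), 0))"
    by (simp add: qnorm_Z2 snd_sum fst_sum)
  also have "M * \<dots> \<le> M * (C * sqrt (card A))" using C A(1) M0 by (intro mult_left_mono) auto
  finally show False using A(2) by simp
qed

section \<open>Oscillation of the difference quotients\<close>

text \<open>Otherwise the value \<open>1\<close> would also be taken at every ratio
  \<open>(n + 1) / n\<close>, but for large \<open>n\<close> the angle
  \<open>\<gamma> * ln (1 + 1 / n)\<close> is nonzero and below \<open>pi\<close> in modulus. An
  integer \<open>p\<close> is wanted so that \<open>p * t\<close> is of the form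
  \<open>ln N / 2\<close> whenever \<open>t\<close> is.\<close>

lemma exists_cis_ln_neq_1:
  assumes "\<gamma> \<noteq> 0"
  shows "\<exists>p::nat. (1::nat) \<le> p \<and> cis (\<gamma> * ln p) \<noteq> 1"
proof (rule ccontr)
  assume "\<not> ?thesis"
  then have 1: "cis (\<gamma> * ln p) = 1" if "1 \<le> p" for p :: nat using that by blast
  obtain n :: nat where n: "\<bar>\<gamma>\<bar> < n" using reals_Archimedean2 by blast
  then have n1: "1 \<le> n" using assms by (cases n) auto
  define z where "z = \<gamma> * ln (1 + 1 / n)"
  have "1 + 1 / real n = real (Suc n) / real n" using n1 by (simp add: field_simps)
  then have "z = \<gamma> * ln (Suc n) - \<gamma> * ln n" using n1 by (simp only: z_def ln_div) (simp add: algebra_simps ln_div)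
  then have "cis z = 1" using 1[of n] 1[of "Suc n"] n1 by (simp add: cis_divide[symmetric])
  then have s: "sin z = 0" by (metis Im_complex_of_real cis.sel(2) of_real_1)
  have l: "0 < ln (1 + 1 / real n)" using n1 by (intro ln_gt_zero) simp
  have "\<bar>z\<bar> = \<bar>\<gamma>\<bar> * ln (1 + 1 / n)" using l by (simp add: z_def abs_mult)
  also have "\<dots> \<le> \<bar>\<gamma>\<bar> * (1 / n)" using ln_add_one_self_le_self[of "1 / n"] by (intro mult_left_mono) auto
  also have "\<dots> < 1" using n n1 by simp
  also have "1 < pi" using pi_gt3 by simp
  finally have zp: "\<bar>z\<bar> < pi" .
  have "z \<noteq> 0" using l assms by (simp add: z_def)
  then show False using s zp sin_gt_zero[of z] sin_gt_zero[of "- z"] by (cases "0 < z") auto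
qed

section \<open>Difference quotients for small and for large \<open>s / t\<close>\<close>

definition slope :: "real \<Rightarrow> real \<Rightarrow> real \<Rightarrow> real \<Rightarrow> complex" where
  "slope a b t s = (phi b (s + t) - phi b s) / phi a t"

text \<open>\<open>phi b (s + t)\<close> is close to \<open>phi b t\<close> by the Lipschitz bound,
  \<open>phi b s\<close> has modulus \<open>s\<close>, and \<open>phi b t / phi a t\<close> is
  exactly the oscillating factor.\<close>

lemma slope_near:
  assumes "0 \<le> s" "0 < t"
  shows "cmod (slope a b t s - cis ((b - a) * ln t)) \<le> (2 + \<bar>b\<bar>) * (s / t)"
proof -
  have n: "phi a t \<noteq> 0" using assms by (simp add: phi_def)
  have "phi b t = cis ((b - a) * ln t) * phi a t"
    by (simp add: phi_def cis_mult algebra_simps)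
  then have "slope a b t s - cis ((b - a) * ln t) = (phi b (s + t) - phi b t - phi b s) / phi a t"
    using n by (simp add: slope_def field_simps)
  then have "cmod (slope a b t s - cis ((b - a) * ln t)) = cmod (phi b (s + t) - phi b t - phi b s) / t"
    using assms by (simp add: norm_divide norm_phi)
  also have "cmod (phi b (s + t) - phi b t - phi b s) \<le> cmod (phi b (s + t) - phi b t) + cmod (phi b s)"
    by (rule norm_triangle_ineq4)
  also have "\<dots> \<le> (1 + \<bar>b\<bar>) * s + s"
    using phi_lipschitz[of "s + t" t b] assms by (simp add: norm_phi)
  finally show ?thesis using assms by (simp add: field_simps)
qed

lemma cis_taylor: "cmod (cis y - 1 - \<i> * y) \<le> exp \<bar>y\<bar> * y\<^sup>2"
  using Taylor_exp_field[of "\<i> * complex_of_real y" 1]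
  by (simp add: cis_conv_exp norm_mult power2_eq_square algebra_simps)

text \<open>First order expansion: \<open>(1 + \<i> * b) * cis (b * ln s)\<close> is the derivative
  of \<open>phi b\<close> at \<open>s\<close>, and dividing \<open>t\<close> by
  \<open>phi a t\<close> leaves \<open>cis (- a * ln t)\<close>.\<close>

lemma slope_far:
  fixes a b s t :: real
  assumes "0 < t" "t \<le> s"
  shows "cmod (slope a b t s - (1 + \<i> * b) * cis (b * ln s) * cis (- a * ln t)) \<le> (\<bar>b\<bar> + 2 * exp \<bar>b\<bar> * b\<^sup>2) * (t / s)"
proof -
  define x where "x = t / s"
  have x: "0 < x" "x \<le> 1" and s: "0 < s" using assms by (auto simp: x_def)
  define l where "l = ln (1 + x)"
  have l: "0 \<le> l" "l \<le> x" using x ln_add_one_self_le_self[of x] by (auto simp: l_def)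
  have lx: "x \<le> (1 + x) * l"
  proof -
    have "- ln (1 + x) \<le> 1 / (1 + x) - 1"
      using ln_le_minus_one[of "1 / (1 + x)"] x by (simp add: ln_div)
    then have "x / (1 + x) \<le> l" using x by (simp add: l_def field_simps)
    then show ?thesis using x by (simp add: field_simps)
  qed
  define y where "y = b * l"
  \<comment> \<open>The remainder of the first order expansion of \<open>1 + x\<close> to the power
    \<open>1 + \<i> * b\<close>. It has to be quadratic in \<open>x\<close> because it is divided by
    \<open>x\<close> at the end.\<close>
  define E where "E = (1 + x) * cis y - 1 - (1 + \<i> * b) * x"
  have "E = (1 + x) * (cis y - 1 - \<i> * y) + \<i> * b * ((1 + x) * l - x)"
    by (simp add: E_def y_def algebra_simps)
  then have "cmod E \<le> cmod ((1 + x) * (cis y - 1 - \<i> * y)) + cmod (\<i> * b * ((1 + x) * l - x))"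
    using norm_triangle_ineq by metis
  also have "cmod ((1 + x) * (cis y - 1 - \<i> * y)) = (1 + x) * cmod (cis y - 1 - \<i> * y)"
  proof -
    have "cmod (1 + complex_of_real x) = 1 + x" using x norm_of_real[of "1 + x"] by (simp del: norm_of_real)
    then show ?thesis by (simp add: norm_mult)
  qed
  also have "\<dots> \<le> 2 * (exp \<bar>b\<bar> * (b\<^sup>2 * x\<^sup>2))"
  proof (rule mult_mono)
    have yb: "\<bar>y\<bar> \<le> \<bar>b\<bar> * x" using l by (simp add: y_def abs_mult mult_left_mono)
    also have "\<dots> \<le> \<bar>b\<bar>" using x by (simp add: mult_left_le)
    finally have "exp \<bar>y\<bar> \<le> exp \<bar>b\<bar>" by simp
    moreover have "y\<^sup>2 \<le> b\<^sup>2 * x\<^sup>2" using power_mono[OF yb, of 2] by (simp add: power_mult_distrib)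
    ultimately have "exp \<bar>y\<bar> * y\<^sup>2 \<le> exp \<bar>b\<bar> * (b\<^sup>2 * x\<^sup>2)" by (intro mult_mono) auto
    then show "cmod (cis y - 1 - \<i> * y) \<le> exp \<bar>b\<bar> * (b\<^sup>2 * x\<^sup>2)" using cis_taylor[of y] by linarith
  qed (use x in auto)
  also have "cmod (\<i> * b * ((1 + x) * l - x)) = \<bar>b\<bar> * \<bar>(1 + x) * l - x\<bar>"
  proof -
    have "\<i> * b * ((1 + x) * l - x) = \<i> * complex_of_real (b * ((1 + x) * l - x))" by simp
    then show ?thesis by (simp only: norm_mult norm_of_real abs_mult) simp
  qed
  also have "\<bar>(1 + x) * l - x\<bar> \<le> x\<^sup>2"
  proof -
    have "(1 + x) * l \<le> (1 + x) * x" using l x by (intro mult_left_mono) auto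
    then show ?thesis using lx by (simp add: power2_eq_square algebra_simps)
  qed
  finally have E: "cmod E \<le> 2 * (exp \<bar>b\<bar> * (b\<^sup>2 * x\<^sup>2)) + \<bar>b\<bar> * x\<^sup>2" by (simp add: mult_left_mono)
  have st: "s + t = s * (1 + x)" "t = s * x" using s by (simp_all add: x_def field_simps)
  have "phi b (s + t) = s * cis (b * ln s) * ((1 + x) * cis y)"
  proof -
    have "ln (s * (1 + x)) = ln s + l" using s x by (simp add: ln_mult l_def)
    then have "cis (b * ln (s * (1 + x))) = cis (b * ln s) * cis y"
      by (simp only: cis_mult y_def distrib_left)
    then show ?thesis unfolding st(1) phi_def by (simp only: of_real_mult of_real_add of_real_1 mult_ac)
  qed
  then have e: "phi b (s + t) - phi b s = s * cis (b * ln s) * (E + (1 + \<i> * b) * x)"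
    by (simp add: phi_def E_def algebra_simps)
  have "slope a b t s - (1 + \<i> * b) * cis (b * ln s) * cis (- a * ln t) = s * cis (b * ln s) * E / phi a t"
  proof -
    have "(1 + \<i> * b) * cis (b * ln s) * cis (- a * ln t) = s * cis (b * ln s) * ((1 + \<i> * b) * x) / phi a t"
    proof -
      have c: "cis (- a * ln t) = s * x / phi a t"
        using assms(1) by (simp add: phi_def divide_complex_def cis_inverse flip: st(2) of_real_mult)
      show ?thesis unfolding c by (simp add: mult_ac)
    qed
    then show ?thesis unfolding slope_def e by (simp add: algebra_simps add_divide_distrib)
  qed
  then have "cmod (slope a b t s - (1 + \<i> * b) * cis (b * ln s) * cis (- a * ln t)) = s * cmod E / t"
    using s assms by (simp add: norm_mult norm_divide norm_phi)
  also have "\<dots> \<le> s * (2 * (exp \<bar>b\<bar> * (b\<^sup>2 * x\<^sup>2)) + \<bar>b\<bar> * x\<^sup>2) / t"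
    using E s assms by (intro divide_right_mono mult_left_mono) auto
  also have "\<dots> = (\<bar>b\<bar> + 2 * exp \<bar>b\<bar> * b\<^sup>2) * x"
    unfolding st(2) using s x by (simp add: field_simps power2_eq_square)
  finally show ?thesis by (simp add: x_def)
qed

text \<open>Two regimes are split at \<open>s = K * p * t\<close>. Above it, \<open>t\<close> and
  \<open>p * t\<close> are both small against \<open>s\<close>, and passing from one to the other
  rotates the limit by \<open>cis (- a * ln p)\<close>. Below it, \<open>q * t\<close> and
  \<open>q' * t\<close> are large against \<open>s\<close>, and the rotation is
  \<open>cis ((b - a) * ln p')\<close>. Neither rotation is trivial.\<close>

lemma slope_oscillates:
  fixes a b :: real
  assumes "a \<noteq> 0" "a \<noteq> b"
  shows "\<exists>\<kappa> (p::nat) (q::nat) (q'::nat). 0 < \<kappa> \<and> (1::nat) \<le> p \<and> (1::nat) \<le> q \<and> (1::nat) \<le> q' \<and>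
    (\<forall>(t::real) s. 0 < t \<longrightarrow> 0 \<le> s \<longrightarrow> \<kappa> \<le> cmod (slope a b t s - slope a b (p * t) s) \<or>
      \<kappa> \<le> cmod (slope a b (q * t) s - slope a b (q' * t) s))"
proof -
  obtain p :: nat where p: "(1::nat) \<le> p" "cis (- a * ln p) \<noteq> 1"
    using exists_cis_ln_neq_1[of "- a"] assms by auto
  obtain p' :: nat where p': "(1::nat) \<le> p'" "cis ((b - a) * ln p') \<noteq> 1"
    using exists_cis_ln_neq_1[of "b - a"] assms by auto
  define k where "k = cmod (1 - cis (- a * ln p))"
  define k' where "k' = cmod (1 - cis ((b - a) * ln p'))"
  have k: "0 < k" "0 < k'" using p p' by (simp_all add: k_def k'_def)
  define C where "C = \<bar>b\<bar> + 2 * exp \<bar>b\<bar> * b\<^sup>2"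
  have C: "0 \<le> C" by (simp add: C_def)
  \<comment> \<open>\<open>K\<close> makes the combined errors of \<open>slope_far\<close> and of
    \<open>slope_near\<close> at most half of the gaps \<open>k\<close> and
    \<open>k'\<close>.\<close>
  obtain K :: nat where K: "max (2 * C * (1 + p) / k) (4 * (2 + \<bar>b\<bar>) / k') + 1 < K"
    using reals_Archimedean2 by blast
  have "0 \<le> 2 * C * (1 + p) / k" using C k by simp
  then have K1: "1 \<le> K" using K by (simp add: less_max_iff_disj)
  have "2 * C * (1 + p) / k < K" "4 * (2 + \<bar>b\<bar>) / k' < K" using K by (auto simp: max_def split: if_splits)
  then have KC: "C * (1 + p) \<le> K * (k / 2)" "2 * (2 + \<bar>b\<bar>) \<le> K * (k' / 2)"
    using k by (simp_all add: field_simps)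
  \<comment> \<open>One factor \<open>K\<close> comes from the threshold \<open>K * p * t\<close>
    above \<open>s\<close>; the other makes \<open>s / (q * t)\<close> at most
    \<open>1 / K\<close>.\<close>
  define q where "q = K\<^sup>2 * p"
  have "min k k' / 2 \<le> cmod (slope a b t s - slope a b (p * t) s) \<or>
      min k k' / 2 \<le> cmod (slope a b (q * t) s - slope a b (p' * q * t) s)"
    if t: "0 < t" and s: "0 \<le> s" for t s :: real
  proof (cases "K * p * t \<le> s")
    case True
    have pt: "0 < p * t" using t p by simp
    have Kp: "1 * (p * t) \<le> K * (p * t)" using K1 pt by (intro mult_right_mono) auto
    then have ps: "p * t \<le> s" using True by (simp add: mult_ac)
    have "1 * t \<le> p * t" using t p by (intro mult_right_mono) auto
    then have ts: "t \<le> s" using ps by simp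
    have s0: "0 < s" using ts t by simp
    let ?z = "(1 + \<i> * b) * cis (b * ln s)"
    let ?w = "?z * cis (- a * ln t)" and ?w' = "?z * cis (- a * ln (p * t))"
    have "1 \<le> cmod (1 + \<i> * b)" using complex_Re_le_cmod[of "1 + \<i> * b"] by simp
    then have "k \<le> cmod (1 + \<i> * b) * k" using k by (simp add: mult_le_cancel_right1)
    also have "\<dots> = cmod (?w * (1 - cis (- a * ln p)))" by (simp add: k_def norm_mult)
    also have "?w * (1 - cis (- a * ln p)) = ?w - ?w'"
      using t p by (simp add: ln_mult cis_mult algebra_simps)
    also have "cmod (?w - ?w') \<le> cmod (slope a b t s - slope a b (p * t) s) + cmod (slope a b t s - ?w)
        + cmod (slope a b (p * t) s - ?w')"
      by norm
    also have "cmod (slope a b t s - ?w) \<le> C * (t / s)" unfolding C_def by (rule slope_far[OF t ts])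
    also have "cmod (slope a b (p * t) s - ?w') \<le> C * (p * t / s)" unfolding C_def by (rule slope_far[OF pt ps])
    finally have "k \<le> cmod (slope a b t s - slope a b (p * t) s) + C * (1 + p) * (t / s)"
      using s0 by (simp add: field_simps)
    moreover have "C * (1 + p) * (t / s) \<le> k / 2"
    proof -
      have "K * t \<le> K * (p * t)" using t p by (intro mult_left_mono) auto
      then have Kt: "K * t \<le> s" using True by (simp add: mult_ac)
      have "C * (1 + p) * t \<le> K * (k / 2) * t" using KC(1) t by (intro mult_right_mono) auto
      also have "\<dots> = k / 2 * (K * t)" by simp
      also have "\<dots> \<le> k / 2 * s" using Kt k by (intro mult_left_mono) auto
      finally show ?thesis using s0 by (simp add: field_simps)
    qed
    ultimately show ?thesis by linarith
  next
    case False
    define u where "u = q * t"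
    have u: "u = K * (K * p * t)" by (simp add: u_def q_def power2_eq_square)
    have u0: "0 < u" using t p K1 by (simp add: u)
    have su: "K * s \<le> u" unfolding u using False K1 by (intro mult_left_mono) auto
    have uu: "1 * u \<le> p' * u" using p' u0 by (intro mult_right_mono) auto
    let ?w = "cis ((b - a) * ln u)" and ?w' = "cis ((b - a) * ln (p' * u))"
    have "k' = cmod (?w * (1 - cis ((b - a) * ln p')))" by (simp add: k'_def norm_mult)
    also have "?w * (1 - cis ((b - a) * ln p')) = ?w - ?w'"
      using u0 p' by (simp add: ln_mult cis_mult algebra_simps)
    also have "cmod (?w - ?w') \<le> cmod (slope a b u s - slope a b (p' * u) s) + cmod (slope a b u s - ?w)
        + cmod (slope a b (p' * u) s - ?w')"
      by norm
    also have "cmod (slope a b u s - ?w) \<le> (2 + \<bar>b\<bar>) * (s / u)" by (rule slope_near[OF s u0])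
    also have "cmod (slope a b (p' * u) s - ?w') \<le> (2 + \<bar>b\<bar>) * (s / (p' * u))"
      using p' u0 by (intro slope_near s) auto
    also have "(2 + \<bar>b\<bar>) * (s / (p' * u)) \<le> (2 + \<bar>b\<bar>) * (s / u)"
      using uu u0 s by (intro mult_left_mono divide_left_mono) auto
    finally have "k' \<le> cmod (slope a b u s - slope a b (p' * u) s) + 2 * (2 + \<bar>b\<bar>) * (s / u)"
      by (simp add: algebra_simps)
    moreover have "2 * (2 + \<bar>b\<bar>) * (s / u) \<le> k' / 2"
    proof -
      have "2 * (2 + \<bar>b\<bar>) * s \<le> K * (k' / 2) * s" using KC(2) s by (intro mult_right_mono) auto
      also have "\<dots> = k' / 2 * (K * s)" by simp
      also have "\<dots> \<le> k' / 2 * u" using su k by (intro mult_left_mono) auto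
      finally show ?thesis using u0 by (simp add: field_simps)
    qed
    ultimately have "min k k' / 2 \<le> cmod (slope a b u s - slope a b (p' * u) s)"
      using min.cobounded2[of k k'] by linarith
    then show ?thesis by (simp add: u_def mult.assoc)
  qed
  then show ?thesis
    using k p p' K1
    by (intro exI[of _ "min k k' / 2"] exI[of _ p] exI[of _ q] exI[of _ "p' * q"]) (simp add: q_def)
qed

section \<open>Non-isomorphism\<close>

definition unit :: "nat \<Rightarrow> cseq" where
  "unit n = (\<lambda>k. if k = n then 1 else 0)"

text \<open>Every nonzero coordinate has modulus \<open>1\<close> and the norm is
  \<open>sqrt (card A)\<close>, so all logarithms equal \<open>ln (card A) / 2\<close> and the
  Kalton--Peck map acts as one scalar.\<close>

lemma unimodular_sum:
  assumes "finite A" "\<forall>n\<in>A. cmod (\<theta> n) = 1"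
  defines "x \<equiv> \<Sum>n\<in>A. seq_scale (\<theta> n) (unit n)"
  shows "x \<in> l2_set" "l2_norm x = sqrt (card A)"
    "KP_map a x = seq_scale (phi a (ln (card A) / 2)) x"
proof -
  have x: "x k = (if k \<in> A then \<theta> k else 0)" for k
    using assms(1) by (simp add: x_def sum_fun_apply seq_scale_def unit_def if_distrib cong: if_cong)
  have z: "(cmod (x k))\<^sup>2 = (if k \<in> A then 1 else 0)" for k using assms(2) by (simp add: x)
  have "summable (\<lambda>k. (cmod (x k))\<^sup>2)"
    unfolding z by (rule summable_finite[OF assms(1)]) simp
  then show xl: "x \<in> l2_set" by (simp add: l2_set_def)
  have "(\<Sum>k. (cmod (x k))\<^sup>2) = (\<Sum>k\<in>A. (cmod (x k))\<^sup>2)"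
    by (rule suminf_finite[OF assms(1)]) (simp add: x)
  then show nx: "l2_norm x = sqrt (card A)" by (simp add: l2_norm_def z)
  show "KP_map a x = seq_scale (phi a (ln (card A) / 2)) x"
  proof
    fix k
    have "0 < card A" if "k \<in> A" using that assms(1) by (auto simp: card_gt_0_iff)
    then show "KP_map a x k = seq_scale (phi a (ln (card A) / 2)) x k"
      using assms(2) by (simp add: KP_map_eq[OF xl] nx Om_def x seq_scale_def ln_sqrt)
  qed
qed

text \<open>The first sums stay in the fibre; the second pay a logarithm for the Kalton--Peck map;
  in the third the multiples of \<open>(unit n, 0)\<close> put the sum on the graph of that map, so
  the logarithm disappears.\<close>

lemma unit_sum_sections:
  assumes "finite A" "\<forall>n\<in>A. cmod (\<theta> n) = 1"
  shows "qnorm (Z2 a) (\<Sum>n\<in>A. qscale (Z2 a) (\<theta> n) (unit n, 0)) = sqrt (card A)"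
    "qnorm (Z2 a) (\<Sum>n\<in>A. qscale (Z2 a) (\<theta> n) (0, unit n)) = sqrt (card A) * (1 + ln (card A) / 2)"
    "qnorm (Z2 a) (\<Sum>n\<in>A. qscale (Z2 a) (phi a (ln (card A) / 2)) (unit n, 0) + (0, unit n)) = sqrt (card A)"
proof -
  let ?x = "\<Sum>n\<in>A. seq_scale (\<theta> n) (unit n)"
  note x = unimodular_sum[OF assms]
  have s0: "seq_scale c 0 = 0" for c by (simp add: seq_scale_def fun_eq_iff)
  have "(\<Sum>n\<in>A. qscale (Z2 a) (\<theta> n) (unit n, 0)) = (?x, 0)"
    by (simp add: prod_eq_iff fst_sum snd_sum s0)
  then show "qnorm (Z2 a) (\<Sum>n\<in>A. qscale (Z2 a) (\<theta> n) (unit n, 0)) = sqrt (card A)"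
    using x by (simp add: qnorm_Z2)
  have l: "0 \<le> ln (real (card A))" by (cases "card A") auto
  have "(\<Sum>n\<in>A. qscale (Z2 a) (\<theta> n) (0, unit n)) = (0, ?x)"
    by (simp add: prod_eq_iff fst_sum snd_sum s0)
  moreover have "0 - KP_map a ?x = seq_scale (- phi a (ln (card A) / 2)) ?x"
  proof -
    have "0 - seq_scale c u = seq_scale (- c) u" for c u by (simp add: seq_scale_def fun_eq_iff)
    then show ?thesis unfolding x(3) .
  qed
  ultimately show "qnorm (Z2 a) (\<Sum>n\<in>A. qscale (Z2 a) (\<theta> n) (0, unit n)) = sqrt (card A) * (1 + ln (card A) / 2)"
    using x l by (simp add: qnorm_Z2 l2_scale norm_phi algebra_simps)
  let ?y = "\<Sum>n\<in>A. seq_scale 1 (unit n)"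
  have y: "?y \<in> l2_set" "l2_norm ?y = sqrt (card A)" "KP_map a ?y = seq_scale (phi a (ln (card A) / 2)) ?y"
    using unimodular_sum[OF assms(1), of "\<lambda>_. 1"] by auto
  have "(\<Sum>n\<in>A. qscale (Z2 a) (phi a (ln (card A) / 2)) (unit n, 0) + (0, unit n)) = (KP_map a ?y, ?y)"
    unfolding y(3) by (simp add: prod_eq_iff fst_sum snd_sum s0 fun_eq_iff sum_fun_apply seq_scale_def sum_distrib_left)
  then show "qnorm (Z2 a) (\<Sum>n\<in>A. qscale (Z2 a) (phi a (ln (card A) / 2)) (unit n, 0) + (0, unit n)) = sqrt (card A)"
    using y(2) by (simp add: qnorm_Z2)
qed

lemma unit_sections:
  "(unit n, 0) \<in> qspace (Z2 a)" "(0, unit n) \<in> qspace (Z2 a)"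
  "qnorm (Z2 a) (unit n, 0) = 1" "qnorm (Z2 a) (0, unit n) = 1"
proof -
  have "seq_scale 1 (unit n) = unit n" by (simp add: seq_scale_def)
  then have "unit n \<in> l2_set" "l2_norm (unit n) = 1" "KP_map a (unit n) = 0"
    using unimodular_sum[of "{n}" "\<lambda>_. 1"] by (simp_all add: seq_scale_def fun_eq_iff)
  then show "(unit n, 0) \<in> qspace (Z2 a)" "(0, unit n) \<in> qspace (Z2 a)"
    "qnorm (Z2 a) (unit n, 0) = 1" "qnorm (Z2 a) (0, unit n) = 1"
    by (simp_all add: qspace_Z2 qnorm_Z2)
qed

lemma linear_map_sum:
  assumes X: "quasi_normed_space X" and Y: "quasi_normed_space Y" and T: "linear_map X Y T" and v: "\<And>n. n \<in> A \<Longrightarrow> v n \<in> qspace X"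
  shows "T (\<Sum>n\<in>A. v n) = (\<Sum>n\<in>A. T (v n))"
  using v
proof (induction A rule: infinite_finite_induct)
  case (insert x F)
  have "v x \<in> qspace X" using insert.prems by simp
  moreover have "(\<Sum>n\<in>F. v n) \<in> qspace X" by (intro qspace_sum X insert.prems) simp
  ultimately show ?case using insert T by (auto simp: linear_map_def)
qed (use linear_map_0[OF X T] in auto)

lemma norm_coordinate_le:
  assumes "u \<in> qspace (Z2 a)"
  shows "cmod (snd u k) \<le> qnorm (Z2 a) u" "cmod (fst u k) \<le> qnorm (Z2 a) u"
proof -
  let ?d = "fst u - KP_map a (snd u)"
  have m: "snd u \<in> l2_set" "?d \<in> l2_set" using assms by (auto simp: qspace_Z2)
  show "cmod (snd u k) \<le> qnorm (Z2 a) u"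
    using cmod_le_l2_norm[OF m(1), of k] l2_norm_nonneg[OF m(2)] by (simp add: qnorm_Z2)
  have "fst u k = ?d k + KP_map a (snd u) k" by simp
  then have "cmod (fst u k) \<le> cmod (?d k) + cmod (KP_map a (snd u) k)" by (metis norm_triangle_ineq)
  then show "cmod (fst u k) \<le> qnorm (Z2 a) u"
    using cmod_le_l2_norm[OF m(2), of k] norm_KP_map_le(1)[OF m(1), of a k] unfolding qnorm_Z2 by linarith
qed

text \<open>If infinitely many values had modulus at least \<open>e\<close>, suitable unimodular
  phases would add \<open>N\<close> of them up to at least \<open>N * e\<close>, while the growth
  assumption allows only \<open>M * sqrt N * (1 + ln N / 2)\<close>.\<close>

lemma coordinates_null:
  assumes S: "linear_map (Z2 a) (Z2 b) S"
    and M: "0 \<le> M" "\<And>u. u \<in> qspace (Z2 a) \<Longrightarrow> qnorm (Z2 b) (S u) \<le> M * qnorm (Z2 a) u"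
    and v: "\<And>n. v n \<in> qspace (Z2 a)"
      "\<And>A \<theta>. finite A \<Longrightarrow> \<forall>n\<in>A. cmod (\<theta> n) = 1 \<Longrightarrow>
        qnorm (Z2 a) (\<Sum>n\<in>A. qscale (Z2 a) (\<theta> n) (v n)) \<le> sqrt (card A) * (1 + ln (card A) / 2)"
    and f: "\<And>u v. f (u + v) = f u + f v" "\<And>c v. f (qscale (Z2 b) c v) = c * f v"
      "\<And>u. u \<in> qspace (Z2 b) \<Longrightarrow> cmod (f u) \<le> qnorm (Z2 b) u"
  shows "(\<lambda>n. f (S (v n))) \<longlonglongrightarrow> 0"
proof (rule ccontr)
  note Za = quasi_normed_spaceD[OF quasi_normed_space_Z2[of a]]
  assume "\<not> ?thesis"
  then obtain e where e: "0 < e" "\<not> (\<forall>\<^sub>F n in sequentially. cmod (f (S (v n))) < e)"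
    unfolding tendsto_iff by (auto simp: dist_norm)
  then have inf: "infinite {n. \<not> cmod (f (S (v n))) < e}"
    by (simp add: eventually_cofinite[symmetric] flip: cofinite_eq_sequentially)
  obtain m :: nat where m: "3 * M / e < m" using reals_Archimedean2 by blast
  moreover have "0 \<le> 3 * M / e" using M e by simp
  ultimately have m0: "0 < real m" by linarith
  then have m1: "1 \<le> real m" by simp
  \<comment> \<open>The fourth power clears the root and the logarithm: \<open>sqrt (card A)\<close>
    is the square of \<open>m\<close> and \<open>ln (card A) / 2\<close> is \<open>2 * ln m\<close>,
    so a quartic in \<open>m\<close> meets the cubic bound \<open>3 * M * m ^ 3\<close>.\<close>
  obtain A where A: "A \<subseteq> {n. \<not> cmod (f (S (v n))) < e}" "finite A" "card A = m ^ 4"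
    using infinite_arbitrarily_large[OF inf] by blast
  define \<theta> where "\<theta> n = cnj (f (S (v n))) / cmod (f (S (v n)))" for n
  have fe: "e \<le> cmod (f (S (v n)))" if "n \<in> A" for n using A(1) that by auto
  have \<theta>: "cmod (\<theta> n) = 1" "\<theta> n * f (S (v n)) = cmod (f (S (v n)))" if "n \<in> A" for n
  proof -
    have z: "cmod (f (S (v n))) \<noteq> 0" using fe[OF that] e by auto
    then show "cmod (\<theta> n) = 1" by (simp add: \<theta>_def norm_divide)
    have "cnj (f (S (v n))) * f (S (v n)) = complex_of_real (cmod (f (S (v n)))) * cmod (f (S (v n)))"
      using complex_norm_square[of "f (S (v n))"] by (simp add: power2_eq_square mult.commute)
    then show "\<theta> n * f (S (v n)) = cmod (f (S (v n)))" using z by (simp add: \<theta>_def)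
  qed
  let ?u = "\<Sum>n\<in>A. qscale (Z2 a) (\<theta> n) (v n)"
  have mv: "qscale (Z2 a) (\<theta> n) (v n) \<in> qspace (Z2 a)" for n by (intro Za v)
  have mu: "?u \<in> qspace (Z2 a)" by (intro qspace_sum quasi_normed_space_Z2 mv)
  have f0: "f 0 = 0" using f(1)[of 0 0] by simp
  have fs: "f (\<Sum>n\<in>B. g n) = (\<Sum>n\<in>B. f (g n))" for B and g :: "nat \<Rightarrow> cseq \<times> cseq"
    by (induction B rule: infinite_finite_induct) (auto simp: f f0)
  have Sv: "S (qscale (Z2 a) c (v n)) = qscale (Z2 b) c (S (v n))" for c n
    using S v(1) unfolding linear_map_def by blast
  have "f (S ?u) = (\<Sum>n\<in>A. \<theta> n * f (S (v n)))"
    unfolding linear_map_sum[OF quasi_normed_space_Z2 quasi_normed_space_Z2 S mv] fs Sv f(2) ..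
  also have "\<dots> = (\<Sum>n\<in>A. complex_of_real (cmod (f (S (v n)))))" by (intro sum.cong refl \<theta>)
  also have "\<dots> = complex_of_real (\<Sum>n\<in>A. cmod (f (S (v n))))" by simp
  finally have "cmod (f (S ?u)) = \<bar>\<Sum>n\<in>A. cmod (f (S (v n)))\<bar>" by (simp only: norm_of_real)
  also have "\<dots> = (\<Sum>n\<in>A. cmod (f (S (v n))))" by (simp add: sum_nonneg)
  finally have "cmod (f (S ?u)) = (\<Sum>n\<in>A. cmod (f (S (v n))))" .
  moreover have "real (card A) * e \<le> (\<Sum>n\<in>A. cmod (f (S (v n))))" using fe by (intro sum_bounded_below)
  ultimately have "real (card A) * e \<le> cmod (f (S ?u))" by simp
  also have "\<dots> \<le> qnorm (Z2 b) (S ?u)"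
  proof (rule f(3))
    show "S ?u \<in> qspace (Z2 b)" using S mu unfolding linear_map_def by blast
  qed
  also have "\<dots> \<le> M * qnorm (Z2 a) ?u" by (rule M(2)[OF mu])
  also have "\<dots> \<le> M * (sqrt (card A) * (1 + ln (card A) / 2))" by (intro mult_left_mono v A(2) ballI \<theta>(1) M(1))
  also have "sqrt (card A) = (real m)\<^sup>2"
    unfolding A(3) by (rule real_sqrt_unique) (simp_all add: power_mult[symmetric])
  also have "ln (card A) / 2 = 2 * ln m" using m0 by (simp add: A(3) ln_realpow)
  also have "M * ((real m)\<^sup>2 * (1 + 2 * ln m)) \<le> M * ((real m)\<^sup>2 * (3 * m))"
    using M(1) ln_le_minus_one[OF m0] m1 by (intro mult_left_mono) auto
  finally have "(real m) ^ 4 * e \<le> 3 * M * real m ^ 3" by (simp add: A(3) power2_eq_square power3_eq_cube)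
  then have "(real m) ^ 3 * (real m * e) \<le> (real m) ^ 3 * (3 * M)" by (simp add: power3_eq_cube power4_eq_xxxx mult_ac)
  then have "real m * e \<le> 3 * M" using m0 by simp
  then show False using m e by (simp add: field_simps)
qed

text \<open>
  The case \<open>a = 0\<close> is excluded because for \<open>s \<gg> t\<close> the quotient \<open>slope 0 b t s\<close> does not oscillate in \<open>t\<close>;
  the theorem then uses the inverse isomorphism.
\<close>

lemma no_embedding:
  assumes S: "linear_map (Z2 a) (Z2 b) S"
    and M: "0 \<le> M" "\<And>u. u \<in> qspace (Z2 a) \<Longrightarrow> qnorm (Z2 b) (S u) \<le> M * qnorm (Z2 a) u"
      "\<And>u. u \<in> qspace (Z2 a) \<Longrightarrow> qnorm (Z2 a) u \<le> M * qnorm (Z2 b) (S u)"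
    and ab: "a \<noteq> 0" "a \<noteq> b"
  shows False
proof -
  note Za = quasi_normed_spaceD[OF quasi_normed_space_Z2[of a]]
  note Ssum = linear_map_sum[OF quasi_normed_space_Z2 quasi_normed_space_Z2 S]
  have Sscale: "S (qscale (Z2 a) c u) = qscale (Z2 b) c (S u)" if "u \<in> qspace (Z2 a)" for c u
    using S that unfolding linear_map_def by blast
  have Sadd: "S (u + v) = S u + S v" if "u \<in> qspace (Z2 a)" "v \<in> qspace (Z2 a)" for u v
    using S that unfolding linear_map_def by blast
  have one: "qscale (Z2 a) 1 u = u" for u by (simp add: seq_scale_def prod_eq_iff)
  define Y where "Y n = S (unit n, 0)" for n
  define U where "U n = S (0, unit n)" for n
  have null: "bounded_null b M (\<lambda>n. S (v n))"
    if v: "\<And>n. v n \<in> qspace (Z2 a)" "\<And>n. qnorm (Z2 a) (v n) = 1" and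
      s: "\<And>A \<theta>. finite A \<Longrightarrow> \<forall>n\<in>A. cmod (\<theta> n) = 1 \<Longrightarrow>
        qnorm (Z2 a) (\<Sum>n\<in>A. qscale (Z2 a) (\<theta> n) (v n)) \<le> sqrt (card A) * (1 + ln (card A) / 2)" for v
    unfolding bounded_null_def
  proof (intro conjI allI)
    show "S (v n) \<in> qspace (Z2 b)" for n using S v(1) unfolding linear_map_def by blast
    show "qnorm (Z2 b) (S (v n)) \<le> M" for n using M(2)[OF v(1)] v(2) by simp
    show "(\<lambda>n. fst (S (v n)) k) \<longlonglongrightarrow> 0" for k
      by (rule coordinates_null[OF S M(1,2) v(1) s, where f = "\<lambda>u. fst u k"])
         (auto simp: seq_scale_def norm_coordinate_le)
    show "(\<lambda>n. snd (S (v n)) k) \<longlonglongrightarrow> 0" for k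
      by (rule coordinates_null[OF S M(1,2) v(1) s, where f = "\<lambda>u. snd u k"])
         (auto simp: seq_scale_def norm_coordinate_le)
  qed
  have lnc: "0 \<le> ln (real n)" for n :: nat by (cases n) auto
  have bY: "bounded_null b M Y" unfolding Y_def
  proof (rule null)
    fix A and \<theta> :: "nat \<Rightarrow> complex" assume A: "finite A" "\<forall>n\<in>A. cmod (\<theta> n) = 1"
    show "qnorm (Z2 a) (\<Sum>n\<in>A. qscale (Z2 a) (\<theta> n) (unit n, 0)) \<le> sqrt (card A) * (1 + ln (card A) / 2)"
      unfolding unit_sum_sections(1)[OF A] using lnc by (simp add: distrib_left)
  qed (simp_all add: unit_sections)
  have bU: "bounded_null b M U" unfolding U_def
  proof (rule null)
    fix A and \<theta> :: "nat \<Rightarrow> complex" assume A: "finite A" "\<forall>n\<in>A. cmod (\<theta> n) = 1"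
    show "qnorm (Z2 a) (\<Sum>n\<in>A. qscale (Z2 a) (\<theta> n) (0, unit n)) \<le> sqrt (card A) * (1 + ln (card A) / 2)"
      unfolding unit_sum_sections(2)[OF A] by simp
  qed (simp_all add: unit_sections)
  \<comment> \<open>Otherwise \<open>sum_sections_unbounded\<close> would break the bound
    \<open>M * sqrt (card A)\<close> inherited from the sums of \<open>(unit n, 0)\<close>.\<close>
  have Y0: "\<forall>\<^sub>F n in sequentially. l2_norm (snd (Y n)) < c" if c: "0 < c" for c
  proof (rule ccontr)
    assume "\<not> ?thesis"
    then have "\<exists>\<^sub>F n in sequentially. c \<le> l2_norm (snd (Y n))"
      by (simp add: frequently_def not_le)
    then obtain A where A: "finite A" "M * sqrt (card A) < qnorm (Z2 b) (\<Sum>n\<in>A. Y n)"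
      using sum_sections_unbounded[OF bY c] by blast
    let ?u = "\<Sum>n\<in>A. (unit n, 0 :: cseq)"
    have mu: "?u \<in> qspace (Z2 a)" by (intro qspace_sum quasi_normed_space_Z2 unit_sections)
    have "(\<Sum>n\<in>A. Y n) = S ?u" unfolding Y_def by (rule Ssum[symmetric]) (rule unit_sections)
    moreover have "qnorm (Z2 a) ?u = sqrt (card A)"
      using unit_sum_sections(1)[OF A(1), of "\<lambda>_. 1" a] unfolding one by simp
    ultimately show False using M(2)[OF mu] A(2) by simp
  qed
  \<comment> \<open>Otherwise a subsequence of \<open>U\<close> would have sums of order
    \<open>sqrt N\<close>, whereas the lower estimate for \<open>S\<close> passes on the logarithm
    in the norm of sums of \<open>(0, unit n)\<close>.\<close>
  have "\<exists>c>0. \<forall>\<^sub>F n in sequentially. c \<le> l2_norm (snd (U n))"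
  proof (rule ccontr)
    assume n: "\<not> ?thesis"
    have "\<exists>\<^sub>F n in sequentially. l2_norm (snd (U n)) < c" if "0 < c" for c
      using n that by (force simp: frequently_def not_less)
    then have "\<forall>\<epsilon>>0. \<exists>\<^sub>F n in sequentially. l2_norm (snd (U n)) < \<epsilon>" by blast
    from bounded_null_subsequence_sums[OF bU this] obtain r :: "nat \<Rightarrow> nat" and C where r: "strict_mono r"
      and C: "\<forall>A. finite A \<longrightarrow> qnorm (Z2 b) (\<Sum>n\<in>A. U (r n)) \<le> C * sqrt (card A)"
      by (elim exE conjE)
    have le: "ln N / 2 \<le> M * C" if N: "0 < N" for N :: nat
    proof -
      have inj: "inj_on r {..<N}" using r by (meson inj_on_subset strict_mono_imp_inj_on subset_UNIV)
      let ?A = "r ` {..<N}"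
      let ?u = "\<Sum>n\<in>?A. (0 :: cseq, unit n)"
      have c: "finite ?A" "card ?A = N" using card_image[OF inj] by simp_all
      have mu: "?u \<in> qspace (Z2 a)" by (intro qspace_sum quasi_normed_space_Z2 unit_sections)
      have Su: "S ?u = (\<Sum>n<N. U (r n))"
        unfolding Ssum[OF unit_sections(2)] U_def by (rule sum.reindex_cong[OF inj refl refl])
      have "sqrt N * (1 + ln N / 2) = qnorm (Z2 a) ?u"
        using unit_sum_sections(2)[OF c(1), of "\<lambda>_. 1" a] unfolding one c(2) by simp
      also have "\<dots> \<le> M * qnorm (Z2 b) (S ?u)" by (rule M(3)[OF mu])
      also have "\<dots> \<le> M * (C * sqrt N)" unfolding Su
        using C[rule_format, of "{..<N}"] M(1) by (intro mult_left_mono) auto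
      finally have "sqrt N * (1 + ln N / 2) \<le> sqrt N * (M * C)" by (simp add: mult_ac)
      then have "1 + ln N / 2 \<le> M * C" using N by (simp add: mult_le_cancel_left_pos)
      then show ?thesis by simp
    qed
    define N where "N = nat \<lceil>exp (2 * (M * C) + 1)\<rceil>"
    have N: "exp (2 * (M * C) + 1) \<le> N" by (simp add: N_def of_nat_ceiling)
    then have N0: "0 < real N" by (rule less_le_trans[OF exp_gt_zero])
    then have "2 * (M * C) + 1 \<le> ln N" using N by (simp add: ln_ge_iff)
    then show False using le[of N] N0 by simp
  qed
  then obtain c where c: "0 < c" "\<forall>\<^sub>F n in sequentially. c \<le> l2_norm (snd (U n))" by (elim exE conjE)
  have freq: "\<forall>\<epsilon>>0. \<exists>\<^sub>F n in sequentially. c \<le> l2_norm (snd (U n)) \<and> l2_norm (snd (Y n)) < \<epsilon>"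
    using c(2) Y0 by (intro allI impI eventually_frequently[OF sequentially_bot] eventually_conj) auto
  \<comment> \<open>The scalar of the third claim of \<open>unit_sum_sections\<close>, for which the
    logarithm cancels. Since \<open>ln 0 = 0\<close>, it is \<open>0\<close> at
    \<open>N = 0\<close>.\<close>
  define \<psi> where "\<psi> N = phi a (ln N / 2)" for N :: nat
  have \<psi>: "cmod (\<psi> N) \<le> sqrt N" for N :: nat
  proof (cases "N = 0")
    case False
    then have "ln (sqrt N) \<le> sqrt N - 1" by (intro ln_le_minus_one) simp
    then show ?thesis using False lnc by (simp add: \<psi>_def norm_phi ln_sqrt)
  qed (simp add: \<psi>_def)
  have sums: "\<forall>A. finite A \<longrightarrow>
    qnorm (Z2 b) (\<Sum>n\<in>A. qscale (Z2 b) (\<psi> (card A)) (Y n) + U n) \<le> M * sqrt (card A)"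
  proof (intro allI impI)
    fix A :: "nat set" assume A: "finite A"
    let ?g = "\<lambda>n. qscale (Z2 a) (\<psi> (card A)) (unit n, 0) + (0, unit n)"
    have mg: "?g n \<in> qspace (Z2 a)" for n by (intro Za unit_sections)
    have "S (?g n) = qscale (Z2 b) (\<psi> (card A)) (Y n) + U n" for n
      unfolding Y_def U_def using Sadd[OF Za(4)[OF unit_sections(1)] unit_sections(2)] Sscale[OF unit_sections(1)] by metis
    then have "(\<Sum>n\<in>A. qscale (Z2 b) (\<psi> (card A)) (Y n) + U n) = S (\<Sum>n\<in>A. ?g n)"
      by (simp only: Ssum[OF mg])
    also have "qnorm (Z2 b) \<dots> \<le> M * qnorm (Z2 a) (\<Sum>n\<in>A. ?g n)"
      by (intro M(2) qspace_sum quasi_normed_space_Z2 mg)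
    also have "qnorm (Z2 a) (\<Sum>n\<in>A. ?g n) = sqrt (card A)"
      unfolding \<psi>_def using unit_sum_sections(3)[OF A, of "\<lambda>_. 1" a] by simp
    finally show "qnorm (Z2 b) (\<Sum>n\<in>A. qscale (Z2 b) (\<psi> (card A)) (Y n) + U n) \<le> M * sqrt (card A)" .
  qed
  from block_sum_estimate[OF bU bY c(1) freq \<psi> sums]
  obtain C where C: "\<forall>F. finite F \<and> 0 \<notin> F \<longrightarrow> (\<exists>x\<in>l2_set. \<exists>y\<in>l2_set. c / 2 \<le> l2_norm x \<and>
    (\<forall>N\<in>F. let v = seq_scale (\<psi> N) y + (\<lambda>k. x k * (phi b (ln (l2_norm x / cmod (x k))) -
        phi b (ln (l2_norm x / cmod (x k)) + ln N / 2)))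
      in v \<in> l2_set \<and> l2_norm v \<le> C))" by (elim exE)
  obtain \<kappa> and p q q' :: nat where \<kappa>: "0 < \<kappa>" "1 \<le> p" "1 \<le> q" "1 \<le> q'"
    and osc: "\<forall>(t::real) s. 0 < t \<longrightarrow> 0 \<le> s \<longrightarrow> \<kappa> \<le> cmod (slope a b t s - slope a b (p * t) s) \<or>
      \<kappa> \<le> cmod (slope a b (q * t) s - slope a b (q' * t) s)"
    using slope_oscillates[OF ab] by (elim exE conjE)
  \<comment> \<open>Chosen so that \<open>t = m * ln 2\<close> makes the final bound
    \<open>4 * \<bar>C\<bar> / (\<kappa> * t)\<close> smaller than \<open>c / 2\<close>.\<close>
  obtain m :: nat where m: "max 1 (4 * \<bar>C\<bar> / (\<kappa> * (ln 2 * (c / 2)))) < m" using reals_Archimedean2 by blast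
  define t where "t = real m * ln 2"
  have t: "0 < t" using m by (simp add: t_def)
  \<comment> \<open>The powers of \<open>4\<close> make \<open>ln N / 2\<close> the multiples \<open>t, p t, q t, q' t\<close>.\<close>
  define F :: "nat set" where "F = (\<lambda>j. 4 ^ (j * m)) ` {1, p, q, q'}"
  have F: "finite F \<and> 0 \<notin> F" by (auto simp: F_def)
  from C[rule_format, OF F] obtain x y where x: "x \<in> l2_set" "y \<in> l2_set" "c / 2 \<le> l2_norm x"
    and v: "\<forall>N\<in>F. let v = seq_scale (\<psi> N) y + (\<lambda>k. x k * (phi b (ln (l2_norm x / cmod (x k))) -
        phi b (ln (l2_norm x / cmod (x k)) + ln N / 2)))
      in v \<in> l2_set \<and> l2_norm v \<le> C" by (elim bexE conjE)
  define s where "s k = ln (l2_norm x / cmod (x k))" for k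
  \<comment> \<open>Dividing the estimate for \<open>j * t\<close> by \<open>phi a (j * t)\<close>,
    of modulus at least \<open>t\<close>, puts the same \<open>y\<close> within
    \<open>\<bar>C\<bar> / t\<close> of \<open>x\<close> times the slope, for each of the four
    values of \<open>j\<close>.\<close>
  define w where "w j k = y k - x k * slope a b (j * t) (s k)" for j k
  have w: "w (real j) \<in> l2_set" "l2_norm (w (real j)) \<le> \<bar>C\<bar> / t" if j: "j \<in> {1, p, q, q'}" for j
  proof -
    have j1: "1 \<le> real j" using j \<kappa> by auto
    have jt: "t \<le> j * t" using j1 t mult_right_mono[of 1 "real j" t] by simp
    have l: "ln (real (4 ^ (j * m))) / 2 = j * t"
    proof -
      have "ln (4::real) = 2 * ln 2" using ln_realpow[of 2 2] by simp
      then show ?thesis by (simp add: ln_realpow t_def)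
    qed
    let ?v = "seq_scale (phi a (j * t)) y + (\<lambda>k. x k * (phi b (s k) - phi b (s k + j * t)))"
    have v: "?v \<in> l2_set" "l2_norm ?v \<le> C"
      using v[rule_format, of "4 ^ (j * m)"] j unfolding \<psi>_def l s_def[symmetric] F_def by (auto simp: Let_def)
    have n: "phi a (j * t) \<noteq> 0" using jt t by (simp add: phi_def)
    have e: "w (real j) = seq_scale (1 / phi a (j * t)) ?v"
      using n by (simp add: w_def slope_def seq_scale_def fun_eq_iff field_simps)
    show "w (real j) \<in> l2_set" unfolding e by (rule l2_scale(1)[OF v(1)])
    have "l2_norm (w (real j)) = l2_norm ?v / (j * t)"
      unfolding e l2_scale(2)[OF v(1)] using jt t by (simp add: norm_divide norm_phi)
    also have "\<dots> \<le> \<bar>C\<bar> / t" using v l2_norm_nonneg[OF v(1)] jt t by (intro frac_le) auto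
    finally show "l2_norm (w (real j)) \<le> \<bar>C\<bar> / t" .
  qed
  have w1: "w 1 \<in> l2_set" "l2_norm (w 1) \<le> \<bar>C\<bar> / t" using w[of 1] by auto
  \<comment> \<open>In these two differences \<open>y\<close> cancels, leaving \<open>x\<close>
    times differences of slopes; by \<open>osc\<close> at least one of them dominates
    \<open>\<kappa>\<close> times \<open>x\<close> in each coordinate.\<close>
  define g where "g = w 1 - w (real p)"
  define h where "h = w (real q) - w (real q')"
  have g: "g \<in> l2_set" "l2_norm g \<le> 2 * (\<bar>C\<bar> / t)"
    using l2_diff[OF w1(1) w(1)[of p]] w1(2) w(2)[of p] by (auto simp: g_def)
  have h: "h \<in> l2_set" "l2_norm h \<le> 2 * (\<bar>C\<bar> / t)"
    using l2_diff[OF w(1)[of q] w(1)[of q']] w(2)[of q] w(2)[of q'] by (auto simp: h_def)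
  have "cmod (x k) \<le> 1 / \<kappa> * (cmod (g k) + cmod (h k))" for k
  proof (cases "x k = 0")
    case False
    have s0: "0 \<le> s k" using False cmod_le_l2_norm[OF x(1), of k] by (simp add: s_def)
    have "g k = x k * (slope a b (p * t) (s k) - slope a b t (s k))"
      "h k = x k * (slope a b (q' * t) (s k) - slope a b (q * t) (s k))"
      by (simp_all add: g_def h_def w_def algebra_simps)
    then have n: "cmod (g k) = cmod (x k) * cmod (slope a b t (s k) - slope a b (p * t) (s k))"
      "cmod (h k) = cmod (x k) * cmod (slope a b (q * t) (s k) - slope a b (q' * t) (s k))"
      by (simp_all add: norm_mult norm_minus_commute)
    have "cmod (x k) * \<kappa> \<le> cmod (g k) \<or> cmod (x k) * \<kappa> \<le> cmod (h k)"
      using osc[rule_format, OF t s0] unfolding n by (auto intro: mult_left_mono)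
    then have "cmod (x k) * \<kappa> \<le> cmod (g k) + cmod (h k)"
      using norm_ge_zero[of "g k"] norm_ge_zero[of "h k"] by linarith
    then show ?thesis using \<kappa>(1) by (simp add: field_simps)
  qed (use \<kappa> in simp)
  then have "l2_norm x \<le> 1 / \<kappa> * (l2_norm g + l2_norm h)"
    using \<kappa>(1) by (intro l2_dominated2(2) g h) auto
  also have "\<dots> \<le> 1 / \<kappa> * (4 * (\<bar>C\<bar> / t))" using g h \<kappa>(1) by (intro mult_left_mono) auto
  finally have "l2_norm x \<le> 1 / \<kappa> * (4 * (\<bar>C\<bar> / t))" .
  with x(3) have "c / 2 \<le> 1 / \<kappa> * (4 * (\<bar>C\<bar> / t))" by (rule order_trans)
  then have "c / 2 * \<kappa> * t \<le> 4 * \<bar>C\<bar>" using \<kappa>(1) t by (simp add: field_simps)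
  moreover have "4 * \<bar>C\<bar> / (\<kappa> * (ln 2 * (c / 2))) < m" using m by simp
  then have "4 * \<bar>C\<bar> < m * (\<kappa> * (ln 2 * (c / 2)))"
    using \<kappa>(1) c(1) by (subst (asm) pos_divide_less_eq) auto
  then have "4 * \<bar>C\<bar> < c / 2 * \<kappa> * t" by (simp add: t_def mult_ac)
  ultimately show False by linarith
qed

lemma linear_map_inv:
  assumes X: "quasi_normed_space X" and T: "linear_map X Y T" and bij: "bij_betw T (qspace X) (qspace Y)"
  shows "linear_map Y X (inv_into (qspace X) T)"
proof -
  let ?S = "inv_into (qspace X) T"
  have S: "?S y \<in> qspace X" "T (?S y) = y" if "y \<in> qspace Y" for y
    using that bij by (metis bij_betw_def inv_into_into, metis bij_betw_inv_into_right)
  have inv: "?S (T x) = x" if "x \<in> qspace X" for x using bij that by (rule bij_betw_inv_into_left)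
  show ?thesis
    unfolding linear_map_def
  proof (intro conjI ballI allI)
    fix u v assume uv: "u \<in> qspace Y" "v \<in> qspace Y"
    have "T (?S u + ?S v) = u + v" using T S[OF uv(1)] S[OF uv(2)] unfolding linear_map_def by simp
    then show "?S (u + v) = ?S u + ?S v"
      using inv[OF quasi_normed_spaceD(2)[OF X S(1)[OF uv(1)] S(1)[OF uv(2)]]] by simp
  next
    fix c u assume u: "u \<in> qspace Y"
    have "T (qscale X c (?S u)) = qscale Y c u" using T S[OF u] unfolding linear_map_def by simp
    then show "?S (qscale Y c u) = qscale X c (?S u)"
      using inv[OF quasi_normed_spaceD(4)[OF X S(1)[OF u]], of c] by simp
  qed (use S in blast)
qed

lemma not_isomorphic_Z2:
  assumes "\<alpha> \<noteq> \<beta>" shows "\<not> isomorphic (Z2 \<alpha>) (Z2 \<beta>)"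
proof
  assume "isomorphic (Z2 \<alpha>) (Z2 \<beta>)"
  then obtain T where "isomorphism (Z2 \<alpha>) (Z2 \<beta>) T" unfolding isomorphic_def by (elim exE)
  from isomorphism_bounds[OF quasi_normed_space_Z2 quasi_normed_space_Z2 this]
  obtain M where M: "0 \<le> M" "\<forall>x\<in>qspace (Z2 \<alpha>). qnorm (Z2 \<beta>) (T x) \<le> M * qnorm (Z2 \<alpha>) x"
    "\<forall>x\<in>qspace (Z2 \<alpha>). qnorm (Z2 \<alpha>) x \<le> M * qnorm (Z2 \<beta>) (T x)"
    and T: "linear_map (Z2 \<alpha>) (Z2 \<beta>) T" "bij_betw T (qspace (Z2 \<alpha>)) (qspace (Z2 \<beta>))"
    by metis
  show False
  proof (cases "\<alpha> = 0")
    case False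
    then show False using no_embedding[OF T(1) M(1)] M(2,3) assms by blast
  next
    case True
    let ?S = "inv_into (qspace (Z2 \<alpha>)) T"
    have S: "?S y \<in> qspace (Z2 \<alpha>)" "T (?S y) = y" if "y \<in> qspace (Z2 \<beta>)" for y
      using that T(2) by (metis bij_betw_def inv_into_into, metis bij_betw_inv_into_right)
    have b: "qnorm (Z2 \<alpha>) (?S y) \<le> M * qnorm (Z2 \<beta>) y" "qnorm (Z2 \<beta>) y \<le> M * qnorm (Z2 \<alpha>) (?S y)"
      if "y \<in> qspace (Z2 \<beta>)" for y
      using M(2)[rule_format, OF S(1)[OF that]] M(3)[rule_format, OF S(1)[OF that]] S(2)[OF that] by simp_all
    show False
      by (rule no_embedding[OF linear_map_inv[OF quasi_normed_space_Z2 T] M(1) b]) (use True assms in auto)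
  qed
qed

theorem proposition6p8:
  shows "(\<forall>\<alpha>::real. singular_exact_sequence l2 (Z2 \<alpha>) l2 (\<lambda>y. (y, 0)) (\<lambda>(w, x). x)) \<and>
         (\<forall>\<alpha> \<beta>::real. \<alpha> \<noteq> \<beta> \<longrightarrow> \<not> isomorphic (Z2 \<alpha>) (Z2 \<beta>))"
  by (simp add: singular_exact_sequence_def short_exact_Z2 strictly_singular_Z2 not_isomorphic_Z2)

end
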